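(* Let $\mathfrak g$ be a simple complex Lie algebra, $f\in\mathfrak g$ nilpotent, and $\{e,h,f\}$ an $sl_2$-triple. The reduced second Poisson bracket $\{.,.\}_2^Q$ on $Q=e+\mathfrak L(\mathfrak g_f)$ is independent of the choice of a good grading $\Gamma$ for $f$ (compatible with $\{e,h,f\}$) and of an isotropic subspace $\mathfrak l\subset\mathfrak g_{-1}$ used in its construction.
   Context: A good grading for $f$ is a $\mathbb Z$-grading $\mathfrak g=\oplus_{i}\mathfrak g_i$, $[\mathfrak g_i,\mathfrak g_j]\subset\mathfrak g_{i+j}$, with $f\in\mathfrak g_{-2}$ and $\mathrm{ad}\,f:\mathfrak g_j\to\mathfrak g_{j-2}$ injective for $j\ge1$ and surjective for $j\le1$. The $sl_2$-triple satisfies $[h,e]=2e$, $[h,f]=-2f$, $[e,f]=h$; it is compatible with $\Gamma$ if $h\in\mathfrak g_0$, $e\in\mathfrak g_2$. $\langle\cdot|\cdot\rangle$ is the Killing form. On $\mathfrak g_{-1}$ one has the symplectic form $(x,y)=\langle e|[x,y]\rangle$; $\mathfrak l'$ is the symplectic complement of $\mathfrak l$, $\mathfrak m=\mathfrak l\oplus\bigoplus_{i\le-2}\mathfrak g_i$, $\mathfrak n=\mathfrak l'\oplus\bigoplus_{i\le-2}\mathfrak g_i$, $\mathfrak b=\mathfrak n^{\perp}$ (Killing orthogonal), $\mathfrak g_f=\ker\mathrm{ad}\,f$. $\mathfrak L(V)$ is the space of smooth maps $S^1\to V$; $(u|v)=\int_{S^1}\langle u(x)|v(x)\rangle dx$ identifies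 $\mathfrak L(\mathfrak g)$ with its (regular) dual. $\{.,.\}_2$ is the Poisson bracket on $\mathfrak L(\mathfrak g)$ with Poisson tensor $P_2(q)(v)=v_x+[q,v]$. Put $S=e+\mathfrak L(\mathfrak b)$, $D_z=P_2(z)(\mathfrak L(\mathfrak n))$ and $E_z=D_z\cap\mathfrak L(\mathfrak b)$ for $z\in S$. The leaves of $E$ on $S$ are the orbits of the adjoint group of $\mathfrak L(\mathfrak m)$ acting by $s+e\mapsto\exp(-\mathrm{ad}\,m)[\partial_x+s+e]-\partial_x$, $m\in\mathfrak L(\mathfrak m)$, and $Q=e+\mathfrak L(\mathfrak g_f)\subset S$ is transverse to them and meets each exactly once; let $\rho:S\to Q$ be the resulting projection. The reduced second bracket constructed from $(\Gamma,\mathfrak l)$ is $\{\phi,\psi\}_2^Q=\{F,G\}_2|_Q$, where $F,G$ are functionals on $\mathfrak L(\mathfrak g)$ with $F|_S=\phi\circ\rho$, $G|_S=\psi\circ\rho$ that are constant along $D$. *)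

theory Defs
  imports "HOL-Analysis.Analysis"
begin

section \<open>Finite-dimensional Lie algebras\<close>

text \<open>A complex Lie algebra of dimension \<open>CARD('n)\<close> is given by a bracket \<open>br\<close> on the
  space \<open>complex^'n\<close>; complex subspaces, linear maps and spans are those of the
  interpretation \<open>vec\<close> for the scalar multiplication \<open>*s\<close>.\<close>

type_synonym 'n bracket = "complex^'n \<Rightarrow> complex^'n \<Rightarrow> complex^'n"
type_synonym 'n loop = "real \<Rightarrow> complex^'n"

definition lie_algebra :: "'n::finite bracket \<Rightarrow> bool" where
  "lie_algebra br \<longleftrightarrow>
     (\<forall>x. Vector_Spaces.linear (*s) (*s) (\<lambda>y. br x y)) \<and>
     (\<forall>y. Vector_Spaces.linear (*s) (*s) (\<lambda>x. br x y)) \<and>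
     (\<forall>x. br x x = 0) \<and>
     (\<forall>x y z. br x (br y z) + br y (br z x) + br z (br x y) = 0)"

definition lie_ideal :: "'n::finite bracket \<Rightarrow> (complex^'n) set \<Rightarrow> bool" where
  "lie_ideal br I \<longleftrightarrow> vec.subspace I \<and> (\<forall>x. \<forall>y\<in>I. br x y \<in> I)"

definition simple_lie_algebra :: "'n::finite bracket \<Rightarrow> bool" where
  "simple_lie_algebra br \<longleftrightarrow>
     lie_algebra br \<and> (\<exists>x y. br x y \<noteq> 0) \<and> (\<forall>I. lie_ideal br I \<longrightarrow> I = {0} \<or> I = UNIV)"

definition ad_nilpotent :: "'n::finite bracket \<Rightarrow> complex^'n \<Rightarrow> bool" where
  "ad_nilpotent br a \<longleftrightarrow> (\<exists>k. \<forall>x. (br a ^^ k) x = 0)"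

definition killing :: "'n::finite bracket \<Rightarrow> complex^'n \<Rightarrow> complex^'n \<Rightarrow> complex" where
  "killing br x y = trace (matrix (\<lambda>z. br x (br y z)))"

definition sl2_triple :: "'n::finite bracket \<Rightarrow> complex^'n \<Rightarrow> complex^'n \<Rightarrow> complex^'n \<Rightarrow> bool" where
  "sl2_triple br e h f \<longleftrightarrow> br h e = 2 *s e \<and> br h f = (-2) *s f \<and> br e f = h"

definition centralizer :: "'n::finite bracket \<Rightarrow> complex^'n \<Rightarrow> (complex^'n) set" where
  "centralizer br a = {x. br a x = 0}"


section \<open>Good gradings and the associated subalgebras\<close>

definition lie_grading :: "'n::finite bracket \<Rightarrow> (int \<Rightarrow> (complex^'n) set) \<Rightarrow> bool" where
  "lie_grading br \<Gamma> \<longleftrightarrow>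
     (\<forall>i. vec.subspace (\<Gamma> i)) \<and>
     (\<forall>x. \<exists>!c. (\<forall>i. c i \<in> \<Gamma> i) \<and> finite {i. c i \<noteq> 0} \<and> x = (\<Sum>i | c i \<noteq> 0. c i)) \<and>
     (\<forall>i j. \<forall>x\<in>\<Gamma> i. \<forall>y\<in>\<Gamma> j. br x y \<in> \<Gamma> (i + j))"

definition good_grading :: "'n::finite bracket \<Rightarrow> complex^'n \<Rightarrow> (int \<Rightarrow> (complex^'n) set) \<Rightarrow> bool" where
  "good_grading br f \<Gamma> \<longleftrightarrow>
     lie_grading br \<Gamma> \<and> f \<in> \<Gamma> (-2) \<and>
     (\<forall>j\<ge>1. inj_on (br f) (\<Gamma> j)) \<and>
     (\<forall>j\<le>1. br f ` \<Gamma> j = \<Gamma> (j - 2))"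

definition compatible_grading ::
  "complex^'n \<Rightarrow> complex^'n \<Rightarrow> (int \<Rightarrow> (complex^'n) set) \<Rightarrow> bool" where
  "compatible_grading e h \<Gamma> \<longleftrightarrow> h \<in> \<Gamma> 0 \<and> e \<in> \<Gamma> 2"

definition sympl :: "'n::finite bracket \<Rightarrow> complex^'n \<Rightarrow> complex^'n \<Rightarrow> complex^'n \<Rightarrow> complex" where
  "sympl br e x y = killing br e (br x y)"

definition isotropic ::
  "'n::finite bracket \<Rightarrow> complex^'n \<Rightarrow> (int \<Rightarrow> (complex^'n) set)
     \<Rightarrow> (complex^'n) set \<Rightarrow> bool" where
  "isotropic br e \<Gamma> l \<longleftrightarrow>
     vec.subspace l \<and> l \<subseteq> \<Gamma> (-1) \<and> (\<forall>x\<in>l. \<forall>y\<in>l. sympl br e x y = 0)"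

definition sympl_compl ::
  "'n::finite bracket \<Rightarrow> complex^'n \<Rightarrow> (int \<Rightarrow> (complex^'n) set)
     \<Rightarrow> (complex^'n) set \<Rightarrow> (complex^'n) set" where
  "sympl_compl br e \<Gamma> l = {x \<in> \<Gamma> (-1). \<forall>y\<in>l. sympl br e x y = 0}"

definition m_alg :: "(int \<Rightarrow> (complex^'n) set) \<Rightarrow> (complex^'n) set \<Rightarrow> (complex^'n) set" where
  "m_alg \<Gamma> l = vec.span (l \<union> (\<Union>i\<in>{..-2}. \<Gamma> i))"

definition n_alg ::
  "'n::finite bracket \<Rightarrow> complex^'n \<Rightarrow> (int \<Rightarrow> (complex^'n) set)
     \<Rightarrow> (complex^'n) set \<Rightarrow> (complex^'n) set" where
  "n_alg br e \<Gamma> l = vec.span (sympl_compl br e \<Gamma> l \<union> (\<Union>i\<in>{..-2}. \<Gamma> i))"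

definition b_space ::
  "'n::finite bracket \<Rightarrow> complex^'n \<Rightarrow> (int \<Rightarrow> (complex^'n) set)
     \<Rightarrow> (complex^'n) set \<Rightarrow> (complex^'n) set" where
  "b_space br e \<Gamma> l = {x. \<forall>y\<in>n_alg br e \<Gamma> l. killing br x y = 0}"


section \<open>Loop spaces and functionals\<close>

primrec ck_map :: "nat \<Rightarrow> ('a::euclidean_space \<Rightarrow> 'b::real_normed_vector) \<Rightarrow> bool" where
  "ck_map 0 f \<longleftrightarrow> continuous_on UNIV f"
| "ck_map (Suc k) f \<longleftrightarrow>
     (\<exists>f'. (\<forall>x. (f has_derivative f' x) (at x)) \<and> (\<forall>v. ck_map k (\<lambda>x. f' x v)))"

definition smooth_map :: "('a::euclidean_space \<Rightarrow> 'b::real_normed_vector) \<Rightarrow> bool" where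
  "smooth_map f \<longleftrightarrow> (\<forall>k. ck_map k f)"

text \<open>Maps on the circle \<open>S\<^sup>1 = \<real>/2\<pi>\<int>\<close> are \<open>2\<pi>\<close>-periodic maps on the real line.\<close>

definition loops :: "(complex^'n) set \<Rightarrow> 'n loop set" where
  "loops V = {q. smooth_map q \<and> (\<forall>x. q (x + 2 * pi) = q x) \<and> (\<forall>x. q x \<in> V)}"

definition loop_deriv :: "'n loop \<Rightarrow> real \<Rightarrow> complex^'n" where
  "loop_deriv v x = vector_derivative v (at x)"

definition pairing :: "'n::finite bracket \<Rightarrow> 'n loop \<Rightarrow> 'n loop \<Rightarrow> complex" where
  "pairing br u v = integral {0..2 * pi} (\<lambda>x. killing br (u x) (v x))"

definition affine_loops :: "complex^'n \<Rightarrow> (complex^'n) set \<Rightarrow> 'n loop set" where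
  "affine_loops a V = (\<lambda>s x. a + s x) ` loops V"

text \<open>A smooth curve in the Frechet space of loops is the same thing as a family of loops that
  is jointly smooth in the parameter and the loop variable.\<close>

definition smooth_curve_in :: "'n loop set \<Rightarrow> (real \<Rightarrow> real \<Rightarrow> complex^'n) \<Rightarrow> bool" where
  "smooth_curve_in M \<gamma> \<longleftrightarrow> smooth_map (\<lambda>p. \<gamma> (fst p) (snd p)) \<and> (\<forall>t. \<gamma> t \<in> M)"

text \<open>A functional on \<open>M\<close> is a complex-valued function whose differential exists at each point
  (along all smooth curves in \<open>M\<close>) and lies in the regular dual, i.e. is represented through
  the pairing by a smooth loop. Outside \<open>M\<close> its values are irrelevant.
  If \<open>M\<close> is a proper affine subspace the representing loop is not unique; only for the full
  loop space is it called the gradient.\<close>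

definition represents_differential :: "'n::finite bracket \<Rightarrow> 'n loop set \<Rightarrow> ('n loop \<Rightarrow> complex) \<Rightarrow> 'n loop \<Rightarrow> 'n loop \<Rightarrow> bool" where
  "represents_differential br M F q v \<longleftrightarrow>
     v \<in> loops UNIV \<and>
     (\<forall>\<gamma>. smooth_curve_in M \<gamma> \<and> \<gamma> 0 = q \<longrightarrow>
        ((\<lambda>t. F (\<gamma> t)) has_vector_derivative
           pairing br v (\<lambda>x. vector_derivative (\<lambda>t. \<gamma> t x) (at 0))) (at 0))"

definition functional_on :: "'n::finite bracket \<Rightarrow> 'n loop set \<Rightarrow> ('n loop \<Rightarrow> complex) \<Rightarrow> bool" where
  "functional_on br M F \<longleftrightarrow> (\<forall>q\<in>M. \<exists>v. represents_differential br M F q v)"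

definition gradient ::
  "'n::finite bracket \<Rightarrow> ('n loop \<Rightarrow> complex) \<Rightarrow> 'n loop \<Rightarrow> 'n loop" where
  "gradient br F q = (SOME v. represents_differential br (loops UNIV) F q v)"


section \<open>The second bracket and its reduction\<close>

definition P2 ::
  "'n::finite bracket \<Rightarrow> 'n loop \<Rightarrow> 'n loop \<Rightarrow> 'n loop" where
  "P2 br q v = (\<lambda>x. loop_deriv v x + br (q x) (v x))"

definition bracket2 ::
  "'n::finite bracket \<Rightarrow> ('n loop \<Rightarrow> complex)
     \<Rightarrow> ('n loop \<Rightarrow> complex) \<Rightarrow> 'n loop \<Rightarrow> complex" where
  "bracket2 br F G q = pairing br (gradient br F q) (P2 br q (gradient br G q))"

definition S_space :: "'n::finite bracket \<Rightarrow> complex^'n \<Rightarrow> (int \<Rightarrow> (complex^'n) set) \<Rightarrow> (complex^'n) set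
     \<Rightarrow> 'n loop set" where
  "S_space br e \<Gamma> l = affine_loops e (b_space br e \<Gamma> l)"

definition Q_space :: "'n::finite bracket \<Rightarrow> complex^'n \<Rightarrow> complex^'n \<Rightarrow> 'n loop set" where
  "Q_space br e f = affine_loops e (centralizer br f)"

definition D_dist :: "'n::finite bracket \<Rightarrow> complex^'n \<Rightarrow> (int \<Rightarrow> (complex^'n) set) \<Rightarrow> (complex^'n) set
     \<Rightarrow> 'n loop \<Rightarrow> 'n loop set" where
  "D_dist br e \<Gamma> l z = P2 br z ` loops (n_alg br e \<Gamma> l)"

text \<open>The pair \<open>(c, u)\<close> stands for the operator \<open>c \<partial>\<^sub>x + u\<close>; since \<open>[m, \<partial>\<^sub>x] = - m\<^sub>x\<close>, one has
  \<open>[m, c \<partial>\<^sub>x + u] = [m, u] - c m\<^sub>x\<close>.\<close>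

definition ad_op :: "'n::finite bracket \<Rightarrow> 'n loop \<Rightarrow> complex \<times> 'n loop \<Rightarrow> complex \<times> 'n loop" where
  "ad_op br m = (\<lambda>(c, u). (0, \<lambda>x. br (m x) (u x) - c *s loop_deriv m x))"

text \<open>The loop part of \<open>exp (- ad m)(\<partial>\<^sub>x + z)\<close>; the coefficient of \<open>\<partial>\<^sub>x\<close> stays equal to \<open>1\<close>, so
  that taking this part amounts to subtracting \<open>\<partial>\<^sub>x\<close>.\<close>

definition gauge_action :: "'n::finite bracket \<Rightarrow> 'n loop \<Rightarrow> 'n loop \<Rightarrow> 'n loop" where
  "gauge_action br m z =
     (\<lambda>x. \<Sum>k. snd ((ad_op br (\<lambda>y. - m y) ^^ k) (1, z)) x /\<^sub>R fact k)"

text \<open>The projection \<open>\<rho>\<close>. The algebra of loops in \<open>m\<close> is nilpotent, so its adjoint group consists of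
  the exponentials, and the orbit of \<open>z\<close> is the set of all \<open>gauge_action br m z\<close>.\<close>

definition Q_proj :: "'n::finite bracket \<Rightarrow> complex^'n \<Rightarrow> complex^'n \<Rightarrow> (int \<Rightarrow> (complex^'n) set)
     \<Rightarrow> (complex^'n) set \<Rightarrow> 'n loop \<Rightarrow> 'n loop" where
  "Q_proj br e f \<Gamma> l z =
     (THE q. q \<in> Q_space br e f \<and> (\<exists>m\<in>loops (m_alg \<Gamma> l). q = gauge_action br m z))"

text \<open>\<open>F\<close> extends \<open>\<phi> \<circ> \<rho>\<close> from \<open>S\<close> to the loop space and its differential annihilates the
  distribution \<open>D\<close>, which is defined along \<open>S\<close> but need not be tangent to \<open>S\<close>.\<close>

definition adapted_extension :: "'n::finite bracket \<Rightarrow> complex^'n \<Rightarrow> complex^'n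
     \<Rightarrow> (int \<Rightarrow> (complex^'n) set) \<Rightarrow> (complex^'n) set
     \<Rightarrow> ('n loop \<Rightarrow> complex) \<Rightarrow> ('n loop \<Rightarrow> complex) \<Rightarrow> bool" where
  "adapted_extension br e f \<Gamma> l \<phi> F \<longleftrightarrow>
     functional_on br (loops UNIV) F \<and>
     (\<forall>z\<in>S_space br e \<Gamma> l. F z = \<phi> (Q_proj br e f \<Gamma> l z)) \<and>
     (\<forall>z\<in>S_space br e \<Gamma> l. \<forall>w\<in>D_dist br e \<Gamma> l z. pairing br (gradient br F z) w = 0)"

definition reduced_bracket2 :: "'n::finite bracket \<Rightarrow> complex^'n \<Rightarrow> complex^'n
     \<Rightarrow> (int \<Rightarrow> (complex^'n) set) \<Rightarrow> (complex^'n) set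
     \<Rightarrow> ('n loop \<Rightarrow> complex) \<Rightarrow> ('n loop \<Rightarrow> complex) \<Rightarrow> 'n loop \<Rightarrow> complex" where
  "reduced_bracket2 br e f \<Gamma> l \<phi> \<psi> q =
     (THE c. \<exists>F G. adapted_extension br e f \<Gamma> l \<phi> F \<and> adapted_extension br e f \<Gamma> l \<psi> G \<and>
                   c = bracket2 br F G q)"

end

theory Submission
  imports Defs
begin

text \<open>
  If \<open>f = 0\<close>, the grading is concentrated in degree \<open>0\<close> and there is nothing to choose. Otherwise
  \<open>ad h\<close> is diagonalizable with real eigenvalues, so \<open>\<langle>h | h\<rangle> \<noteq> 0\<close> and the Killing form of the simple
  algebra is nondegenerate.

  Independence: let \<open>F\<close>, \<open>G\<close> be adapted extensions of \<open>\<phi>\<close>, \<open>\<psi>\<close>. Since \<open>d\<^sub>q G\<close> annihilates \<open>D\<^sub>q\<close>, the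
  vector \<open>P\<^sub>2(q)(d\<^sub>q G)\<close> lies in \<open>L(b) = L(g\<^sub>f) + P\<^sub>2(q)(L(m))\<close>, and on \<open>L(b)\<close> the covector \<open>d\<^sub>q F\<close> agrees
  with any lift \<open>v'\<close> of \<open>d\<^sub>q \<phi>\<close> for which \<open>P\<^sub>2(q) v'\<close> is tangent to \<open>Q\<close>. Such a lift exists, its
  defining conditions involve neither the grading nor \<open>l\<close>, and the bracket equals \<open>- \<langle>d\<^sub>q \<psi>, P\<^sub>2(q) v'\<rangle>\<close>.

  Existence of adapted extensions: every \<open>z\<close> in \<open>e + L(g\<^bsub>\<le>1\<^esub>)\<close> has a unique gauge transform by
  \<open>L(g\<^bsub><0\<^esub>)\<close> in \<open>Q\<close>; it is found by a fixed-point iteration that is contracting for the grading, hence is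
  a differential polynomial in \<open>z\<close>. Composed with the projection onto \<open>e + L(g\<^bsub>\<le>1\<^esub>)\<close> it gives a map of
  the whole loop space onto \<open>Q\<close> that extends \<open>\<rho>\<close> and is constant to first order along \<open>P\<^sub>2(z)(L(g\<^bsub><0\<^esub>))\<close>,
  which contains \<open>D\<^sub>z\<close>; pulling \<open>\<phi>\<close> back along this map yields an adapted extension.
\<close>

section \<open>Smooth maps\<close>

text \<open>The reduced bracket is a definite description, so a formula valid for all adapted
  extensions settles nothing until one extension is known to exist; much of the development serves
  this. The obstacle is that \<open>D\<close> comes from \<open>n\<close> and need not be tangent to
  \<open>S\<close>, so prescribing \<open>F\<close> on \<open>S\<close> does not control its
  differential along \<open>D\<close>. The remedy is to replace \<open>S\<close> by the affine space
  \<open>e + L(low 1)\<close>: it contains \<open>S\<close> for every choice of \<open>l\<close>,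
  all of \<open>P2 z\<close> applied to loops in \<open>low (-1)\<close> is tangent to it, and
  \<open>n\<close> lies in \<open>low (-1)\<close>. A second obstacle is regularity: a differential
  must be represented by a smooth loop, which mere differentiability of the gauge fixing would not
  give. Brackets, linear maps and x-derivatives all have adjoints for the pairing, and a fixed
  finite number of them suffices to build the gauge fixing, so representing loops can be pulled back
  along it. A smooth curve of loops is a smooth function of two real variables, so
  finite-dimensional calculus is enough throughout.\<close>

lemma ck_map_Suc_D: "ck_map (Suc k) f \<Longrightarrow> ck_map k f"
proof (induction k arbitrary: f)
  case 0
  then show ?case
    by (auto simp: continuous_on_eq_continuous_within intro: has_derivative_continuous)
next
  case (Suc k)
  then show ?case by (metis ck_map.simps(2))
qed

lemma ck_map_const: "ck_map k (\<lambda>x. c)"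
proof (induction k arbitrary: c)
  case (Suc k)
  then show ?case by (auto intro!: exI[of _ "\<lambda>x v. 0"])
qed auto

lemma ck_map_add: "ck_map k f \<Longrightarrow> ck_map k g \<Longrightarrow> ck_map k (\<lambda>x. f x + g x)"
proof (induction k arbitrary: f g)
  case 0 then show ?case by (auto intro: continuous_intros)
next
  case (Suc k)
  then obtain f' g' where "\<And>x. (f has_derivative f' x) (at x)" "\<And>v. ck_map k (\<lambda>x. f' x v)"
    "\<And>x. (g has_derivative g' x) (at x)" "\<And>v. ck_map k (\<lambda>x. g' x v)" by auto
  then show ?case
    by (auto intro!: exI[of _ "\<lambda>x v. f' x v + g' x v"] has_derivative_add Suc.IH)
qed

lemma ck_map_bounded_linear: "bounded_linear L \<Longrightarrow> ck_map k f \<Longrightarrow> ck_map k (\<lambda>x. L (f x))"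
proof (induction k arbitrary: f)
  case 0 then show ?case by (auto intro: bounded_linear.continuous_on)
next
  case (Suc k)
  then obtain f' where f': "\<And>x. (f has_derivative f' x) (at x)" "\<And>v. ck_map k (\<lambda>x. f' x v)"
    by auto
  have "((\<lambda>x. L (f x)) has_derivative (\<lambda>v. L (f' x v))) (at x)" for x
    by (rule bounded_linear.has_derivative[OF Suc.prems(1) f'(1)])
  then show ?case using Suc.IH[OF Suc.prems(1)] f'(2)
    by (auto intro!: exI[of _ "\<lambda>x v. L (f' x v)"])
qed

lemma (in bounded_bilinear) ck_map_prod:
  "ck_map k f \<Longrightarrow> ck_map k g \<Longrightarrow> ck_map k (\<lambda>x. prod (f x) (g x))"
proof (induction k arbitrary: f g)
  case 0 then show ?case by (auto intro: continuous_on)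
next
  case (Suc k)
  then obtain f' g' where d: "\<And>x. (f has_derivative f' x) (at x)" "\<And>v. ck_map k (\<lambda>x. f' x v)"
    "\<And>x. (g has_derivative g' x) (at x)" "\<And>v. ck_map k (\<lambda>x. g' x v)" by auto
  moreover have "ck_map k f" "ck_map k g" using Suc.prems ck_map_Suc_D by auto
  ultimately show ?case
    by (auto intro!: exI[of _ "\<lambda>x v. prod (f x) (g' x v) + prod (f' x v) (g x)"] ck_map_add Suc.IH FDERIV)
qed

lemma ck_map_compose_affine:
  fixes L :: "'a::euclidean_space \<Rightarrow> 'b::euclidean_space"
  assumes "bounded_linear L" shows "ck_map k f \<Longrightarrow> ck_map k (\<lambda>x. f (a + L x))"
proof (induction k arbitrary: f)
  case 0
  have "continuous_on UNIV (\<lambda>x. a + L x)"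
    by (intro continuous_intros linear_continuous_on assms)
  with 0 show ?case by (auto intro: continuous_on_compose2)
next
  case (Suc k)
  then obtain f' where f': "\<And>x. (f has_derivative f' x) (at x)" "\<And>v. ck_map k (\<lambda>x. f' x v)"
    by auto
  have "((\<lambda>x. f (a + L x)) has_derivative (\<lambda>v. f' (a + L x) (L v))) (at x)" for x
    by (rule has_derivative_compose[where g = f and f = "\<lambda>x. a + L x"])
      (auto intro!: derivative_eq_intros f' bounded_linear_imp_has_derivative assms)
  then show ?case using Suc.IH f'(2)
    by (auto intro!: exI[of _ "\<lambda>x v. f' (a + L x) (L v)"])
qed

lemma smooth_map_const [intro]: "smooth_map (\<lambda>x. c)"
  by (auto simp: smooth_map_def ck_map_const)

lemma smooth_map_add [intro]: "smooth_map f \<Longrightarrow> smooth_map g \<Longrightarrow> smooth_map (\<lambda>x. f x + g x)"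
  by (auto simp: smooth_map_def ck_map_add)

lemma smooth_map_bounded_linear: "bounded_linear L \<Longrightarrow> smooth_map f \<Longrightarrow> smooth_map (\<lambda>x. L (f x))"
  by (auto simp: smooth_map_def ck_map_bounded_linear)

lemma smooth_map_minus [intro]: "smooth_map f \<Longrightarrow> smooth_map (\<lambda>x. - f x)"
  using smooth_map_bounded_linear[OF bounded_linear_minus[OF bounded_linear_ident]] by auto

lemma smooth_map_diff [intro]: "smooth_map f \<Longrightarrow> smooth_map g \<Longrightarrow> smooth_map (\<lambda>x. f x - g x)"
  using smooth_map_add[OF _ smooth_map_minus, of f g] by simp

lemma (in bounded_bilinear) smooth_map_prod:
  "smooth_map f \<Longrightarrow> smooth_map g \<Longrightarrow> smooth_map (\<lambda>x. prod (f x) (g x))"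
  by (auto simp: smooth_map_def ck_map_prod)

lemma smooth_map_compose_affine:
  fixes L :: "'a::euclidean_space \<Rightarrow> 'b::euclidean_space"
  assumes "bounded_linear L" "smooth_map f" shows "smooth_map (\<lambda>x. f (a + L x))"
  using assms by (auto simp: smooth_map_def ck_map_compose_affine)

lemma smooth_map_compose_linear:
  fixes L :: "'a::euclidean_space \<Rightarrow> 'b::euclidean_space"
  assumes "bounded_linear L" "smooth_map f" shows "smooth_map (\<lambda>x. f (L x))"
  using smooth_map_compose_affine[OF assms, of 0] by simp

lemma smooth_map_bounded_linear_self: 
  assumes "bounded_linear L" shows "smooth_map L"
  unfolding smooth_map_def
proof
  fix k show "ck_map k L"
  proof (cases k)
    case 0 then show ?thesis using assms by (auto intro: linear_continuous_on)
  next
    case (Suc k')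
    then show ?thesis using assms
      by (auto intro!: exI[of _ "\<lambda>x v. L v"] ck_map_const bounded_linear_imp_has_derivative)
  qed
qed

section \<open>Frechet derivatives of smooth maps and their symmetry\<close>

lemma smooth_map_has_derivative:
  assumes "smooth_map f" shows "(f has_derivative frechet_derivative f (at x)) (at x)"
proof -
  have "ck_map (Suc 0) f" using assms by (simp add: smooth_map_def)
  then show ?thesis using frechet_derivative_works differentiable_def by (metis ck_map.simps(2))
qed

lemma smooth_map_continuous_on: "smooth_map f \<Longrightarrow> continuous_on A f"
  by (metis UNIV_I ck_map.simps(1) continuous_on_subset smooth_map_def subset_UNIV)

lemma smooth_map_frechet_derivative [intro]:
  assumes "smooth_map f" shows "smooth_map (\<lambda>x. frechet_derivative f (at x) v)"
  unfolding smooth_map_def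
proof
  fix k
  have "ck_map (Suc k) f" using assms by (simp add: smooth_map_def)
  then obtain f' where f': "\<And>x. (f has_derivative f' x) (at x)" "\<And>v. ck_map k (\<lambda>x. f' x v)" by auto
  have "frechet_derivative f (at x) = f' x" for x
    using f'(1) by (metis frechet_derivative_at)
  then show "ck_map k (\<lambda>x. frechet_derivative f (at x) v)" using f'(2) by simp
qed

lemma smooth_map_along_line:
  assumes "smooth_map f"
  shows "((\<lambda>t. f (a + t *\<^sub>R v)) has_vector_derivative frechet_derivative f (at (a + t *\<^sub>R v)) v) (at t)"
proof -
  interpret D: bounded_linear "frechet_derivative f (at (a + t *\<^sub>R v))"
    using smooth_map_has_derivative[OF assms] by (rule has_derivative_bounded_linear)
  have "((\<lambda>t. a + t *\<^sub>R v) has_derivative (\<lambda>s. s *\<^sub>R v)) (at t)"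
    by (auto intro!: derivative_eq_intros)
  from has_derivative_compose[OF this smooth_map_has_derivative[OF assms]]
  show ?thesis by (simp add: has_vector_derivative_def D.scaleR)
qed

text \<open>The mean value theorem is used twice, along \<open>v\<close> for the increment in
  direction \<open>w\<close>, then along \<open>w\<close> for the derivative just obtained. This is
  the classical route to the symmetry of mixed derivatives.\<close>

lemma second_difference_mvt:
  fixes f :: "'a::euclidean_space \<Rightarrow> real"
  assumes "smooth_map f" and "0 < s"
  obtains \<xi> \<eta> where "0 < \<xi>" "\<xi> < s" "0 < \<eta>" "\<eta> < s"
    "f (a + s *\<^sub>R v + s *\<^sub>R w) - f (a + s *\<^sub>R v) - f (a + s *\<^sub>R w) + f a
       = s * s * frechet_derivative (\<lambda>x. frechet_derivative f (at x) v) (at (a + \<xi> *\<^sub>R v + \<eta> *\<^sub>R w)) w"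
proof -
  define g where "g t = f (a + s *\<^sub>R w + t *\<^sub>R v) - f (a + t *\<^sub>R v)" for t
  let ?D = "\<lambda>x. frechet_derivative f (at x) v"
  have "(g has_real_derivative ?D (a + s *\<^sub>R w + t *\<^sub>R v) - ?D (a + t *\<^sub>R v)) (at t)" for t
    unfolding g_def has_real_derivative_iff_has_vector_derivative
    by (intro has_vector_derivative_diff smooth_map_along_line assms)
  from MVT2[OF \<open>0 < s\<close> this] obtain \<xi> where \<xi>: "0 < \<xi>" "\<xi> < s"
    "g s - g 0 = s * (?D (a + s *\<^sub>R w + \<xi> *\<^sub>R v) - ?D (a + \<xi> *\<^sub>R v))" by auto
  define k where "k t = ?D (a + \<xi> *\<^sub>R v + t *\<^sub>R w)" for t
  have "(k has_real_derivative frechet_derivative ?D (at (a + \<xi> *\<^sub>R v + t *\<^sub>R w)) w) (at t)" for t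
    unfolding k_def has_real_derivative_iff_has_vector_derivative
    by (intro smooth_map_along_line smooth_map_frechet_derivative assms)
  from MVT2[OF \<open>0 < s\<close> this] obtain \<eta> where \<eta>: "0 < \<eta>" "\<eta> < s"
    "k s - k 0 = s * frechet_derivative ?D (at (a + \<xi> *\<^sub>R v + \<eta> *\<^sub>R w)) w" by auto
  have "f (a + s *\<^sub>R v + s *\<^sub>R w) - f (a + s *\<^sub>R v) - f (a + s *\<^sub>R w) + f a = g s - g 0"
    by (simp add: g_def algebra_simps)
  also have "\<dots> = s * (k s - k 0)" using \<xi> by (simp add: k_def algebra_simps)
  finally have "f (a + s *\<^sub>R v + s *\<^sub>R w) - f (a + s *\<^sub>R v) - f (a + s *\<^sub>R w) + f a
    = s * s * frechet_derivative ?D (at (a + \<xi> *\<^sub>R v + \<eta> *\<^sub>R w)) w" using \<eta> by simp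
  with that \<xi> \<eta> show ?thesis by blast
qed

lemma second_difference_tendsto:
  fixes f :: "'a::euclidean_space \<Rightarrow> real"
  assumes f: "smooth_map f"
  shows "((\<lambda>s. (f (a + s *\<^sub>R v + s *\<^sub>R w) - f (a + s *\<^sub>R v) - f (a + s *\<^sub>R w) + f a) / (s * s))
     \<longlongrightarrow> frechet_derivative (\<lambda>x. frechet_derivative f (at x) v) (at a) w) (at_right 0)"
    (is "((\<lambda>s. ?q s) \<longlongrightarrow> ?H a) _")
proof (rule tendstoI)
  fix \<epsilon> :: real assume "\<epsilon> > 0"
  define H where "H = ?H"
  have "continuous_on UNIV H"
    unfolding H_def by (intro smooth_map_continuous_on smooth_map_frechet_derivative f)
  then obtain \<delta> where \<delta>: "\<delta> > 0" "\<And>x. dist x a < \<delta> \<Longrightarrow> dist (H x) (H a) < \<epsilon>"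
    using \<open>\<epsilon> > 0\<close> unfolding continuous_on_iff by blast
  \<comment> \<open>The radius keeps the intermediate point of the mean value theorem within
    \<open>\<delta>\<close> of \<open>a\<close>; the summand 1 keeps the denominator positive when
    both directions vanish.\<close>
  define r where "r = \<delta> / (norm v + norm w + 1)"
  have nn: "norm v + norm w + 1 > 0" by (smt (verit) norm_ge_zero)
  have r: "r > 0" unfolding r_def using \<delta>(1) nn by simp
  have "dist (?q s) (?H a) < \<epsilon>" if s: "0 < s" "s < r" for s
  proof -
    obtain \<xi> \<eta> where x: "0 < \<xi>" "\<xi> < s" "0 < \<eta>" "\<eta> < s"
      "f (a + s *\<^sub>R v + s *\<^sub>R w) - f (a + s *\<^sub>R v) - f (a + s *\<^sub>R w) + f a
       = s * s * ?H (a + \<xi> *\<^sub>R v + \<eta> *\<^sub>R w)"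
      using second_difference_mvt[OF f s(1)] by blast
    have "norm (\<xi> *\<^sub>R v + \<eta> *\<^sub>R w) \<le> \<xi> * norm v + \<eta> * norm w"
      using norm_triangle_ineq[of "\<xi> *\<^sub>R v" "\<eta> *\<^sub>R w"] x by simp
    also have "\<dots> \<le> s * norm v + s * norm w" using x by (intro add_mono mult_right_mono) auto
    also have "\<dots> < s * (norm v + norm w + 1)" using s by (simp add: algebra_simps)
    also have "\<dots> < r * (norm v + norm w + 1)" using s nn by (intro mult_strict_right_mono)
    also have "\<dots> = \<delta>" using nn by (simp add: r_def)
    finally have "dist (a + \<xi> *\<^sub>R v + \<eta> *\<^sub>R w) a < \<delta>" by (simp add: dist_norm algebra_simps)
    from \<delta>(2)[OF this] show ?thesis using x(5) s(1) by (simp add: H_def)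
  qed
  then show "\<forall>\<^sub>F s in at_right 0. dist (?q s) (?H a) < \<epsilon>"
    unfolding eventually_at_right_field using r by blast
qed

lemma smooth_map_frechet_bounded_linear:
  assumes "bounded_linear L" "smooth_map f"
  shows "frechet_derivative (\<lambda>x. L (f x)) (at x) v = L (frechet_derivative f (at x) v)"
proof -
  have "((\<lambda>x. L (f x)) has_derivative (\<lambda>v. L (frechet_derivative f (at x) v))) (at x)"
    using bounded_linear.has_derivative[OF assms(1) smooth_map_has_derivative[OF assms(2)]] .
  then show ?thesis by (metis frechet_derivative_at)
qed

text \<open>The second difference is symmetric in \<open>v\<close> and \<open>w\<close>, hence so is
  its limit. The mean value theorem is about real functions, which is why the claim is tested on
  coordinates.\<close>

lemma smooth_map_symmetric_derivative:
  fixes f :: "'a::euclidean_space \<Rightarrow> 'b::euclidean_space"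
  assumes f: "smooth_map f"
  shows "frechet_derivative (\<lambda>x. frechet_derivative f (at x) v) (at a) w
       = frechet_derivative (\<lambda>x. frechet_derivative f (at x) w) (at a) v"
proof (rule euclidean_eqI)
  fix b :: 'b assume "b \<in> Basis"
  have L: "bounded_linear (\<lambda>x. x \<bullet> b)" by (rule bounded_linear_inner_left)
  let ?f = "\<lambda>x. f x \<bullet> b"
  have sf: "smooth_map ?f" by (rule smooth_map_bounded_linear[OF L f])
  have 1: "frechet_derivative (\<lambda>x. frechet_derivative ?f (at x) v) (at a) w
     = frechet_derivative (\<lambda>x. frechet_derivative f (at x) v) (at a) w \<bullet> b" for v w
    unfolding smooth_map_frechet_bounded_linear[OF L f]
    by (rule smooth_map_frechet_bounded_linear[OF L smooth_map_frechet_derivative[OF f]])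
  have "frechet_derivative (\<lambda>x. frechet_derivative ?f (at x) v) (at a) w
     = frechet_derivative (\<lambda>x. frechet_derivative ?f (at x) w) (at a) v"
  proof (rule tendsto_unique[OF _ second_difference_tendsto[OF sf, of a v w]])
    have "?f (a + s *\<^sub>R w + s *\<^sub>R v) - ?f (a + s *\<^sub>R w) - ?f (a + s *\<^sub>R v) + ?f a
        = ?f (a + s *\<^sub>R v + s *\<^sub>R w) - ?f (a + s *\<^sub>R v) - ?f (a + s *\<^sub>R w) + ?f a" for s
      by (simp add: add.assoc add.commute[of "s *\<^sub>R w"])
    with second_difference_tendsto[OF sf, of a w v]
    show "((\<lambda>s. (?f (a + s *\<^sub>R v + s *\<^sub>R w) - ?f (a + s *\<^sub>R v) - ?f (a + s *\<^sub>R w) + ?f a) / (s * s))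
     \<longlongrightarrow> frechet_derivative (\<lambda>x. frechet_derivative ?f (at x) w) (at a) v) (at_right 0)"
      by (simp only:)
  qed simp
  then show "frechet_derivative (\<lambda>x. frechet_derivative f (at x) v) (at a) w \<bullet> b
       = frechet_derivative (\<lambda>x. frechet_derivative f (at x) w) (at a) v \<bullet> b"
    by (simp add: 1)
qed

section \<open>Representations of sl(2)\<close>

text \<open>Only operators on a vector space are fixed, not elements of a Lie algebra, so that
  exchanging \<open>e\<close> and \<open>f\<close> gives another instance. The common exponent
  \<open>N\<close> is what a grading supplies, and it replaces the usual search for highest weight
  vectors.\<close>

locale sl2_rep =
  e: Vector_Spaces.linear "(*s)" "(*s)" e +
  f: Vector_Spaces.linear "(*s)" "(*s)" f +
  h: Vector_Spaces.linear "(*s)" "(*s)" h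
  for e f h :: "complex^'n::finite \<Rightarrow> complex^'n" +
  fixes N :: nat
  assumes comm_he: "h (e x) = e (h x) + 2 *s e x"
    and comm_hf: "h (f x) = f (h x) - 2 *s f x"
    and comm_ef: "e (f x) = f (e x) + h x"
    and nilpotent_e: "(e ^^ N) x = 0"
    and nilpotent_f: "(f ^^ N) x = 0"
begin

lemma funpow_linear:
  "(e ^^ k) (x + y) = (e ^^ k) x + (e ^^ k) y" "(f ^^ k) (x + y) = (f ^^ k) x + (f ^^ k) y"
  "(e ^^ k) (x - y) = (e ^^ k) x - (e ^^ k) y" "(f ^^ k) (x - y) = (f ^^ k) x - (f ^^ k) y"
  "(e ^^ k) (c *s x) = c *s (e ^^ k) x" "(f ^^ k) (c *s x) = c *s (f ^^ k) x"
  "(e ^^ k) 0 = 0" "(f ^^ k) 0 = 0"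
  by (induction k) (auto simp: e.add f.add e.diff f.diff e.scale f.scale)

lemma h_funpow_e: "h ((e ^^ k) x) = (e ^^ k) (h x) + (2 * of_nat k) *s (e ^^ k) x"
proof (induction k)
  case (Suc k)
  have "h ((e ^^ Suc k) x) = e (h ((e ^^ k) x)) + 2 *s (e ^^ Suc k) x" by (simp add: comm_he)
  then show ?case unfolding Suc.IH e.add e.scale by (simp add: vec_eq_iff algebra_simps)
qed simp

lemma h_funpow_f: "h ((f ^^ k) x) = (f ^^ k) (h x) - (2 * of_nat k) *s (f ^^ k) x"
proof (induction k)
  case (Suc k)
  have "h ((f ^^ Suc k) x) = f (h ((f ^^ k) x)) - 2 *s (f ^^ Suc k) x" by (simp add: comm_hf)
  then show ?case unfolding Suc.IH f.diff f.scale by (simp add: vec_eq_iff algebra_simps)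
qed simp

lemma funpow_e_f:
  "(e ^^ Suc k) (f x) = f ((e ^^ Suc k) x) + of_nat (Suc k) *s (e ^^ k) (h x + of_nat k *s x)"
proof (induction k)
  case (Suc k)
  have "(e ^^ Suc (Suc k)) (f x) = e ((e ^^ Suc k) (f x))" by simp
  also have "\<dots> = e (f ((e ^^ Suc k) x)) + of_nat (Suc k) *s (e ^^ Suc k) (h x + of_nat k *s x)"
    unfolding Suc.IH e.add e.scale by simp
  also have "e (f ((e ^^ Suc k) x)) = f ((e ^^ Suc (Suc k)) x) + h ((e ^^ Suc k) x)"
    by (simp add: comm_ef)
  finally show ?case
    unfolding h_funpow_e funpow_linear by (auto simp: vec_eq_iff algebra_simps)
qed (auto simp: comm_ef)

lemma e_funpow_f:
  "e ((f ^^ Suc k) x) = (f ^^ Suc k) (e x) + of_nat (Suc k) *s (f ^^ k) (h x - of_nat k *s x)"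
proof (induction k)
  case (Suc k)
  have "e ((f ^^ Suc (Suc k)) x) = f (e ((f ^^ Suc k) x)) + h ((f ^^ Suc k) x)"
    by (simp add: comm_ef)
  also have "f (e ((f ^^ Suc k) x)) = (f ^^ Suc (Suc k)) (e x) + of_nat (Suc k) *s (f ^^ Suc k) (h x - of_nat k *s x)"
    unfolding Suc.IH f.add f.scale by simp
  finally show ?case
    unfolding h_funpow_f funpow_linear by (auto simp: vec_eq_iff algebra_simps)
qed (auto simp: comm_ef)

lemma e_funpow_f_singular:
  assumes "e x = 0" "h x = c *s x"
  shows "e ((f ^^ Suc k) x) = (of_nat (Suc k) * (c - of_nat k)) *s (f ^^ k) x"
  unfolding e_funpow_f assms funpow_linear by (simp add: vec_eq_iff algebra_simps)

text \<open>Up to a factor \<open>e\<close> maps \<open>(f ^^ Suc k) x\<close> to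
  \<open>(f ^^ k) x\<close>, and the factor vanishes only for \<open>c = k\<close>. Starting from
  \<open>(f ^^ N) x = 0\<close>, the vanishing therefore propagates down to
  \<open>x\<close>.\<close>

lemma singular_vector_0:
  assumes "e x = 0" "h x = c *s x" "\<And>k::nat. c \<noteq> of_nat k"
  shows "x = 0"
proof -
  have "(f ^^ (N - k)) x = 0" if "k \<le> N" for k
    using that
  proof (induction k)
    case (Suc k)
    then have *: "Suc (N - Suc k) = N - k" by simp
    have "e ((f ^^ (N - k)) x) = 0" using Suc by simp
    then have "(of_nat (N - k) * (c - of_nat (N - Suc k))) *s (f ^^ (N - Suc k)) x = 0"
      using e_funpow_f_singular[OF assms(1,2), of "N - Suc k"] unfolding * by simp
    moreover have "N - k \<noteq> 0" using Suc.prems by simp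
    ultimately show ?case using assms(3)[of "N - Suc k"] by (metis mult_eq_0_iff of_nat_eq_0_iff right_minus_eq vec.scale_eq_0_iff)
  qed (simp add: nilpotent_f)
  from this[of N] show ?thesis by simp
qed

text \<open>The vector is again annihilated by \<open>e\<close>, and its weight
  \<open>k - 2 (k + 1) = - k - 2\<close> is not a natural number.\<close>

lemma funpow_f_singular_0:
  assumes "e u = 0" "h u = of_nat k *s u"
  shows "(f ^^ Suc k) u = 0"
proof (rule singular_vector_0)
  show "e ((f ^^ Suc k) u) = 0" unfolding e_funpow_f_singular[OF assms] by simp
  show "h ((f ^^ Suc k) u) = (- of_nat (k + 2)) *s (f ^^ Suc k) u"
    unfolding h_funpow_f assms(2) funpow_linear by (simp add: vec_eq_iff algebra_simps)
  fix j :: nat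
  show "- of_nat (k + 2) \<noteq> (of_nat j :: complex)"
  proof
    assume "- of_nat (k + 2) = (of_nat j :: complex)"
    then have "of_nat (j + (k + 2)) = (0::complex)" by (metis add.right_inverse add.commute of_nat_add)
    then show False by (metis add_is_0 of_nat_eq_0_iff zero_neq_numeral)
  qed
qed

lemma funpow_e_f_singular:
  assumes "e u = 0" "h u = of_nat k *s u" "j \<le> k"
  shows "\<exists>c. c \<noteq> 0 \<and> (e ^^ j) ((f ^^ j) u) = c *s u"
  using assms(3)
proof (induction j)
  case 0
  then show ?case by (auto intro: exI[of _ 1])
next
  case (Suc j)
  then obtain c where c: "c \<noteq> 0" "(e ^^ j) ((f ^^ j) u) = c *s u" by auto
  have "(e ^^ Suc j) ((f ^^ Suc j) u) = (e ^^ j) (e ((f ^^ Suc j) u))"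
    by (metis comp_apply funpow_Suc_right)
  also have "\<dots> = (of_nat (Suc j) * (of_nat k - of_nat j) * c) *s u"
    unfolding e_funpow_f_singular[OF assms(1,2)] funpow_linear c by simp
  finally show ?case using c Suc.prems
    by (intro exI[of _ "of_nat (Suc j) * (of_nat k - of_nat j) * c"]) (simp del: of_nat_Suc)
qed

text \<open>Induction on the length of the \<open>e\<close>-string through \<open>y\<close>. Its top
  \<open>u = (e ^^ k) y\<close> turns out to have weight \<open>k\<close>, so \<open>f\<close>
  annihilates \<open>(f ^^ k) u\<close>; subtracting a multiple of that vector from \<open>y\<close>
  shortens the string and leaves \<open>f y\<close> unchanged.\<close>

lemma ker_e_range_f_aux: "(e ^^ k) y = 0 \<Longrightarrow> e (f y) = 0 \<Longrightarrow> f y = 0"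
proof (induction k arbitrary: y)
  case (Suc k)
  define u where "u = (e ^^ k) y"
  have eu: "e u = 0" using Suc.prems by (simp add: u_def)
  have "(e ^^ Suc k) (f y) = 0" using Suc.prems by (metis comp_apply funpow_Suc_right funpow_linear(7))
  then have "of_nat (Suc k) *s (e ^^ k) (h y + of_nat k *s y) = 0"
    using Suc.prems(1) unfolding funpow_e_f by simp
  then have "(e ^^ k) (h y + of_nat k *s y) = 0" by (metis of_nat_neq_0 vec.scale_eq_0_iff)
  then have "h u = of_nat k *s u"
    unfolding u_def h_funpow_e funpow_linear
    by (simp add: vec_eq_iff algebra_simps)
  note u = eu this
  obtain c where c: "c \<noteq> 0" "(e ^^ k) ((f ^^ k) u) = c *s u"
    using funpow_e_f_singular[OF u order.refl] by auto
  define y' where "y' = y - (1 / c) *s (f ^^ k) u"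
  have f0: "f ((f ^^ k) u) = 0" using funpow_f_singular_0[OF u] by simp
  have fy': "f y' = f y" by (simp add: y'_def f.diff f.scale f0)
  have "(e ^^ k) y' = 0" using c by (simp add: y'_def funpow_linear u_def)
  from Suc.IH[OF this] Suc.prems(2) show ?case by (simp add: fy')
qed simp

lemma ker_e_range_f: "e (f y) = 0 \<Longrightarrow> f y = 0"
  using ker_e_range_f_aux nilpotent_e by blast

text \<open>The Chevalley involution; it transfers every statement to the one with \<open>e\<close>
  and \<open>f\<close> exchanged.\<close>

lemma opposite: "sl2_rep f e (\<lambda>x. - h x) N"
proof -
  have "Vector_Spaces.linear (*s) (*s) (\<lambda>x. - h x)"
    using vec.linear_compose_neg h.linear_axioms by blast
  then show ?thesis
    unfolding sl2_rep_def sl2_rep_axioms_def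
    using e.linear_axioms f.linear_axioms h.linear_axioms nilpotent_e nilpotent_f
    by (auto simp: comm_he comm_hf comm_ef e.neg f.neg)
qed

lemma ker_f_range_e: "f (e y) = 0 \<Longrightarrow> e y = 0"
  using sl2_rep.ker_e_range_f[OF opposite] .

lemma dim_range_le: "vec.dim (range f) \<le> vec.dim (e ` range f)"
proof -
  have "inj_on e (range f)"
  proof (rule inj_onI)
    fix a b assume "a \<in> range f" "b \<in> range f" and ab: "e a = e b"
    then obtain y where y: "a - b = f y" by (metis f.diff rangeE)
    have "e (a - b) = 0" using ab by (simp add: e.diff)
    then show "a = b" using ker_e_range_f y by (metis right_minus_eq)
  qed
  then show ?thesis
    using vec.dim_image_eq[OF e.linear_axioms, of "range f"]
    by (metis f.subspace_image order.refl vec.span_eq_iff vec.subspace_UNIV)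
qed

text \<open>Since \<open>e\<close> is injective on the range of \<open>f\<close> and
  \<open>f\<close> is injective on the range of \<open>e\<close>, both ranges have the same
  dimension, and \<open>e\<close> maps the range of \<open>f\<close> onto its own range.\<close>

lemma ex_ker_e_plus_range_f: "\<exists>y. e (x - f y) = 0"
proof -
  have "vec.dim (range e) \<le> vec.dim (f ` range e)"
    using sl2_rep.dim_range_le[OF opposite] .
  also have "\<dots> \<le> vec.dim (range f)" by (rule vec.dim_subset) auto
  also have "\<dots> \<le> vec.dim (e ` range f)" by (rule dim_range_le)
  finally have "e ` range f = range e"
    by (intro vec.subspace_dim_equal) (auto intro!: e.subspace_image f.subspace_image)
  then obtain y where "e x = e (f y)" by (metis (no_types, lifting) imageE rangeI)
  then show ?thesis by (auto simp: e.diff)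
qed

lemma ex_ker_f_plus_range_e: "\<exists>y. f (x - e y) = 0"
  using sl2_rep.ex_ker_e_plus_range_f[OF opposite] .

text \<open>On the kernel of \<open>e\<close>, the operator \<open>h - k\<close> takes vectors
  annihilated by \<open>f ^^ Suc k\<close> to vectors annihilated by \<open>f ^^ k\<close>. By
  induction the image is a sum of vectors of lower weights.\<close>

lemma ker_e_weight_decomposition:
  "e x = 0 \<Longrightarrow> (f ^^ k) x = 0 \<Longrightarrow>
     \<exists>c. (\<forall>i<k. h (c i) = of_nat i *s c i) \<and> x = (\<Sum>i<k. c i)"
proof (induction k arbitrary: x)
  case (Suc k)
  define y where "y = h x - of_nat k *s x"
  have ey: "e y = 0"
    using comm_he[of x] Suc.prems(1) by (simp add: y_def e.diff e.scale h.zero)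
  have "of_nat (Suc k) *s (f ^^ k) y = 0"
    using e_funpow_f[of k x] Suc.prems unfolding y_def by (simp add: funpow_linear e.zero)
  then have "(f ^^ k) y = 0" by (metis of_nat_neq_0 vec.scale_eq_0_iff)
  from Suc.IH[OF ey this] obtain c where c: "\<forall>i<k. h (c i) = of_nat i *s c i" "y = (\<Sum>i<k. c i)"
    by auto
  \<comment> \<open>On weights \<open>i < k\<close> the operator \<open>h - k\<close> is invertible;
    the sum of the \<open>w i\<close> is the preimage of \<open>y\<close>, and what remains of
    \<open>x\<close> has weight \<open>k\<close>.\<close>
  define w where "w i = (1 / (of_nat i - of_nat k)) *s c i" for i
  have hw: "h (w i) = of_nat i *s w i" if "i < k" for i
    using c that by (simp add: w_def h.scale vec_eq_iff)
  have "h (\<Sum>i<k. w i) - of_nat k *s (\<Sum>i<k. w i) = (\<Sum>i<k. (of_nat i - of_nat k) *s w i)"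
    by (simp add: h.sum vec.scale_sum_right sum_subtractf[symmetric] hw vec.scale_left_diff_distrib)
  also have "\<dots> = y"
    unfolding c by (intro sum.cong) (auto simp: w_def)
  finally have *: "h (x - (\<Sum>i<k. w i)) = of_nat k *s (x - (\<Sum>i<k. w i))"
    by (simp add: y_def h.diff vec_eq_iff algebra_simps)
  show ?case
    by (rule exI[of _ "\<lambda>i. if i = k then x - (\<Sum>i<k. w i) else w i"])
      (use hw * in \<open>auto simp: less_Suc_eq\<close>)
qed auto

abbreviation "eigvecs \<equiv> {x. \<exists>r::real. h x = of_real r *s x}"

text \<open>The kernel of \<open>e\<close> is spanned by weight vectors and \<open>f\<close>
  preserves their span. Every vector is a sum of a vector of the kernel and one in the range of
  \<open>f\<close>; repeating this \<open>N\<close> times exhausts it because \<open>f ^^ N\<close>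
  vanishes.\<close>

lemma span_eigvecs: "vec.span eigvecs = UNIV"
proof -
  have ker: "x \<in> vec.span eigvecs" if ex: "e x = 0" for x
  proof -
    obtain c where c: "\<forall>i<N. h (c i) = of_nat i *s c i" "x = (\<Sum>i<N. c i)"
      using ker_e_weight_decomposition[OF ex nilpotent_f] by blast
    have "\<exists>r::real. h (c i) = of_real r *s c i" if "i < N" for i
      using c(1) that by (intro exI[of _ "real i"]) simp
    then show ?thesis unfolding c(2) by (intro vec.span_sum vec.span_base) auto
  qed
  have f_eig: "f x \<in> eigvecs" if x: "x \<in> eigvecs" for x
  proof -
    obtain r :: real where "h x = of_real r *s x" using x by auto
    then have "h (f x) = of_real (r - 2) *s f x"
      unfolding comm_hf by (simp add: f.scale vec.scale_left_diff_distrib)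
    then show ?thesis by blast
  qed
  have stable: "f x \<in> vec.span eigvecs" if "x \<in> vec.span eigvecs" for x
    using that
  proof (induction rule: vec.span_induct_alt)
    case base
    show ?case by (simp only: f.zero vec.span_zero)
  next
    case (step c x y)
    show ?case unfolding f.add f.scale
      by (intro vec.span_add vec.span_scale vec.span_base f_eig step)
  qed
  have "\<exists>y. x - (f ^^ k) y \<in> vec.span eigvecs" for k x
  proof (induction k arbitrary: x)
    case 0
    have "x - (f ^^ 0) x \<in> vec.span eigvecs" by (simp add: vec.span_zero del: mem_Collect_eq)
    then show ?case by blast
  next
    case (Suc k)
    obtain y where y: "e (x - f y) = 0" using ex_ker_e_plus_range_f by blast
    obtain z where z: "y - (f ^^ k) z \<in> vec.span eigvecs" using Suc by blast
    have "x - (f ^^ Suc k) z = (x - f y) + f (y - (f ^^ k) z)" by (simp add: f.diff)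
    then show ?case using vec.span_add[OF ker[OF y] stable[OF z]] by metis
  qed
  from this[of _ N] show ?thesis by (auto simp: nilpotent_f)
qed

end

text \<open>In a basis of eigenvectors the trace of the square is the sum of the squared
  eigenvalues; these are real, so each is zero if the sum is.\<close>

lemma trace_square_eq_0_imp_0:
  fixes A :: "complex^'n::finite \<Rightarrow> complex^'n"
  assumes lin: "Vector_Spaces.linear (*s) (*s) A"
    and span: "vec.span {x. \<exists>r::real. A x = of_real r *s x} = UNIV"
    and tr: "trace (matrix A ** matrix A) = 0"
  shows "A x = 0"
proof -
  interpret A: Vector_Spaces.linear "(*s)" "(*s)" A by (rule lin)
  obtain B where B: "B \<subseteq> {x. \<exists>r::real. A x = of_real r *s x}" "vec.independent B"
      "{x. \<exists>r::real. A x = of_real r *s x} \<subseteq> vec.span B"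
    using vec.maximal_independent_subset[of "{x. \<exists>r::real. A x = of_real r *s x}"] by auto
  have spanB: "vec.span B = UNIV"
    using vec.span_minimal[OF B(3) vec.subspace_span] span by auto
  have "card B = CARD('n)"
    using vec.dim_eq_card[of B UNIV] spanB B(2) by (simp add: vec_dim_card del: vec.dim_UNIV)
  moreover have "finite B" using B(2) by (rule vec.finiteI_independent)
  ultimately obtain b :: "'n \<Rightarrow> complex^'n" where b: "bij_betw b UNIV B"
    using finite_same_card_bij[OF finite[of UNIV]] by metis
  have "\<exists>r::real. A (b i) = of_real r *s b i" for i
    using b B(1) bij_betwE by blast
  then obtain r :: "'n \<Rightarrow> real" where r: "\<And>i. A (b i) = of_real (r i) *s b i" by metis
  define P where "P = transpose (\<chi> i. b i)"
  have Pax: "P *v axis i 1 = b i" for i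
    by (simp add: P_def matrix_vector_mult_def transpose_def axis_def vec_eq_iff if_distrib
        sum.delta cong: if_cong del: vector_transpose_matrix)
  have "columns P = B" using b 
    by (auto simp: columns_def bij_betw_def P_def column_transpose row_def)
  then obtain P' where P': "P ** P' = mat 1"
    using matrix_right_invertible_span_columns[of P] spanB by auto
  then have P'P: "P' ** P = mat 1" using matrix_left_right_inverse by blast
  define M where "M = P' ** (matrix A ** matrix A) ** P"
  have M: "M *v axis i 1 = of_real ((r i)\<^sup>2) *s axis i 1" for i
  proof -
    have "M *v axis i 1 = P' *v (matrix A *v (matrix A *v (P *v axis i 1)))"
      by (simp add: M_def matrix_vector_mul_assoc matrix_mul_assoc)
    also have "\<dots> = of_real ((r i)\<^sup>2) *s (P' *v b i)"
      by (simp add: Pax matrix_works[OF lin] r A.scale vec.scale power2_eq_square)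
    also have "P' *v b i = axis i 1"
      by (simp add: Pax[symmetric] matrix_vector_mul_assoc P'P)
    finally show ?thesis .
  qed
  have "M $ i $ i = of_real ((r i)\<^sup>2)" for i
  proof -
    have "M $ i $ i = (M *v axis i 1) $ i" by (simp add: matrix_vector_mult_def axis_def if_distrib sum.delta cong: if_cong)
    then show ?thesis by (simp add: M)
  qed
  then have "trace M = of_real (\<Sum>i\<in>UNIV. (r i)\<^sup>2)" by (simp add: trace_def)
  moreover have "trace M = trace (P ** P' ** (matrix A ** matrix A))"
    unfolding M_def by (subst trace_mul_sym) (simp add: matrix_mul_assoc)
  ultimately have "(\<Sum>i\<in>UNIV. (r i)\<^sup>2) = 0" using tr P' by (metis matrix_mul_lid of_real_eq_0_iff)
  then have "r i = 0" for i by (simp add: sum_nonneg_eq_0_iff)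
  then have Ab: "A y = 0" if "y \<in> B" for y
    using r b that by (metis bij_betw_iff_bijections of_real_0 vec.scale_zero_left)
  have "x \<in> vec.span B" using spanB by simp
  then show ?thesis
    by (induction rule: vec.span_induct_alt) (auto simp: A.zero A.add A.scale Ab)
qed

section \<open>The Killing form\<close>

lemma complex_linear_iff:
  "Vector_Spaces.linear (*s) (*s) (L :: complex^'n::finite \<Rightarrow> complex^'m::finite) \<longleftrightarrow>
     (\<forall>x y. L (x + y) = L x + L y) \<and> (\<forall>c x. L (c *s x) = c *s L x)"
  unfolding Vector_Spaces.linear_def module_hom_def module_hom_axioms_def
  by (auto simp: vec.vector_space_axioms vec.module_axioms)

lemma scaleR_eq_smult: "r *\<^sub>R x = complex_of_real r *s (x :: complex^'n)"
  by (simp add: vec_eq_iff) (simp add: scaleR_conv_of_real)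

lemma complex_linear_bounded:
  assumes "Vector_Spaces.linear (*s) (*s) (L :: complex^'n::finite \<Rightarrow> complex^'m::finite)"
  shows "bounded_linear L"
  unfolding linear_conv_bounded_linear[symmetric]
  by (rule linearI) (use assms in \<open>auto simp: complex_linear_iff scaleR_eq_smult\<close>)

lemma matrix_diff_mult:
  fixes A B :: "'a::comm_ring_1^'n^'m"
  shows "(A - B) ** C = A ** C - B ** C" "D ** (A - B) = D ** A - D ** B"
  by (simp_all add: matrix_matrix_mult_def vec_eq_iff sum_subtractf algebra_simps)

locale lie_alg =
  fixes br :: "'n::finite bracket"
  assumes lie: "lie_algebra br"
begin

lemma linear_right: "Vector_Spaces.linear (*s) (*s) (br x)"
  and linear_left: "Vector_Spaces.linear (*s) (*s) (\<lambda>x. br x y)"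
  and br_self [simp]: "br x x = 0"
  using lie by (auto simp: lie_algebra_def)

sublocale R: Vector_Spaces.linear "(*s)" "(*s)" "br x" for x by (rule linear_right)

sublocale L: Vector_Spaces.linear "(*s)" "(*s)" "\<lambda>x. br x y" for y by (rule linear_left)

lemmas br_simps = R.add R.diff R.neg R.scale R.zero L.add L.diff L.neg L.scale L.zero

lemma br_anti: "br x y = - br y x"
proof -
  have "br (x + y) (x + y) = 0" by (rule br_self)
  then show ?thesis unfolding br_simps by (simp add: eq_neg_iff_add_eq_0 add.commute)
qed

lemma jacobi: "br x (br y z) = br (br x y) z + br y (br x z)"
proof -
  have "br x (br y z) + br y (br z x) + br z (br x y) = 0"
    using lie by (auto simp: lie_algebra_def)
  moreover have "br y (br z x) = - br y (br x z)"
    by (subst br_anti[of z x]) (rule R.neg)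
  moreover have "br z (br x y) = - br (br x y) z" by (rule br_anti)
  ultimately show ?thesis by (simp add: eq_diff_eq[symmetric] algebra_simps)
qed

lemma bounded_bilinear_br: "bounded_bilinear br"
  unfolding bilinear_conv_bounded_bilinear[symmetric] bilinear_def
  using complex_linear_bounded linear_right linear_left linear_conv_bounded_linear by blast

definition AD :: "complex^'n \<Rightarrow> complex^'n^'n" where "AD x = matrix (br x)"

lemma AD_works: "AD x *v y = br x y"
  unfolding AD_def by (rule matrix_works[OF linear_right])

lemma AD_add: "AD (x + y) = AD x + AD y"
  by (simp add: matrix_eq AD_works matrix_vector_mult_add_rdistrib br_simps)

lemma AD_scale: "AD (c *s x) = (\<chi> i j. c * AD x $ i $ j)"
  by (simp add: AD_def matrix_def br_simps)

lemma AD_br: "AD (br x y) = AD x ** AD y - AD y ** AD x"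
  by (simp add: matrix_eq AD_works matrix_vector_mult_diff_rdistrib matrix_vector_mul_assoc[symmetric]
      jacobi[of x y])

lemma killing_eq: "killing br x y = trace (AD x ** AD y)"
  unfolding killing_def AD_def
  using matrix_compose_gen[OF linear_right[of y] linear_right[of x]] by (simp add: o_def)

lemma killing_sym: "killing br x y = killing br y x"
  unfolding killing_eq by (rule trace_mul_sym)

lemma killing_add_right: "killing br z (x + y) = killing br z x + killing br z y"
  unfolding killing_eq AD_add matrix_add_ldistrib trace_add by simp

lemma killing_add_left: "killing br (x + y) z = killing br x z + killing br y z"
  using killing_add_right killing_sym by metis

lemma killing_scale_left: "killing br (c *s x) z = c * killing br x z"
  unfolding killing_eq AD_scale
  by (simp add: trace_def matrix_matrix_mult_def sum_distrib_left mult.assoc)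

lemma killing_scale_right: "killing br z (c *s x) = c * killing br z x"
  using killing_scale_left killing_sym by metis

lemma killing_minus: "killing br (- x) y = - killing br x y" "killing br x (- y) = - killing br x y"
  using killing_scale_left[of "-1" x y] killing_scale_right[of x "-1" y] by (simp_all add: vec.scale_minus_left)

lemma killing_diff: "killing br (x - x') y = killing br x y - killing br x' y"
  "killing br x (y - y') = killing br x y - killing br x y'"
  using killing_add_left[of x "- x'" y] killing_add_right[of x y "- y'"] by (simp_all add: killing_minus)

lemma killing_zero [simp]: "killing br 0 y = 0" "killing br x 0 = 0"
  using killing_scale_left[of 0 0 y] killing_scale_right[of x 0 0] by simp_all

lemma killing_sum: "killing br (\<Sum>i\<in>A. g i) y = (\<Sum>i\<in>A. killing br (g i) y)"
  "killing br x (\<Sum>i\<in>A. g i) = (\<Sum>i\<in>A. killing br x (g i))"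
  by (induction A rule: infinite_finite_induct) (auto simp: killing_add_left killing_add_right)

lemma killing_invariant: "killing br (br x y) z = killing br x (br y z)"
proof -
  have "trace (AD y ** AD x ** AD z) = trace (AD x ** (AD z ** AD y))"
    by (metis matrix_mul_assoc trace_mul_sym)
  then show ?thesis
    unfolding killing_eq AD_br
    by (simp add: trace_sub matrix_diff_mult matrix_mul_assoc)
qed

lemma killing_invariant': "killing br (br x y) z = - killing br y (br x z)"
  using killing_invariant[of y x z] br_anti[of x y] by (simp add: killing_minus)

lemma bounded_bilinear_killing: "bounded_bilinear (killing br)"
  unfolding bilinear_conv_bounded_bilinear[symmetric] bilinear_def
  by (auto intro!: linearI simp: killing_add_left killing_add_right scaleR_eq_smult
      killing_scale_left killing_scale_right scaleR_conv_of_real)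

end

text \<open>By invariance the radical of the Killing form is an ideal. A single nonzero value keeps
  it from being everything, and simplicity then leaves only zero; this stands in for Cartan's
  criterion.\<close>

lemma killing_nondegenerate:
  assumes simple: "simple_lie_algebra br" and nz: "killing br a b \<noteq> 0"
    and x: "\<And>y. killing br x y = 0"
  shows "x = 0"
proof -
  interpret lie_alg br using simple by (simp add: simple_lie_algebra_def lie_alg_def)
  let ?I = "{x. \<forall>y. killing br x y = 0}"
  have "lie_ideal br ?I"
    unfolding lie_ideal_def vec.subspace_def
    by (auto simp: killing_add_left killing_scale_left killing_invariant')
  then have "?I = {0} \<or> ?I = UNIV" using simple by (simp add: simple_lie_algebra_def)
  then show ?thesis using nz x by auto
qed

section \<open>Duality for a nondegenerate Killing form\<close>

locale nondegenerate_lie_alg = lie_alg br for br :: "'n::finite bracket" +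
  assumes nondegenerate: "(\<And>y. killing br x y = 0) \<Longrightarrow> x = 0"
begin

text \<open>\<open>T y\<close> lists the coordinates of the functional \<open>killing br y\<close>.
  Nondegeneracy makes \<open>T\<close> injective, hence surjective by equality of
  dimensions.\<close>

lemma killing_representation:
  fixes \<phi> :: "complex^'n \<Rightarrow> complex"
  assumes "\<And>x y. \<phi> (x + y) = \<phi> x + \<phi> y" "\<And>c x. \<phi> (c *s x) = c * \<phi> x"
  obtains y where "\<And>x. \<phi> x = killing br y x"
proof -
  define T where "T y = (\<chi> i. killing br y (axis i 1))" for y
  have expand: "\<psi> x = (\<Sum>i\<in>UNIV. x $ i * \<psi> (axis i 1))"
    if "\<And>x y. \<psi> (x + y) = \<psi> x + \<psi> y" "\<And>c x. \<psi> (c *s x) = c * \<psi> x" for \<psi> :: "complex^'n \<Rightarrow> complex" and x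
  proof -
    have z: "\<psi> 0 = 0" using that(2)[of 0 0] by simp
    have s: "\<psi> (\<Sum>i\<in>A. g i) = (\<Sum>i\<in>A. \<psi> (g i))" if "finite A" for A and g :: "'n \<Rightarrow> complex^'n"
      using that by (induction A rule: finite_induct) (auto simp: z \<open>\<And>x y. \<psi> (x + y) = \<psi> x + \<psi> y\<close>)
    have "\<psi> x = \<psi> (\<Sum>i\<in>UNIV. x $ i *s axis i 1)" by (simp add: basis_expansion)
    then show ?thesis by (simp add: s that)
  qed
  have lin: "Vector_Spaces.linear (*s) (*s) T"
    by (auto simp: complex_linear_iff T_def vec_eq_iff killing_add_left killing_scale_left)
  have kT: "killing br y x = (\<Sum>i\<in>UNIV. x $ i * T y $ i)" for x y
    using expand[of "killing br y" x] by (simp add: T_def killing_add_right killing_scale_right)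
  have "inj T"
  proof (rule injI)
    fix x y assume "T x = T y"
    then have "killing br (x - y) z = 0" for z unfolding killing_diff by (simp add: kT)
    then show "x = y" using nondegenerate by fastforce
  qed
  then have "surj T" using vec.linear_injective_imp_surjective[OF lin] by blast
  then obtain y where y: "T y = (\<chi> i. \<phi> (axis i 1))" by (metis surjD)
  have "\<phi> x = killing br y x" for x using expand[of \<phi> x] assms by (simp add: kT y)
  then show ?thesis using that by blast
qed

text \<open>Provides the pointwise adjoint through which covectors are later pulled back along
  constant linear maps of loops.\<close>

lemma killing_adjoint:
  assumes L: "Vector_Spaces.linear (*s) (*s) L"
  obtains L' where "Vector_Spaces.linear (*s) (*s) L'" "\<And>u v. killing br u (L v) = killing br (L' u) v"
proof -
  have "\<exists>y. \<forall>v. killing br u (L v) = killing br y v" for u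
  proof (rule killing_representation[of "\<lambda>v. killing br u (L v)"])
    fix y assume "\<And>x. killing br u (L x) = killing br y x"
    then show ?thesis by blast
  qed (use L in \<open>auto simp: complex_linear_iff killing_add_right killing_scale_right\<close>)
  then obtain L' where L': "\<And>u v. killing br u (L v) = killing br (L' u) v" by metis
  have ext: "x = y" if "\<And>z. killing br x z = killing br y z" for x y
    using nondegenerate[of "x - y"] that by (simp add: killing_diff)
  have "Vector_Spaces.linear (*s) (*s) L'"
    unfolding complex_linear_iff
    by (auto intro!: ext simp: L'[symmetric] killing_add_left killing_scale_left)
  then show ?thesis using that L' by blast
qed

lemma killing_separation:
  assumes "vec.subspace W" "x \<notin> W"
  obtains y where "\<And>w. w \<in> W \<Longrightarrow> killing br y w = 0" "killing br y x \<noteq> 0"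
proof -
  obtain B where B: "B \<subseteq> W" "vec.independent B" "W \<subseteq> vec.span B"
    using vec.maximal_independent_subset by blast
  have "x \<notin> vec.span B" using assms B(1) vec.span_minimal by blast
  then have ind: "vec.independent (insert x B)" "x \<notin> B"
    using vec.independent_insertI[OF _ B(2)] vec.span_base by blast+
  \<comment> \<open>The separating functional is encoded as one coordinate of a vector-valued map;
    \<open>undefined\<close> names an arbitrary fixed coordinate.\<close>
  obtain g :: "complex^'n \<Rightarrow> complex^'n" where g: "Vector_Spaces.linear (*s) (*s) g"
    "\<forall>b\<in>insert x B. g b = (if b = x then axis undefined 1 else 0)"
    using vec.linear_independent_extend[OF ind(1), of "\<lambda>b. if b = x then axis undefined 1 else 0"] by blast
  interpret g: Vector_Spaces.linear "(*s)" "(*s)" g by (rule g(1))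
  obtain y where y: "\<And>v. g v $ undefined = killing br y v"
    using killing_representation[of "\<lambda>v. g v $ undefined"] by (auto simp: g.add g.scale)
  have gW: "g w = 0" if "w \<in> vec.span B" for w
    using that ind(2) g(2) by (induction rule: vec.span_induct_alt) (auto simp: g.zero g.add g.scale)
  show ?thesis
  proof
    show "killing br y w = 0" if "w \<in> W" for w using gW B(3) that y[of w] by auto
    show "killing br y x \<noteq> 0" using g(2) y[of x] by (simp add: axis_def)
  qed
qed

end

section \<open>Gradings\<close>

locale graded_lie_alg = lie_alg br for br :: "'n::finite bracket" +
  fixes \<Gamma> :: "int \<Rightarrow> (complex^'n) set"
  assumes grading: "lie_grading br \<Gamma>"
begin

lemma subspace_grade: "vec.subspace (\<Gamma> i)"
  using grading by (auto simp: lie_grading_def)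

lemma grade_br: "x \<in> \<Gamma> i \<Longrightarrow> y \<in> \<Gamma> j \<Longrightarrow> br x y \<in> \<Gamma> (i + j)"
  using grading by (auto simp: lie_grading_def)

definition components :: "complex^'n \<Rightarrow> int \<Rightarrow> complex^'n" where
  "components x = (THE c. (\<forall>i. c i \<in> \<Gamma> i) \<and> finite {i. c i \<noteq> 0} \<and> x = (\<Sum>i | c i \<noteq> 0. c i))"

definition pr :: "int \<Rightarrow> complex^'n \<Rightarrow> complex^'n" where "pr j x = components x j"

lemma components_ex1:
  "\<exists>!c. (\<forall>i. c i \<in> \<Gamma> i) \<and> finite {i. c i \<noteq> 0} \<and> x = (\<Sum>i | c i \<noteq> 0. c i)"
  using grading by (auto simp: lie_grading_def)

lemma pr_props: "pr i x \<in> \<Gamma> i" "finite {i. pr i x \<noteq> 0}" "x = (\<Sum>i | pr i x \<noteq> 0. pr i x)"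
  using theI'[OF components_ex1[of x]] unfolding pr_def components_def by auto

lemma pr_unique:
  assumes A: "finite A" and c: "\<And>i. i \<in> A \<Longrightarrow> c i \<in> \<Gamma> i" and x: "x = (\<Sum>i\<in>A. c i)"
  shows "pr j x = (if j \<in> A then c j else 0)"
proof -
  define c' where "c' i = (if i \<in> A then c i else 0)" for i
  have "finite {i. c' i \<noteq> 0}" using A by (rule finite_subset[rotated]) (auto simp: c'_def)
  moreover have "c' i \<in> \<Gamma> i" for i using c vec.subspace_0[OF subspace_grade] by (auto simp: c'_def)
  moreover have "x = (\<Sum>i | c' i \<noteq> 0. c' i)"
    unfolding x using A by (intro sum.mono_neutral_cong_right) (auto simp: c'_def)
  ultimately have "components x = c'"
    unfolding components_def by (intro the1_equality[OF components_ex1]) auto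
  then show ?thesis by (simp add: pr_def c'_def)
qed

lemma pr_expand:
  assumes "finite A" "{i. pr i x \<noteq> 0} \<subseteq> A" shows "x = (\<Sum>i\<in>A. pr i x)"
  by (rule trans[OF pr_props(3)], rule sum.mono_neutral_left) (use assms in auto)

lemma pr_same: "x \<in> \<Gamma> j \<Longrightarrow> pr j x = x"
  using pr_unique[of "{j}" "\<lambda>_. x" x j] by simp

lemma pr_other: "x \<in> \<Gamma> i \<Longrightarrow> i \<noteq> j \<Longrightarrow> pr j x = 0"
  using pr_unique[of "{i}" "\<lambda>_. x" x j] by simp

lemma pr_add: "pr j (x + y) = pr j x + pr j y"
proof -
  let ?A = "{i. pr i x \<noteq> 0} \<union> {i. pr i y \<noteq> 0}"
  have fin: "finite ?A" using pr_props(2) by auto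
  have "x + y = (\<Sum>i\<in>?A. pr i x) + (\<Sum>i\<in>?A. pr i y)"
    by (rule arg_cong2[where f = "(+)"]; rule pr_expand[OF fin]) auto
  then have "pr j (x + y) = (if j \<in> ?A then pr j x + pr j y else 0)"
    by (intro pr_unique[OF fin]) (auto simp: sum.distrib intro!: vec.subspace_add[OF subspace_grade] pr_props)
  then show ?thesis by auto
qed

lemma pr_scale: "pr j (c *s x) = c *s pr j x"
proof -
  have "c *s x = (\<Sum>i | pr i x \<noteq> 0. c *s pr i x)"
    using arg_cong[OF pr_props(3)[of x], of "\<lambda>u. c *s u"] unfolding vec.scale_sum_right .
  then have "pr j (c *s x) = (if j \<in> {i. pr i x \<noteq> 0} then c *s pr j x else 0)"
    by (intro pr_unique[OF pr_props(2)]) (auto intro!: vec.subspace_scale[OF subspace_grade] pr_props)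
  then show ?thesis by auto
qed

lemma linear_pr: "Vector_Spaces.linear (*s) (*s) (pr j)"
  by (simp add: complex_linear_iff pr_add pr_scale)

sublocale pr: Vector_Spaces.linear "(*s)" "(*s)" "pr j" for j by (rule linear_pr)

definition degrees :: "int set" where "degrees = {j. \<exists>x. pr j x \<noteq> 0}"

lemma finite_degrees: "finite degrees"
proof -
  have "degrees \<subseteq> (\<Union>i. {j. pr j (axis i 1) \<noteq> 0})"
  proof (rule subsetI, rule ccontr)
    fix j assume "j \<in> degrees" and 0: "j \<notin> (\<Union>i. {j. pr j (axis i 1) \<noteq> 0})"
    then obtain x where x: "pr j x \<noteq> 0" by (auto simp: degrees_def)
    have "pr j x = pr j (\<Sum>i\<in>UNIV. x $ i *s axis i 1)" by (simp add: basis_expansion)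
    also have "\<dots> = 0" using 0 by (simp add: pr.sum pr.scale)
    finally show False using x by simp
  qed
  moreover have "finite (\<Union>i. {j. pr j (axis i 1) \<noteq> 0})" using pr_props(2) by auto
  ultimately show ?thesis by (rule finite_subset)
qed

lemma sum_pr: "x = (\<Sum>i\<in>degrees. pr i x)"
  by (rule pr_expand[OF finite_degrees]) (auto simp: degrees_def)

lemma pr_notin_degrees: "j \<notin> degrees \<Longrightarrow> pr j x = 0"
  by (auto simp: degrees_def)

lemma pr_eqI: assumes "\<And>j. pr j x = pr j y" shows "x = y"
proof -
  have "x = (\<Sum>i\<in>degrees. pr i x)" by (rule sum_pr)
  also have "\<dots> = (\<Sum>i\<in>degrees. pr i y)" by (simp only: assms)
  also have "\<dots> = y" by (rule sum_pr[symmetric])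
  finally show ?thesis .
qed

definition height :: nat where "height = nat (Max (insert 0 (abs ` degrees)))"

lemma degrees_height: "j \<in> degrees \<Longrightarrow> \<bar>j\<bar> \<le> int height"
  using finite_degrees by (auto simp: height_def Max_ge_iff)

lemma pr_height: "\<bar>j\<bar> > int height \<Longrightarrow> pr j x = 0"
  using degrees_height pr_notin_degrees by fastforce

lemma pr_pr: "pr i (pr j x) = (if i = j then pr j x else 0)"
  using pr_same[OF pr_props(1)] pr_other[OF pr_props(1)] by auto

lemma grade_iff_pr: "x \<in> \<Gamma> j \<longleftrightarrow> (\<forall>i. i \<noteq> j \<longrightarrow> pr i x = 0)"
proof
  assume 0: "\<forall>i. i \<noteq> j \<longrightarrow> pr i x = 0"
  have "pr j x = x"
  proof (rule pr_eqI)
    fix i show "pr i (pr j x) = pr i x" using 0 by (cases "i = j") (simp_all add: pr_pr)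
  qed
  then show "x \<in> \<Gamma> j" using pr_props(1)[of j x] by simp
qed (auto simp: pr_other)

lemma pr_br: assumes "x \<in> \<Gamma> i" shows "pr j (br x y) = br x (pr (j - i) y)"
proof -
  have "br x y = (\<Sum>k\<in>degrees. br x (pr k y))" by (subst sum_pr[of y]) (simp add: R.sum)
  then have "pr j (br x y) = (\<Sum>k\<in>degrees. pr j (br x (pr k y)))" by (simp add: pr.sum)
  also have "\<dots> = (\<Sum>k\<in>degrees. if k = j - i then br x (pr k y) else 0)"
  proof (intro sum.cong refl)
    fix k
    have "br x (pr k y) \<in> \<Gamma> (i + k)" using assms pr_props(1) by (rule grade_br)
    then show "pr j (br x (pr k y)) = (if k = j - i then br x (pr k y) else 0)"
      using pr_same[of _ "i + k"] pr_other[of _ "i + k" j] by auto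
  qed
  also have "\<dots> = br x (pr (j - i) y)"
    using finite_degrees by (simp add: sum.delta pr_notin_degrees R.zero)
  finally show ?thesis .
qed

lemma pr_funpow_br:
  assumes "x \<in> \<Gamma> i" shows "pr j ((br x ^^ k) y) = (br x ^^ k) (pr (j - int k * i) y)"
proof (induction k arbitrary: j)
  case (Suc k)
  have *: "j - i - int k * i = j - int (Suc k) * i" by (simp add: algebra_simps)
  show ?case by (simp only: funpow.simps o_apply pr_br[OF assms] Suc.IH *)
qed simp

text \<open>All degrees lie in a window of width \<open>2 * height\<close>, so
  \<open>2 * height + 1\<close> shifts by a nonzero amount leave it.\<close>

lemma funpow_br_nilpotent:
  assumes "x \<in> \<Gamma> i" "i \<noteq> 0" shows "(br x ^^ (2 * height + 1)) y = 0"
proof (rule pr_eqI)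
  fix j
  have z: "(br x ^^ k) 0 = 0" for k by (induction k) (auto simp: R.zero)
  show "pr j ((br x ^^ (2 * height + 1)) y) = pr j 0"
  proof (cases "\<bar>j\<bar> > int height")
    case False
    have "int (2 * height + 1) * 1 \<le> int (2 * height + 1) * \<bar>i\<bar>"
      using assms(2) by (intro mult_left_mono) auto
    moreover have "\<bar>int (2 * height + 1) * i\<bar> = int (2 * height + 1) * \<bar>i\<bar>"
      by (simp only: abs_mult abs_of_nat)
    moreover have "int (2 * height + 1) = 2 * int height + 1" by simp
    ultimately have "\<bar>int (2 * height + 1) * i\<bar> \<ge> 2 * int height + 1" by (metis mult.right_neutral)
    then have "\<bar>j - int (2 * height + 1) * i\<bar> > int height" using False by linarith
    then show ?thesis unfolding pr_funpow_br[OF assms(1)] by (simp add: pr_height z pr.zero)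
  qed (simp add: pr_height)
qed

definition degree_op :: "complex^'n \<Rightarrow> complex^'n" where
  "degree_op x = (\<Sum>j\<in>degrees. of_int j *s pr j x)"

lemma linear_degree_op: "Vector_Spaces.linear (*s) (*s) degree_op"
  by (simp add: complex_linear_iff degree_op_def pr_add pr_scale vec.scale_right_distrib sum.distrib
      vec.scale_sum_right mult.commute)

lemma pr_degree_op: "pr j (degree_op x) = of_int j *s pr j x"
proof -
  have "pr j (degree_op x) = (\<Sum>i\<in>degrees. if i = j then of_int j *s pr j x else 0)"
    unfolding degree_op_def pr.sum by (intro sum.cong) (auto simp: pr.scale pr_pr)
  then show ?thesis using finite_degrees by (simp add: pr_notin_degrees)
qed

lemma degree_op_br: assumes "x \<in> \<Gamma> i"
  shows "degree_op (br x y) = br x (degree_op y) + of_int i *s br x y"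
proof (rule pr_eqI)
  fix j
  have "of_int j = (of_int (j - i) + of_int i :: complex)" by simp
  then show "pr j (degree_op (br x y)) = pr j (br x (degree_op y) + of_int i *s br x y)"
    by (simp only: pr_degree_op pr_br[OF assms] pr.add pr.scale R.scale vec.scale_left_distrib)
qed

text \<open>The trace of an operator of nonzero degree vanishes because it is, up to a factor, the
  trace of its commutator with the degree operator.\<close>

lemma killing_grade:
  assumes x: "x \<in> \<Gamma> i" and y: "y \<in> \<Gamma> j" and ij: "i + j \<noteq> 0"
  shows "killing br x y = 0"
proof -
  define T where "T = matrix degree_op"
  define A where "A = AD x ** AD y"
  have Tw: "T *v z = degree_op z" for z unfolding T_def by (rule matrix_works[OF linear_degree_op])
  have "T ** A = A ** T + (\<chi> k l. of_int (i + j) * A $ k $ l)"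
  proof (subst matrix_eq, rule allI)
    fix z
    have s: "(\<chi> k l. of_int (i + j) * A $ k $ l) *v z = of_int (i + j) *s (A *v z)"
      by (simp add: matrix_vector_mult_def vec_eq_iff sum_distrib_left mult.assoc del: of_int_add)
    have "T ** A *v z = degree_op (br x (br y z))"
      by (simp add: A_def matrix_vector_mul_assoc[symmetric] Tw AD_works)
    also have "\<dots> = br x (br y (degree_op z)) + of_int (i + j) *s br x (br y z)"
      by (simp add: degree_op_br[OF x] degree_op_br[OF y] R.add R.scale vec.scale_left_distrib)
    also have "\<dots> = (A ** T + (\<chi> k l. of_int (i + j) * A $ k $ l)) *v z"
      unfolding matrix_vector_mult_add_rdistrib s
      by (simp add: A_def matrix_vector_mul_assoc[symmetric] Tw AD_works)
    finally show "T ** A *v z = (A ** T + (\<chi> k l. of_int (i + j) * A $ k $ l)) *v z" .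
  qed
  then have "trace (T ** A) = trace (A ** T) + of_int (i + j) * trace A"
    by (simp add: trace_add) (simp add: trace_def sum_distrib_left)
  then have "of_int (i + j) * trace A = 0" using trace_mul_sym[of T A] by simp
  then show ?thesis using ij by (metis A_def killing_eq mult_eq_0_iff of_int_eq_0_iff)
qed

lemma killing_pr: "killing br (pr i x) y = killing br x (pr (- i) y)"
proof -
  have "killing br (pr i x) y = (\<Sum>j\<in>degrees. killing br (pr i x) (pr j y))"
    by (subst sum_pr[of y]) (simp add: killing_sum)
  also have "\<dots> = (\<Sum>j\<in>degrees. if j = - i then killing br (pr i x) (pr j y) else 0)"
    by (intro sum.cong) (auto intro: killing_grade[OF pr_props(1) pr_props(1)])
  also have "\<dots> = killing br (pr i x) (pr (- i) y)"
    using finite_degrees by (simp add: pr_notin_degrees)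
  also have "\<dots> = (\<Sum>j\<in>degrees. if j = i then killing br (pr j x) (pr (- i) y) else 0)"
    using finite_degrees by (simp add: pr_notin_degrees)
  also have "\<dots> = (\<Sum>j\<in>degrees. killing br (pr j x) (pr (- i) y))"
    by (intro sum.cong) (auto intro: killing_grade[OF pr_props(1) pr_props(1)])
  also have "\<dots> = killing br x (pr (- i) y)"
    by (subst (2) sum_pr[of x]) (simp add: killing_sum)
  finally show ?thesis .
qed

text \<open>The filtration attached to the grading. Exponentials and gauge transforms are
  inhomogeneous and can be controlled only from above in degree, so all later estimates are stated
  with it.\<close>

definition low :: "int \<Rightarrow> (complex^'n) set" where "low k = {x. \<forall>j>k. pr j x = 0}"

lemma subspace_low: "vec.subspace (low k)"
  by (auto simp: vec.subspace_def low_def pr.zero pr.add pr.scale)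

lemma low_mono: "x \<in> low k \<Longrightarrow> k \<le> l \<Longrightarrow> x \<in> low l"
  by (auto simp: low_def)

lemma grade_low: "x \<in> \<Gamma> j \<Longrightarrow> j \<le> k \<Longrightarrow> x \<in> low k"
  by (auto simp: low_def pr_other)

lemma low_top: "int height \<le> k \<Longrightarrow> x \<in> low k"
  by (auto simp: low_def pr_height)

lemma low_bot: "k < - int height \<Longrightarrow> x \<in> low k \<Longrightarrow> x = 0"
proof (rule pr_eqI)
  fix j assume "k < - int height" "x \<in> low k"
  then show "pr j x = pr j 0" using pr_height[of j x] by (cases "j > k") (auto simp: low_def pr.zero)
qed

lemma low_expand: assumes "x \<in> low k" shows "x = (\<Sum>i\<in>{i\<in>degrees. i \<le> k}. pr i x)"
proof -
  have "{i. pr i x \<noteq> 0} \<subseteq> {i\<in>degrees. i \<le> k}"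
  proof
    fix i assume i: "i \<in> {i. pr i x \<noteq> 0}"
    then have "\<not> k < i" using assms by (auto simp: low_def)
    with i show "i \<in> {i\<in>degrees. i \<le> k}" by (auto simp: degrees_def)
  qed
  then show ?thesis by (intro pr_expand) (simp_all add: finite_degrees)
qed

lemma low_subset:
  assumes "vec.subspace V" "\<And>i. i \<le> k \<Longrightarrow> \<Gamma> i \<subseteq> V" shows "low k \<subseteq> V"
proof
  fix x assume "x \<in> low k"
  show "x \<in> V"
    by (subst low_expand[OF \<open>x \<in> low k\<close>])
      (use assms pr_props(1) in \<open>auto intro!: vec.subspace_sum\<close>)
qed

lemma low_homogeneous:
  assumes L: "Vector_Spaces.linear (*s) (*s) L" and hom: "\<And>i x. x \<in> \<Gamma> i \<Longrightarrow> L x \<in> \<Gamma> (i + d)"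
    and x: "x \<in> low k"
  shows "L x \<in> low (k + d)"
proof -
  interpret L: Vector_Spaces.linear "(*s)" "(*s)" L by (rule L)
  have "vec.subspace {x. L x \<in> low (k + d)}"
    using subspace_low[of "k + d"] by (auto simp: vec.subspace_def L.zero L.add L.scale)
  then have "low k \<subseteq> {x. L x \<in> low (k + d)}"
  proof (rule low_subset)
    fix i assume "i \<le> k"
    then show "\<Gamma> i \<subseteq> {x. L x \<in> low (k + d)}" using grade_low[OF hom] by auto
  qed
  then show ?thesis using x by blast
qed

lemma low_br: assumes x: "x \<in> low a" and y: "y \<in> low b" shows "br x y \<in> low (a + b)"
proof -
  have *: "br u y \<in> low (a + b)" if "u \<in> \<Gamma> i" "i \<le> a" for u i
  proof -
    have "br u y \<in> low (b + i)"
      by (rule low_homogeneous[OF linear_right _ y]) (use grade_br[OF that(1)] in \<open>auto simp: add.commute\<close>)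
    then show ?thesis using that(2) by (auto intro: low_mono)
  qed
  have "vec.subspace {x. br x y \<in> low (a + b)}"
    using subspace_low[of "a + b"] by (auto simp: vec.subspace_def br_simps)
  then have "low a \<subseteq> {x. br x y \<in> low (a + b)}"
    by (rule low_subset) (use * in blast)
  then show ?thesis using x by blast
qed

lemma killing_low: assumes "x \<in> low a" "y \<in> low b" "a + b < 0" shows "killing br x y = 0"
proof -
  have "killing br x y = (\<Sum>i\<in>degrees. killing br (pr i x) (pr (- i) y))"
  proof -
    have "killing br x y = (\<Sum>i\<in>degrees. killing br (pr i x) y)"
      using arg_cong[OF sum_pr[of x], of "\<lambda>u. killing br u y"] unfolding killing_sum .
    then show ?thesis by (simp add: killing_pr pr_pr)
  qed
  also have "\<dots> = 0"
  proof (intro sum.neutral ballI)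
    fix i
    show "killing br (pr i x) (pr (- i) y) = 0"
    proof (cases "i > a")
      case True
      then have "pr i x = 0" using assms(1) by (simp add: low_def)
      then show ?thesis by simp
    next
      case False
      then have "b < - i" using assms(3) by linarith
      then have "pr (- i) y = 0" using assms(2) by (simp add: low_def)
      then show ?thesis by simp
    qed
  qed
  finally show ?thesis .
qed

end

lemma (in graded_lie_alg) sl2_rep_grading:
  assumes e: "e \<in> \<Gamma> 2" and f: "f \<in> \<Gamma> (-2)" and triple: "sl2_triple br e h f"
  shows "sl2_rep (br e) (br f) (br h) (2 * height + 1)"
proof -
  have t: "br h e = 2 *s e" "br h f = - 2 *s f" "br e f = h"
    using triple by (auto simp: sl2_triple_def)
  show ?thesis
    unfolding sl2_rep_def sl2_rep_axioms_def
  proof (intro conjI allI linear_right)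
    fix x
    show "br h (br e x) = br e (br h x) + 2 *s br e x" using jacobi[of h e x] by (simp add: t L.scale)
    show "br h (br f x) = br f (br h x) - 2 *s br f x"
      using jacobi[of h f x] by (simp add: t L.scale L.neg)
    show "br e (br f x) = br f (br e x) + br h x" using jacobi[of e f x] by (simp add: t)
    show "(br e ^^ (2 * height + 1)) x = 0" by (rule funpow_br_nilpotent[OF e]) simp
    show "(br f ^^ (2 * height + 1)) x = 0" by (rule funpow_br_nilpotent[OF f]) simp
  qed
qed

lemma (in graded_lie_alg) killing_h_h_neq_0:
  assumes e: "e \<in> \<Gamma> 2" and f: "f \<in> \<Gamma> (-2)" and triple: "sl2_triple br e h f" and "f \<noteq> 0"
  shows "killing br h h \<noteq> 0"
proof
  assume "killing br h h = 0"
  then have "trace (matrix (br h) ** matrix (br h)) = 0" by (simp add: killing_eq AD_def)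
  from trace_square_eq_0_imp_0[OF linear_right sl2_rep.span_eigvecs[OF sl2_rep_grading[OF e f triple]] this]
  have "br h f = 0" .
  then have "(-2 :: complex) *s f = 0" using triple by (simp add: sl2_triple_def)
  then show False using \<open>f \<noteq> 0\<close> by (simp only: vec.scale_eq_0_iff) simp
qed

text \<open>The zero map is injective only on trivial grades of positive degree and surjective only
  onto trivial grades of negative degree.\<close>

lemma good_grading_0:
  assumes good: "good_grading br 0 \<Gamma>" and lie: "lie_algebra br" and iso: "isotropic br e \<Gamma> l"
  shows "\<Gamma> = (\<lambda>i. if i = 0 then UNIV else {0})" and "l = {0}"
proof -
  interpret graded_lie_alg br \<Gamma>
    using good lie by (auto simp: good_grading_def graded_lie_alg_def graded_lie_alg_axioms_def lie_alg_def)
  have zero: "0 \<in> \<Gamma> i" for i by (rule vec.subspace_0[OF subspace_grade])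
  have nz: "\<Gamma> i = {0}" if "i \<noteq> 0" for i
  proof (cases "i \<ge> 1")
    case True
    then have "inj_on (br 0) (\<Gamma> i)" using good by (auto simp: good_grading_def)
    then have "x = 0" if "x \<in> \<Gamma> i" for x using that zero by (auto simp: inj_on_def L.zero)
    then show ?thesis using zero by blast
  next
    case False
    then have "i + 2 \<le> 1" using \<open>i \<noteq> 0\<close> by linarith
    then have "br 0 ` \<Gamma> (i + 2) = \<Gamma> (i + 2 - 2)" using good unfolding good_grading_def by blast
    then have "br 0 ` \<Gamma> (i + 2) = \<Gamma> i" by simp
    then show ?thesis using zero[of "i + 2"] by (auto simp: L.zero)
  qed
  have [simp]: "x \<in> \<Gamma> 0" for x
    using nz pr_props(1)[of _ x] by (subst grade_iff_pr) blast
  show "\<Gamma> = (\<lambda>i. if i = 0 then UNIV else {0})"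
    by (intro ext) (simp add: nz set_eq_iff)
  show "l = {0}"
    using iso nz[of "-1"] vec.subspace_0[of l] by (auto simp: isotropic_def)
qed

section \<open>The slice of a good grading\<close>

text \<open>The partial inverse of \<open>ad e\<close> for the splitting of the algebra into the
  centralizer of \<open>f\<close> and the range of \<open>ad e\<close>: it vanishes on the
  centralizer and has values in the range of \<open>ad f\<close>. It is determined without reference
  to any grading.\<close>

definition slice_inv :: "'n::finite bracket \<Rightarrow> complex^'n \<Rightarrow> complex^'n \<Rightarrow> complex^'n \<Rightarrow> complex^'n" where
  "slice_inv br e f x = (THE y. y \<in> range (br f) \<and> x - br e y \<in> centralizer br f)"

locale good_slice =
  nondegenerate_lie_alg br + graded_lie_alg br \<Gamma>
  for br :: "'n::finite bracket" and \<Gamma> :: "int \<Rightarrow> (complex^'n) set" +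
  fixes e h f :: "complex^'n" and l :: "(complex^'n) set"
  assumes good: "good_grading br f \<Gamma>" and compatible: "compatible_grading e h \<Gamma>"
    and triple: "sl2_triple br e h f" and isotropic: "isotropic br e \<Gamma> l"
begin

lemma grade_e: "e \<in> \<Gamma> 2" and grade_f: "f \<in> \<Gamma> (-2)"
  using compatible good by (auto simp: compatible_grading_def good_grading_def)

lemma sl2: "sl2_rep (br e) (br f) (br h) (2 * height + 1)"
  by (rule sl2_rep_grading[OF grade_e grade_f triple])

abbreviation "\<sigma> \<equiv> slice_inv br e f"
abbreviation "cen \<equiv> centralizer br f"

lemma subspace_cen: "vec.subspace cen"
  by (auto simp: vec.subspace_def centralizer_def br_simps)

lemma subspace_range: "vec.subspace (range (br f))"
  by (rule R.subspace_image) (rule vec.subspace_UNIV)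

text \<open>Existence combines two splittings: \<open>x\<close> is in the kernel of
  \<open>ad f\<close> up to some \<open>[e, y]\<close>, and \<open>y\<close> may be replaced by its
  part in the range of \<open>ad f\<close> because the rest is annihilated by \<open>ad e\<close>.
  Uniqueness holds because each of \<open>ad e\<close>, \<open>ad f\<close> is injective on the
  range of the other.\<close>

lemma slice_inv_ex1: "\<exists>!y. y \<in> range (br f) \<and> x - br e y \<in> cen"
proof -
  obtain y where y: "br f (x - br e y) = 0" using sl2_rep.ex_ker_f_plus_range_e[OF sl2] by blast
  obtain w where w: "br e (y - br f w) = 0" using sl2_rep.ex_ker_e_plus_range_f[OF sl2] by blast
  show ?thesis
  proof (rule ex1I)
    have "br e (br f w) = br e y" using w by (simp add: R.diff)
    then show "br f w \<in> range (br f) \<and> x - br e (br f w) \<in> cen" using y by (simp add: centralizer_def)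
  next
    fix y' assume y': "y' \<in> range (br f) \<and> x - br e y' \<in> cen"
    then obtain w' where w': "y' = br f w'" by auto
    have "br f (br e (br f w - y')) = 0"
      using y y' w by (simp add: centralizer_def R.diff)
    then have "br e (br f w - y') = 0" using sl2_rep.ker_f_range_e[OF sl2] by blast
    then have "br f (w - w') = 0" using sl2_rep.ker_e_range_f[OF sl2, of "w - w'"] by (simp add: w' R.diff)
    then show "y' = br f w" by (simp add: w' R.diff)
  qed
qed

lemma slice_inv: "\<sigma> x \<in> range (br f)" "x - br e (\<sigma> x) \<in> cen"
  using theI'[OF slice_inv_ex1[of x]] unfolding slice_inv_def by auto

lemma slice_inv_eqI: "y \<in> range (br f) \<Longrightarrow> x - br e y \<in> cen \<Longrightarrow> \<sigma> x = y"
  unfolding slice_inv_def by (intro the1_equality[OF slice_inv_ex1]) auto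

lemma linear_slice_inv: "Vector_Spaces.linear (*s) (*s) \<sigma>"
proof -
  have "\<sigma> (x + y) = \<sigma> x + \<sigma> y" for x y
  proof (rule slice_inv_eqI)
    show "\<sigma> x + \<sigma> y \<in> range (br f)" by (intro vec.subspace_add subspace_range slice_inv)
    have "(x - br e (\<sigma> x)) + (y - br e (\<sigma> y)) \<in> cen" by (intro vec.subspace_add subspace_cen slice_inv)
    then show "x + y - br e (\<sigma> x + \<sigma> y) \<in> cen" by (simp add: R.add algebra_simps)
  qed
  moreover have "\<sigma> (c *s x) = c *s \<sigma> x" for c x
  proof (rule slice_inv_eqI)
    show "c *s \<sigma> x \<in> range (br f)" by (intro vec.subspace_scale subspace_range slice_inv)
    have "c *s (x - br e (\<sigma> x)) \<in> cen" by (intro vec.subspace_scale subspace_cen slice_inv)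
    then show "c *s x - br e (c *s \<sigma> x) \<in> cen" by (simp add: R.scale vec.scale_right_diff_distrib)
  qed
  ultimately show ?thesis by (simp add: complex_linear_iff)
qed

sublocale \<sigma>: Vector_Spaces.linear "(*s)" "(*s)" \<sigma> by (rule linear_slice_inv)

lemma slice_inv_cen: "\<sigma> x = 0 \<longleftrightarrow> x \<in> cen"
  using slice_inv_eqI[of 0 x] slice_inv(2)[of x] vec.subspace_0[OF subspace_range] by (auto simp: R.zero)

lemma slice_inv_e: "u \<in> range (br f) \<Longrightarrow> \<sigma> (br e u) = u"
  by (rule slice_inv_eqI) (auto simp: vec.subspace_0[OF subspace_cen])

lemma pr_br_f: "pr j (br f x) = br f (pr (j + 2) x)"
  using pr_br[OF grade_f, of j x] by simp

lemma pr_cen: "x \<in> cen \<Longrightarrow> pr j x \<in> cen"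
  using pr_br_f[of "j - 2" x] by (simp add: centralizer_def pr.zero)

lemma pr_range: "x \<in> range (br f) \<Longrightarrow> pr j x \<in> range (br f)"
  by (auto simp: pr_br_f)

text \<open>The component of degree \<open>j - 2\<close> of a solution solves the same equation, so
  uniqueness makes the solution homogeneous.\<close>

lemma slice_inv_grade: assumes "x \<in> \<Gamma> j" shows "\<sigma> x \<in> \<Gamma> (j - 2)"
proof -
  have "pr j (x - br e (\<sigma> x)) = x - br e (pr (j - 2) (\<sigma> x))"
    by (simp add: pr.diff pr_same[OF assms] pr_br[OF grade_e])
  then have "\<sigma> x = pr (j - 2) (\<sigma> x)"
    by (intro slice_inv_eqI) (metis pr_range slice_inv(1), metis pr_cen slice_inv(2))
  then show ?thesis by (metis pr_props(1))
qed

lemma slice_inv_low: "x \<in> low k \<Longrightarrow> \<sigma> x \<in> low (k - 2)"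
  using low_homogeneous[OF linear_slice_inv, of "- 2" x k] slice_inv_grade by simp

lemma cen_grade_0: assumes "x \<in> cen" "x \<in> \<Gamma> j" "1 \<le> j" shows "x = 0"
proof -
  have "inj_on (br f) (\<Gamma> j)" using good assms(3) by (auto simp: good_grading_def)
  moreover have "br f x = br f 0" using assms(1) by (simp add: centralizer_def R.zero)
  ultimately show ?thesis using assms(2) vec.subspace_0[OF subspace_grade] by (rule inj_onD)
qed

text \<open>The injectivity half of goodness. It puts \<open>Q\<close> inside \<open>S\<close> and
  bounds \<open>q - e\<close> by degree 0 for \<open>q\<close> in \<open>Q\<close>.\<close>

lemma cen_low: "x \<in> cen \<Longrightarrow> x \<in> low 0"
  using cen_grade_0[OF pr_cen pr_props(1)] by (auto simp: low_def)

text \<open>The surjectivity half of goodness. Gauge parameters have negative degree, so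
  \<open>slice_inv\<close> recovers them from their bracket with \<open>e\<close>.\<close>

lemma low_range: "low (-1) \<subseteq> range (br f)"
proof (rule low_subset[OF subspace_range])
  fix i :: int assume "i \<le> -1"
  then have "br f ` \<Gamma> (i + 2) = \<Gamma> (i + 2 - 2)" using good unfolding good_grading_def
    by (metis add_le_cancel_right one_add_one add.commute add_diff_cancel_right' diff_add_cancel uminus_add_conv_diff)
  then show "\<Gamma> i \<subseteq> range (br f)" by auto
qed

section \<open>The subspaces m, n and b within the degree filtration\<close>

abbreviation "mm \<equiv> m_alg \<Gamma> l"
abbreviation "nn \<equiv> n_alg br e \<Gamma> l"
abbreviation "bb \<equiv> b_space br e \<Gamma> l"

lemma subspace_mm: "vec.subspace mm" and subspace_nn: "vec.subspace nn"
  by (auto simp: m_alg_def n_alg_def)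

lemma subspace_bb: "vec.subspace bb"
  by (auto simp: vec.subspace_def b_space_def killing_add_left killing_scale_left)

lemma l_compl: "l \<subseteq> sympl_compl br e \<Gamma> l"
  using isotropic by (auto simp: isotropic_def sympl_compl_def)

lemma mm_subset_nn: "mm \<subseteq> nn"
  unfolding m_alg_def n_alg_def using l_compl by (intro vec.span_mono) auto

lemma nn_subset_low: "nn \<subseteq> low (-1)"
  unfolding n_alg_def
  by (intro vec.span_minimal subspace_low) (auto simp: sympl_compl_def intro!: grade_low)

lemma low_subset_mm: "low (-2) \<subseteq> mm"
  by (rule low_subset[OF subspace_mm]) (auto simp: m_alg_def intro!: vec.span_base)

lemma l_subset_mm: "l \<subseteq> mm"
  by (auto simp: m_alg_def intro: vec.span_base)

text \<open>Together with its neighbours this confines \<open>n\<close> and \<open>m\<close> between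
  \<open>low (-2)\<close> and \<open>low (-1)\<close>, and \<open>b\<close> between
  \<open>low 0\<close> and \<open>low 1\<close>: the choice of \<open>l\<close> is felt only in
  degrees -1 and 1.\<close>

lemma low_subset_bb: "low 0 \<subseteq> bb"
  using nn_subset_low killing_low[of _ 0 _ "-1"] by (auto simp: b_space_def)

lemma bb_subset_low: "bb \<subseteq> low 1"
proof
  fix x assume x: "x \<in> bb"
  have "pr j x = 0" if "j > 1" for j
  proof (rule nondegenerate)
    fix y
    have "pr (- j) y \<in> low (-2)" using that by (intro grade_low[OF pr_props(1)]) simp
    then have "pr (- j) y \<in> nn" using low_subset_mm mm_subset_nn by auto
    then show "killing br (pr j x) y = 0" using x by (simp add: b_space_def killing_pr)
  qed
  then show "x \<in> low 1" by (simp add: low_def)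
qed

text \<open>The degree-one part of an element of \<open>b\<close> has the form \<open>[e, a]\<close>, and \<open>a\<close> lies in the double
  symplectic complement of \<open>l\<close>, which is \<open>l\<close> itself.\<close>

lemma slice_inv_bb_degree_1: assumes x: "x \<in> bb" shows "\<sigma> (pr 1 x) \<in> l"
proof (rule ccontr)
  define a where "a = \<sigma> (pr 1 x)"
  assume "\<sigma> (pr 1 x) \<notin> l"
  then have al: "a \<notin> l" by (simp add: a_def)
  have a: "a \<in> \<Gamma> (-1)" using slice_inv_grade[OF pr_props(1)[of 1 x]] by (simp add: a_def)
  have lG: "l \<subseteq> \<Gamma> (-1)" and sl: "vec.subspace l" using isotropic by (auto simp: isotropic_def)
  have inj: "u = v" if "u \<in> \<Gamma> (-1)" "v \<in> \<Gamma> (-1)" "br e u = br e v" for u v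
    using that slice_inv_e low_range grade_low[of _ "-1" "-1"] by (metis order.refl subsetD)
  have ea: "br e a \<in> \<Gamma> 1" using grade_br[OF grade_e a] by simp
  have "pr 1 x - br e a = 0"
    using slice_inv(2)[of "pr 1 x"] vec.subspace_diff[OF subspace_grade pr_props(1)[of 1 x] ea]
    by (intro cen_grade_0[where j = 1]) (auto simp: a_def)
  then have xa: "pr 1 x = br e a" by simp
  have "br e a \<notin> br e ` l" using inj a al lG by blast
  then obtain y where y: "\<And>w. w \<in> br e ` l \<Longrightarrow> killing br y w = 0" "killing br y (br e a) \<noteq> 0"
    using killing_separation[OF R.subspace_image[OF sl]] by metis
  have ky: "killing br (pr (-1) y) u = killing br y u" if "u \<in> \<Gamma> 1" for u
    using that by (simp add: killing_pr pr_same)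
  have "pr (-1) y \<in> sympl_compl br e \<Gamma> l"
  proof -
    have "sympl br e (pr (-1) y) w = 0" if w: "w \<in> l" for w
    proof -
      have "br e w \<in> \<Gamma> 1" using grade_br[OF grade_e, of w "-1"] w lG by auto
      then have "killing br (br e w) (pr (-1) y) = 0" using ky y(1)[of "br e w"] w by (simp add: killing_sym)
      then have "killing br e (br w (pr (-1) y)) = 0" by (simp add: killing_invariant)
      then show ?thesis unfolding sympl_def by (subst br_anti) (simp add: killing_minus)
    qed
    then show ?thesis by (simp add: sympl_compl_def pr_props)
  qed
  then have "pr (-1) y \<in> nn" by (auto simp: n_alg_def intro: vec.span_base)
  then have "killing br x (pr (-1) y) = 0" using x by (simp add: b_space_def)
  then have "killing br (pr 1 x) y = 0" by (simp add: killing_pr)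
  then show False using y(2) xa by (simp add: killing_sym)
qed

text \<open>The part of degree at most 0 is mapped into \<open>low (-2)\<close>, hence into
  \<open>m\<close> for any \<open>l\<close>; only the part of degree 1 needs the isotropic subspace.
  This keeps the gauge fixing of points of \<open>S\<close> inside \<open>m\<close>.\<close>

lemma slice_inv_bb: assumes x: "x \<in> bb" shows "\<sigma> x \<in> mm"
proof -
  have "x - pr 1 x \<in> low 0"
  proof -
    have "pr j (x - pr 1 x) = 0" if "j > 0" for j
      using that x bb_subset_low by (cases "j = 1") (auto simp: pr.diff pr_pr low_def)
    then show ?thesis by (simp add: low_def)
  qed
  then have "\<sigma> (x - pr 1 x) \<in> mm" using slice_inv_low[of _ 0] low_subset_mm by auto
  moreover have "\<sigma> (pr 1 x) \<in> mm" using slice_inv_bb_degree_1[OF x] l_subset_mm by auto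
  ultimately show ?thesis using vec.subspace_add[OF subspace_mm] by (fastforce simp: \<sigma>.diff)
qed

lemma killing_cen_range: "x \<in> cen \<Longrightarrow> y \<in> range (br f) \<Longrightarrow> killing br x y = 0"
  using killing_invariant'[of f _ x] by (auto simp: centralizer_def killing_sym)

definition low1_proj :: "complex^'n \<Rightarrow> complex^'n" where
  "low1_proj x = (\<Sum>j\<in>{j\<in>degrees. j \<le> 1}. pr j x)"

lemma linear_low1_proj: "Vector_Spaces.linear (*s) (*s) low1_proj"
  by (simp add: complex_linear_iff low1_proj_def pr_add pr_scale sum.distrib vec.scale_sum_right)

lemma low1_proj_low: "low1_proj x \<in> low 1"
  unfolding low1_proj_def by (intro vec.subspace_sum subspace_low grade_low[OF pr_props(1)]) auto

lemma low1_proj_id: "x \<in> low 1 \<Longrightarrow> low1_proj x = x"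
  unfolding low1_proj_def by (rule low_expand[symmetric])

end

section \<open>Loops and curves of loops\<close>

lemma vec_subspace_imp_closed: "vec.subspace V \<Longrightarrow> closed (V :: (complex^'n::finite) set)"
  by (rule closed_subspace) (auto simp: vec.subspace_def subspace_def scaleR_eq_smult)

lemma has_vector_derivative_in_subspace:
  fixes g :: "real \<Rightarrow> complex^'n::finite"
  assumes d: "(g has_vector_derivative d) (at x)" and V: "vec.subspace V" and g: "\<And>y. g y \<in> V"
  shows "d \<in> V"
proof (rule Lim_in_closed_set[OF vec_subspace_imp_closed[OF V]])
  show "((\<lambda>y. (g y - g x) /\<^sub>R (y - x)) \<longlongrightarrow> d) (at x)"
  proof (rule LIM_zero_cancel, rule tendsto_norm_zero_cancel)
    have "((\<lambda>y. norm (g y - g x - (y - x) *\<^sub>R d) / norm (y - x)) \<longlongrightarrow> 0) (at x)"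
      using d by (simp add: has_vector_derivative_def has_derivative_iff_norm)
    moreover have "norm (g y - g x - (y - x) *\<^sub>R d) / norm (y - x) = norm ((g y - g x) /\<^sub>R (y - x) - d)"
      if "y \<noteq> x" for y
    proof -
      have "(g y - g x) /\<^sub>R (y - x) - d = (g y - g x - (y - x) *\<^sub>R d) /\<^sub>R (y - x)"
        using that by (simp add: scaleR_diff_right)
      then show ?thesis by (simp add: divide_inverse mult.commute)
    qed
    ultimately show "((\<lambda>y. norm ((g y - g x) /\<^sub>R (y - x) - d)) \<longlongrightarrow> 0) (at x)"
      by (elim Lim_transform_eventually) (auto simp: eventually_at_filter)
  qed
  show "\<forall>\<^sub>F y in at x. (g y - g x) /\<^sub>R (y - x) \<in> V"
    unfolding scaleR_eq_smult
    by (intro always_eventually allI vec.subspace_scale[OF V] vec.subspace_diff[OF V] g)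
qed simp

lemma smooth_map_frechet_shift:
  assumes "smooth_map u" "\<And>p. u (p + c) = u p"
  shows "frechet_derivative u (at (p + c)) v = frechet_derivative u (at p) v"
proof -
  have "u (p + c + t *\<^sub>R v) = u (p + t *\<^sub>R v)" for t
    using assms(2)[of "p + t *\<^sub>R v"] by (simp add: algebra_simps)
  then show ?thesis
    using smooth_map_along_line[OF assms(1), of "p + c" v 0] smooth_map_along_line[OF assms(1), of p v 0]
    by (simp add: vector_derivative_unique_at)
qed

lemma smooth_map_frechet_bilinear:
  assumes "bounded_bilinear B" "smooth_map u" "smooth_map v"
  shows "frechet_derivative (\<lambda>p. B (u p) (v p)) (at p) w
     = B (frechet_derivative u (at p) w) (v p) + B (u p) (frechet_derivative v (at p) w)"
proof -
  have "((\<lambda>p. B (u p) (v p)) has_derivative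
      (\<lambda>w. B (u p) (frechet_derivative v (at p) w) + B (frechet_derivative u (at p) w) (v p))) (at p)"
    by (rule bounded_bilinear.FDERIV[OF assms(1) smooth_map_has_derivative[OF assms(2)] smooth_map_has_derivative[OF assms(3)]])
  from frechet_derivative_at[OF this, symmetric] show ?thesis by (simp add: add.commute)
qed

lemma smooth_map_frechet_add:
  assumes "smooth_map u" "smooth_map v"
  shows "frechet_derivative (\<lambda>p. u p + v p) (at p) w
     = frechet_derivative u (at p) w + frechet_derivative v (at p) w"
proof -
  have "((\<lambda>p. u p + v p) has_derivative
      (\<lambda>w. frechet_derivative u (at p) w + frechet_derivative v (at p) w)) (at p)"
    by (rule has_derivative_add[OF smooth_map_has_derivative[OF assms(1)] smooth_map_has_derivative[OF assms(2)]])
  from frechet_derivative_at[OF this, symmetric] show ?thesis by simp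
qed

lemma loop_deriv_eq:
  assumes "smooth_map u" shows "loop_deriv u x = frechet_derivative u (at x) 1"
  unfolding loop_deriv_def
  using smooth_map_along_line[OF assms, of 0 1 x] by (intro vector_derivative_at) simp

lemma loopsD: "q \<in> loops V \<Longrightarrow> smooth_map q" "q \<in> loops V \<Longrightarrow> q (x + 2 * pi) = q x"
  "q \<in> loops V \<Longrightarrow> q x \<in> V"
  by (auto simp: loops_def)

lemma loops_iff: "q \<in> loops V \<longleftrightarrow> q \<in> loops UNIV \<and> (\<forall>x. q x \<in> V)"
  by (auto simp: loops_def)

lemma loops_UNIV: "q \<in> loops V \<Longrightarrow> q \<in> loops UNIV"
  by (auto simp: loops_def)

lemma loops_const: "c \<in> V \<Longrightarrow> (\<lambda>x. c) \<in> loops V"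
  by (auto simp: loops_def)

lemma loops_add: "u \<in> loops UNIV \<Longrightarrow> v \<in> loops UNIV \<Longrightarrow> (\<lambda>x. u x + v x) \<in> loops UNIV"
  by (auto simp: loops_def)

lemma loops_diff: "u \<in> loops UNIV \<Longrightarrow> v \<in> loops UNIV \<Longrightarrow> (\<lambda>x. u x - v x) \<in> loops UNIV"
  by (auto simp: loops_def)

lemma loops_minus: "u \<in> loops UNIV \<Longrightarrow> (\<lambda>x. - u x) \<in> loops UNIV"
  by (auto simp: loops_def)

lemma loops_bounded_linear: "bounded_linear L \<Longrightarrow> u \<in> loops UNIV \<Longrightarrow> (\<lambda>x. L (u x)) \<in> loops UNIV"
  by (auto simp: loops_def intro: smooth_map_bounded_linear)

lemma loops_linear: "Vector_Spaces.linear (*s) (*s) L \<Longrightarrow> u \<in> loops UNIV \<Longrightarrow> (\<lambda>x. L (u x)) \<in> loops UNIV"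
  by (rule loops_bounded_linear[OF complex_linear_bounded])

lemma loops_loop_deriv: assumes "u \<in> loops UNIV" shows "loop_deriv u \<in> loops UNIV"
proof -
  have s: "smooth_map u" using assms by (rule loopsD)
  have "loop_deriv u = (\<lambda>x. frechet_derivative u (at x) 1)" using loop_deriv_eq[OF s] by auto
  moreover have "smooth_map (\<lambda>x. frechet_derivative u (at x) 1)" by (rule smooth_map_frechet_derivative[OF s])
  moreover have "frechet_derivative u (at (x + 2 * pi)) 1 = frechet_derivative u (at x) 1" for x
    by (rule smooth_map_frechet_shift[OF s loopsD(2)[OF assms]])
  ultimately show ?thesis by (simp add: loops_def)
qed

lemma has_vector_derivative_loop_deriv:
  assumes "smooth_map u" shows "(u has_vector_derivative loop_deriv u x) (at x)"
  using smooth_map_has_derivative[OF assms, of x] unfolding loop_deriv_def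
  by (metis differentiableI vector_derivative_works)

lemma loop_deriv_in: "u \<in> loops V \<Longrightarrow> vec.subspace V \<Longrightarrow> loop_deriv u x \<in> V"
  by (rule has_vector_derivative_in_subspace[OF has_vector_derivative_loop_deriv[OF loopsD(1)] _ loopsD(3)])

lemma loop_deriv_add:
  "smooth_map u \<Longrightarrow> smooth_map v \<Longrightarrow> loop_deriv (\<lambda>x. u x + v x) x = loop_deriv u x + loop_deriv v x"
  by (simp add: loop_deriv_eq smooth_map_add smooth_map_frechet_add)

lemma loop_deriv_diff:
  "smooth_map u \<Longrightarrow> smooth_map v \<Longrightarrow> loop_deriv (\<lambda>x. u x - v x) x = loop_deriv u x - loop_deriv v x"
  unfolding loop_deriv_def
  by (rule vector_derivative_at) (intro has_vector_derivative_diff;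
      use has_vector_derivative_loop_deriv in \<open>auto simp: loop_deriv_def\<close>)

lemma loop_deriv_zero: "loop_deriv (\<lambda>x. 0) x = 0"
  unfolding loop_deriv_def by simp

section \<open>Smooth curves of loops and their velocities\<close>

abbreviation "uncurry_curve \<gamma> \<equiv> (\<lambda>p. \<gamma> (fst p) (snd p))"

lemma smooth_curve_in_loops_iff:
  "smooth_curve_in (loops UNIV) \<gamma> \<longleftrightarrow> smooth_map (uncurry_curve \<gamma>) \<and> (\<forall>t x. \<gamma> t (x + 2 * pi) = \<gamma> t x)"
proof -
  have "smooth_map (\<gamma> t)" if "smooth_map (uncurry_curve \<gamma>)" for t
    using smooth_map_compose_affine[OF _ that, of "\<lambda>x. (0, x)" "(t, 0)"]
    by (simp add: bounded_linear_Pair bounded_linear_zero bounded_linear_ident)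
  then show ?thesis by (auto simp: smooth_curve_in_def loops_def)
qed

definition curve_velocity :: "(real \<Rightarrow> 'n loop) \<Rightarrow> 'n::finite loop" where
  "curve_velocity \<gamma> = (\<lambda>x. vector_derivative (\<lambda>t. \<gamma> t x) (at 0))"

lemma has_vector_derivative_curve:
  assumes "smooth_map (uncurry_curve \<gamma>)"
  shows "((\<lambda>t. \<gamma> t x) has_vector_derivative frechet_derivative (uncurry_curve \<gamma>) (at (t, x)) (1, 0)) (at t)"
  using smooth_map_along_line[OF assms, of "(0, x)" "(1, 0)" t] by simp

lemma curve_velocity_eq:
  assumes "smooth_map (uncurry_curve \<gamma>)"
  shows "curve_velocity \<gamma> x = frechet_derivative (uncurry_curve \<gamma>) (at (0, x)) (1, 0)"
  unfolding curve_velocity_def by (rule vector_derivative_at[OF has_vector_derivative_curve[OF assms]])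

lemma loop_deriv_curve_eq:
  assumes "smooth_map (uncurry_curve \<gamma>)"
  shows "loop_deriv (\<gamma> t) x = frechet_derivative (uncurry_curve \<gamma>) (at (t, x)) (0, 1)"
  unfolding loop_deriv_def
  using smooth_map_along_line[OF assms, of "(t, 0)" "(0, 1)" x] by (intro vector_derivative_at) simp

lemma smooth_map_restrict_fst: "smooth_map G \<Longrightarrow> smooth_map (\<lambda>x. G (t, x))"
  for G :: "real \<times> real \<Rightarrow> 'a::real_normed_vector"
  using smooth_map_compose_affine[of "\<lambda>x::real. (0::real, x)" G "(t, 0)"]
  by (simp add: bounded_linear_Pair bounded_linear_zero bounded_linear_ident)

lemma loops_curve_velocity:
  assumes "smooth_curve_in (loops UNIV) \<gamma>" shows "curve_velocity \<gamma> \<in> loops UNIV"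
proof -
  have s: "smooth_map (uncurry_curve \<gamma>)" using assms by (simp add: smooth_curve_in_def)
  have "uncurry_curve \<gamma> (p + (0, 2 * pi)) = uncurry_curve \<gamma> p" for p
    using assms by (simp add: smooth_curve_in_loops_iff)
  from smooth_map_frechet_shift[OF s this, of "(0, x)" for x]
    smooth_map_restrict_fst[OF smooth_map_frechet_derivative[OF s], of 0]
  have "smooth_map (\<lambda>x. frechet_derivative (uncurry_curve \<gamma>) (at (0, x)) (1, 0))"
    "\<And>x. frechet_derivative (uncurry_curve \<gamma>) (at (0, x + 2 * pi)) (1, 0)
       = frechet_derivative (uncurry_curve \<gamma>) (at (0, x)) (1, 0)" by auto
  moreover have "curve_velocity \<gamma> = (\<lambda>x. frechet_derivative (uncurry_curve \<gamma>) (at (0, x)) (1, 0))"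
    using curve_velocity_eq[OF s] by auto
  ultimately show ?thesis by (simp add: loops_def)
qed

lemma smooth_curve_loop_deriv:
  assumes "smooth_curve_in (loops UNIV) \<gamma>" shows "smooth_curve_in (loops UNIV) (\<lambda>t. loop_deriv (\<gamma> t))"
proof -
  have s: "smooth_map (uncurry_curve \<gamma>)" using assms by (simp add: smooth_curve_in_def)
  show ?thesis unfolding smooth_curve_in_def
    using smooth_map_frechet_derivative[OF s, of "(0, 1)"] assms loops_loop_deriv[of "\<gamma> _"]
    by (auto simp: loop_deriv_curve_eq[OF s] smooth_curve_in_def)
qed

text \<open>Symmetry of the mixed derivative in the curve parameter and the loop variable.\<close>

lemma curve_velocity_loop_deriv:
  assumes "smooth_curve_in (loops UNIV) \<gamma>"
  shows "curve_velocity (\<lambda>t. loop_deriv (\<gamma> t)) = loop_deriv (curve_velocity \<gamma>)"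
proof
  fix x
  have s: "smooth_map (uncurry_curve \<gamma>)" using assms by (simp add: smooth_curve_in_def)
  have s': "smooth_map (uncurry_curve (\<lambda>t. loop_deriv (\<gamma> t)))"
    using smooth_curve_loop_deriv[OF assms] by (simp add: smooth_curve_in_def)
  have "curve_velocity (\<lambda>t. loop_deriv (\<gamma> t)) x
     = frechet_derivative (\<lambda>p. frechet_derivative (uncurry_curve \<gamma>) (at p) (0, 1)) (at (0, x)) (1, 0)"
    unfolding curve_velocity_eq[OF s'] by (simp add: loop_deriv_curve_eq[OF s])
  also have "\<dots> = frechet_derivative (\<lambda>p. frechet_derivative (uncurry_curve \<gamma>) (at p) (1, 0)) (at (0, x)) (0, 1)"
    by (rule smooth_map_symmetric_derivative[OF s])
  also have "\<dots> = loop_deriv (curve_velocity \<gamma>) x"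
  proof -
    define G where "G p = frechet_derivative (uncurry_curve \<gamma>) (at p) (1, 0)" for p
    have "smooth_map G" unfolding G_def by (rule smooth_map_frechet_derivative[OF s])
    from smooth_map_along_line[OF this, of "(0, 0)" "(0, 1)" x]
    have "((\<lambda>x. G (0, x)) has_vector_derivative frechet_derivative G (at (0, x)) (0, 1)) (at x)" by simp
    moreover have "curve_velocity \<gamma> = (\<lambda>x. G (0, x))" by (auto simp: curve_velocity_eq[OF s] G_def)
    ultimately show ?thesis
      unfolding loop_deriv_def G_def by (simp add: vector_derivative_at)
  qed
  finally show "curve_velocity (\<lambda>t. loop_deriv (\<gamma> t)) x = loop_deriv (curve_velocity \<gamma>) x" .
qed

lemma smooth_curve_line:
  assumes "q \<in> loops UNIV" "w \<in> loops UNIV"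
  shows "smooth_curve_in (loops UNIV) (\<lambda>t x. q x + t *\<^sub>R w x)" (is ?A)
    and "curve_velocity (\<lambda>t x. q x + t *\<^sub>R w x) = w" (is ?B)
proof -
  have "smooth_map (\<lambda>p. q (snd p))" "smooth_map (\<lambda>p. w (snd p))"
    by (rule smooth_map_compose_linear[OF bounded_linear_snd]; use assms loopsD in blast)+
  moreover have "smooth_map (\<lambda>p::real \<times> real. fst p)"
    by (rule smooth_map_bounded_linear_self[OF bounded_linear_fst])
  ultimately show ?A unfolding smooth_curve_in_loops_iff
    using assms by (auto intro!: smooth_map_add bounded_bilinear.smooth_map_prod[OF bounded_bilinear_scaleR] simp: loopsD)
  show ?B unfolding curve_velocity_def
    by (intro ext vector_derivative_at) (auto intro!: derivative_eq_intros)
qed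

lemma represents_differential_line:
  assumes "represents_differential br M F q v" and "q \<in> loops UNIV" "w \<in> loops UNIV"
    and "\<And>t. (\<lambda>x. q x + t *\<^sub>R w x) \<in> M"
  shows "((\<lambda>t. F (\<lambda>x. q x + t *\<^sub>R w x)) has_vector_derivative pairing br v w) (at 0)"
proof -
  have "smooth_curve_in M (\<lambda>t x. q x + t *\<^sub>R w x)"
    using smooth_curve_line(1)[OF assms(2,3)] assms(4) by (auto simp: smooth_curve_in_def)
  moreover have "(\<lambda>x. q x + 0 *\<^sub>R w x) = q" by simp
  ultimately have "((\<lambda>t. F (\<lambda>x. q x + t *\<^sub>R w x)) has_vector_derivative
     pairing br v (curve_velocity (\<lambda>t x. q x + t *\<^sub>R w x))) (at 0)"
    using assms(1) unfolding represents_differential_def curve_velocity_def by blast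
  then show ?thesis by (simp add: smooth_curve_line(2)[OF assms(2,3)])
qed

lemma gradient_represents:
  "functional_on br (loops UNIV) F \<Longrightarrow> q \<in> loops UNIV \<Longrightarrow>
     represents_differential br (loops UNIV) F q (gradient br F q)"
  unfolding functional_on_def gradient_def by (metis someI_ex)

section \<open>The pairing of loops and the second Poisson tensor\<close>

context lie_alg
begin

lemma loops_br: "u \<in> loops UNIV \<Longrightarrow> v \<in> loops UNIV \<Longrightarrow> (\<lambda>x. br (u x) (v x)) \<in> loops UNIV"
  by (auto simp: loops_def intro: bounded_bilinear.smooth_map_prod[OF bounded_bilinear_br])

lemma loops_P2: "q \<in> loops UNIV \<Longrightarrow> v \<in> loops UNIV \<Longrightarrow> P2 br q v \<in> loops UNIV"
  unfolding P2_def by (intro loops_add loops_br loops_loop_deriv)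

lemma integrable_pairing:
  assumes "u \<in> loops UNIV" "v \<in> loops UNIV"
  shows "(\<lambda>x. killing br (u x) (v x)) integrable_on {0..2 * pi}"
  by (intro integrable_continuous_real smooth_map_continuous_on
      bounded_bilinear.smooth_map_prod[OF bounded_bilinear_killing] loopsD(1)[OF assms(1)] loopsD(1)[OF assms(2)])

lemma pairing_sym: "pairing br u v = pairing br v u"
  unfolding pairing_def by (subst killing_sym) simp

lemma pairing_add_left:
  "u \<in> loops UNIV \<Longrightarrow> u' \<in> loops UNIV \<Longrightarrow> v \<in> loops UNIV \<Longrightarrow>
   pairing br (\<lambda>x. u x + u' x) v = pairing br u v + pairing br u' v"
  unfolding pairing_def killing_add_left by (intro integral_add integrable_pairing)

lemma pairing_diff_left:
  "u \<in> loops UNIV \<Longrightarrow> u' \<in> loops UNIV \<Longrightarrow> v \<in> loops UNIV \<Longrightarrow>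
   pairing br (\<lambda>x. u x - u' x) v = pairing br u v - pairing br u' v"
  unfolding pairing_def killing_diff by (intro integral_diff integrable_pairing)

lemma pairing_minus: "pairing br (\<lambda>x. - u x) v = - pairing br u v"
  unfolding pairing_def killing_minus by simp

lemma pairing_add_right:
  "u \<in> loops UNIV \<Longrightarrow> v \<in> loops UNIV \<Longrightarrow> v' \<in> loops UNIV \<Longrightarrow>
   pairing br u (\<lambda>x. v x + v' x) = pairing br u v + pairing br u v'"
  unfolding pairing_sym[of u] by (rule pairing_add_left)

lemma pairing_0: "(\<And>x. killing br (u x) (v x) = 0) \<Longrightarrow> pairing br u v = 0"
  by (simp add: pairing_def)

lemma pairing_br: "pairing br (\<lambda>x. br (u x) (v x)) w = pairing br u (\<lambda>x. br (v x) (w x))"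
  by (simp add: pairing_def killing_invariant)

lemma pairing_br': "pairing br u (\<lambda>x. br (v x) (w x)) = - pairing br (\<lambda>x. br (v x) (u x)) w"
  by (simp add: pairing_def killing_invariant')

text \<open>Integration by parts; periodicity cancels the boundary terms.\<close>

lemma pairing_loop_deriv:
  assumes u: "u \<in> loops UNIV" and v: "v \<in> loops UNIV"
  shows "pairing br u (loop_deriv v) = - pairing br (loop_deriv u) v"
proof -
  let ?g = "\<lambda>x. killing br (u x) (v x)"
  have per: "u (2 * pi) = u 0" "v (2 * pi) = v 0"
    using loopsD(2)[OF u, of 0] loopsD(2)[OF v, of 0] by simp_all
  have "(?g has_vector_derivative killing br (u x) (loop_deriv v x) + killing br (loop_deriv u x) (v x)) (at x within {0..2*pi})" for x
    by (intro bounded_bilinear.has_vector_derivative[OF bounded_bilinear_killing]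
        has_vector_derivative_at_within[OF has_vector_derivative_loop_deriv] loopsD(1)[OF u] loopsD(1)[OF v])
  then have "((\<lambda>x. killing br (u x) (loop_deriv v x) + killing br (loop_deriv u x) (v x)) has_integral
      ?g (2 * pi) - ?g 0) {0..2*pi}"
    by (intro fundamental_theorem_of_calculus) auto
  then have "((\<lambda>x. killing br (u x) (loop_deriv v x) + killing br (loop_deriv u x) (v x)) has_integral 0) {0..2*pi}"
    by (simp add: per)
  then have "integral {0..2*pi} (\<lambda>x. killing br (u x) (loop_deriv v x) + killing br (loop_deriv u x) (v x)) = 0"
    by (rule integral_unique)
  moreover have "integral {0..2*pi} (\<lambda>x. killing br (u x) (loop_deriv v x) + killing br (loop_deriv u x) (v x))
     = pairing br u (loop_deriv v) + pairing br (loop_deriv u) v"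
    unfolding pairing_def by (intro integral_add integrable_pairing loops_loop_deriv u v)
  ultimately show ?thesis by (simp add: eq_neg_iff_add_eq_0)
qed

lemma pairing_P2_skew:
  assumes "q \<in> loops UNIV" "u \<in> loops UNIV" "v \<in> loops UNIV"
  shows "pairing br u (P2 br q v) = - pairing br (P2 br q u) v"
  unfolding P2_def using assms
  by (simp add: pairing_add_left pairing_add_right loops_br loops_loop_deriv
      pairing_loop_deriv[of u v] pairing_br'[of u q v])

text \<open>Nondegeneracy of the pairing is tested against the loops \<open>cnj \<langle>u | y\<rangle> y\<close>.\<close>

lemma pairing_zero_imp_orthogonal:
  assumes u: "u \<in> loops UNIV" and V: "vec.subspace V" and y: "y \<in> V"
    and 0: "\<And>n. n \<in> loops V \<Longrightarrow> pairing br u n = 0"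
  shows "killing br (u x) y = 0"
proof -
  define c where "c x = killing br (u x) y" for x
  define n where "n x = cnj (c x) *s y" for x
  have blk: "bounded_linear (\<lambda>v. killing br v y)"
    by (rule bounded_bilinear.bounded_linear_left[OF bounded_bilinear_killing])
  have "bounded_linear (\<lambda>v. cnj (killing br v y) *s y)"
    unfolding linear_conv_bounded_linear[symmetric]
    by (rule linearI) (auto simp: killing_add_left killing_scale_left scaleR_eq_smult vec.scale_left_distrib)
  then have "n \<in> loops UNIV"
    unfolding n_def c_def by (rule loops_bounded_linear[OF _ u])
  then have "n \<in> loops V" using vec.subspace_scale[OF V y] by (subst loops_iff) (auto simp: n_def)
  then have "pairing br u n = 0" by (rule 0)
  moreover have "killing br (u x) (n x) = of_real ((cmod (c x))\<^sup>2)" for x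
    by (simp add: n_def killing_scale_right c_def[symmetric] mult.commute complex_norm_square[symmetric] del: of_real_power)
  ultimately have i0: "integral {0..2 * pi} (\<lambda>x. complex_of_real ((cmod (c x))\<^sup>2)) = 0"
    by (simp add: pairing_def)
  have cc: "continuous_on {0..2*pi} c"
    unfolding c_def by (intro smooth_map_continuous_on smooth_map_bounded_linear[OF blk] loopsD(1)[OF u])
  then have cont: "continuous_on {0..2*pi} (\<lambda>x. (cmod (c x))\<^sup>2)" by (intro continuous_intros)
  have "((\<lambda>x. (cmod (c x))\<^sup>2) has_integral integral {0..2*pi} (\<lambda>x. (cmod (c x))\<^sup>2)) {0..2*pi}"
    by (intro integrable_integral integrable_continuous_real cont)
  from has_integral_of_real[OF this, where 'b = complex] i0
  have "integral {0..2*pi} (\<lambda>x. (cmod (c x))\<^sup>2) = 0" by (metis integral_unique of_real_eq_0_iff)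
  then have hi: "((\<lambda>x. (cmod (c x))\<^sup>2) has_integral 0) (cbox 0 (2*pi))"
    using integrable_integral[OF integrable_continuous_real[OF cont]] by simp
  have z: "c x = 0" if "x \<in> {0..2*pi}" for x
    using has_integral_0_cbox_imp_0[OF _ _ hi, of x] cont that pi_gt_zero by (simp add: not_le)
  define k where "k = \<lfloor>x / (2 * pi)\<rfloor>"
  have per: "c (x + of_int k * (2 * pi)) = c x" for x and k :: int
  proof -
    have nat: "c (x + real m * (2 * pi)) = c x" for x m
    proof (induction m)
      case (Suc m)
      have "x + real (Suc m) * (2 * pi) = (x + real m * (2 * pi)) + 2 * pi" by (simp add: algebra_simps)
      then show ?case using Suc loopsD(2)[OF u] by (simp only: c_def)
    qed simp
    show ?thesis
    proof (cases "k \<ge> 0")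
      case True
      then show ?thesis using nat[of x "nat k"] by simp
    next
      case False
      then show ?thesis using nat[of "x + of_int k * (2 * pi)" "nat (- k)"] by simp
    qed
  qed
  have "x + of_int (- k) * (2 * pi) \<in> {0..2*pi}"
  proof -
    have "of_int k \<le> x / (2 * pi)" "x / (2 * pi) \<le> of_int k + 1" unfolding k_def by linarith+
    then have "of_int k * (2 * pi) \<le> x" "x \<le> (of_int k + 1) * (2 * pi)"
      by (simp_all only: pos_le_divide_eq pos_divide_le_eq mult_pos_pos pi_gt_zero zero_less_numeral)
    then show ?thesis by (simp add: algebra_simps)
  qed
  then show ?thesis using z per[of x "- k"] by (simp add: c_def)
qed

end

section \<open>Exponentials in the extended Lie algebra\<close>

text \<open>\<open>\<Phi> i j\<close> stands for a product of the \<open>i\<close>-th iterate on one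
  factor and the \<open>j\<close>-th on the other. Working with the indexed family allows the
  factors to live in a different space from the product, as happens for
  \<open>ext_br\<close>.\<close>

lemma funpow_leibniz:
  fixes \<Phi> :: "nat \<Rightarrow> nat \<Rightarrow> 'a::real_vector"
  assumes X: "linear X" and step: "\<And>i j. X (\<Phi> i j) = \<Phi> (Suc i) j + \<Phi> i (Suc j)"
  shows "(X ^^ k) (\<Phi> 0 0) = (\<Sum>i\<le>k. real (k choose i) *\<^sub>R \<Phi> i (k - i))"
proof (induction k)
  case (Suc k)
  have "(X ^^ Suc k) (\<Phi> 0 0) = X (\<Sum>i\<le>k. real (k choose i) *\<^sub>R \<Phi> i (k - i))"
    using Suc by simp
  also have "\<dots> = (\<Sum>i\<le>k. real (k choose i) *\<^sub>R (\<Phi> (Suc i) (k - i) + \<Phi> i (Suc (k - i))))"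
    by (simp add: linear_sum[OF X] linear_scale[OF X] step)
  also have "\<dots> = (\<Sum>i\<le>k. real (k choose i) *\<^sub>R \<Phi> (Suc i) (k - i))
     + (\<Sum>i\<le>k. real (k choose i) *\<^sub>R \<Phi> i (Suc k - i))"
    unfolding scaleR_add_right sum.distrib
    by (intro arg_cong2[where f = "(+)"] sum.cong refl) (simp add: Suc_diff_le)
  also have "(\<Sum>i\<le>k. real (k choose i) *\<^sub>R \<Phi> i (Suc k - i))
     = (\<Sum>i\<le>Suc k. real (k choose i) *\<^sub>R \<Phi> i (Suc k - i))"
    by simp
  also have "\<dots> = \<Phi> 0 (Suc k) + (\<Sum>i\<le>k. real (k choose Suc i) *\<^sub>R \<Phi> (Suc i) (k - i))"
    by (subst sum.atMost_Suc_shift) simp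
  also have "(\<Sum>i\<le>k. real (k choose i) *\<^sub>R \<Phi> (Suc i) (k - i)) + (\<Phi> 0 (Suc k) +
       (\<Sum>i\<le>k. real (k choose Suc i) *\<^sub>R \<Phi> (Suc i) (k - i)))
     = \<Phi> 0 (Suc k) + (\<Sum>i\<le>k. real (Suc k choose Suc i) *\<^sub>R \<Phi> (Suc i) (k - i))"
    by (simp add: sum.distrib[symmetric] scaleR_add_left[symmetric] add.left_commute)
  also have "\<dots> = (\<Sum>i\<le>Suc k. real (Suc k choose i) *\<^sub>R \<Phi> i (Suc k - i))"
    by (subst sum.atMost_Suc_shift) simp
  finally show ?case .
qed simp

lemma exp_leibniz:
  fixes \<Phi> :: "nat \<Rightarrow> nat \<Rightarrow> 'a::real_vector"
  assumes X: "linear X" and step: "\<And>i j. X (\<Phi> i j) = \<Phi> (Suc i) j + \<Phi> i (Suc j)"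
    and van: "\<And>i j. N \<le> i \<or> N \<le> j \<Longrightarrow> \<Phi> i j = 0" and nil: "\<And>k v. N \<le> k \<Longrightarrow> (X ^^ k) v = 0"
  shows "(\<Sum>k<N. (X ^^ k) (\<Phi> 0 0) /\<^sub>R fact k) = (\<Sum>i<N. \<Sum>j<N. \<Phi> i j /\<^sub>R (fact i * fact j))"
proof -
  \<comment> \<open>Padding the sum with zero terms makes the triangle \<open>i + j < 2 * N\<close>
    contain the whole square of indices below \<open>N\<close>; outside the square
    \<open>\<Phi>\<close> vanishes.\<close>
  have "(\<Sum>k<N. (X ^^ k) (\<Phi> 0 0) /\<^sub>R fact k) = (\<Sum>k<2 * N. (X ^^ k) (\<Phi> 0 0) /\<^sub>R fact k)"
    using nil by (intro sum.mono_neutral_left) auto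
  also have "\<dots> = (\<Sum>k<2 * N. \<Sum>i\<le>k. \<Phi> i (k - i) /\<^sub>R (fact i * fact (k - i)))"
  proof (intro sum.cong refl)
    fix k
    have "(real (k choose i) *\<^sub>R \<Phi> i (k - i)) /\<^sub>R fact k = \<Phi> i (k - i) /\<^sub>R (fact i * fact (k - i))" if "i \<le> k" for i
      using binomial_fact[OF that, where 'a = real] by (simp add: field_simps)
    then show "(X ^^ k) (\<Phi> 0 0) /\<^sub>R fact k = (\<Sum>i\<le>k. \<Phi> i (k - i) /\<^sub>R (fact i * fact (k - i)))"
      unfolding funpow_leibniz[where X = X and \<Phi> = \<Phi>, OF X, OF step] scaleR_sum_right
      by (intro sum.cong) auto
  qed
  also have "\<dots> = (\<Sum>(i, j)\<in>{(i, j). i + j < 2 * N}. \<Phi> i j /\<^sub>R (fact i * fact j))"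
    by (rule sum.triangle_reindex[symmetric])
  also have "\<dots> = (\<Sum>(i, j)\<in>{..<N} \<times> {..<N}. \<Phi> i j /\<^sub>R (fact i * fact j))"
  proof (rule sum.mono_neutral_right)
    have *: "\<Phi> i j = 0" if "\<not> (i < N \<and> j < N)" for i j
      using van[of i j] that by linarith
    show "finite {(i, j). i + j < 2 * N}"
      by (rule finite_subset[of _ "{..<2 * N} \<times> {..<2 * N}"]) auto
    show "\<forall>x\<in>{(i, j). i + j < 2 * N} - {..<N} \<times> {..<N}. (case x of (i, j) \<Rightarrow> \<Phi> i j /\<^sub>R (fact i * fact j)) = 0"
    proof
      fix x assume x: "x \<in> {(i, j). i + j < 2 * N} - {..<N} \<times> {..<N}"
      obtain a b where ab: "x = (a, b)" by (cases x)
      show "(case x of (i, j) \<Rightarrow> \<Phi> i j /\<^sub>R (fact i * fact j)) = 0"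
        using x *[of a b] by (simp add: ab)
    qed
  qed auto
  also have "\<dots> = (\<Sum>i<N. \<Sum>j<N. \<Phi> i j /\<^sub>R (fact i * fact j))"
    by (rule sum.cartesian_product[symmetric])
  finally show ?thesis .
qed

context lie_alg
begin

definition exp_ad :: "nat \<Rightarrow> complex^'n \<Rightarrow> complex^'n \<Rightarrow> complex^'n" where
  "exp_ad N a v = (\<Sum>k<N. ((\<lambda>v. - br a v) ^^ k) v /\<^sub>R fact k)"

text \<open>The truncated series of \<open>(exp X - 1) / X\<close> for \<open>X = - ad a\<close>. It
  appears because the first application of \<open>- ad m\<close> to an operator also differentiates
  \<open>m\<close>, whereas all later ones are plain brackets.\<close>

definition exp_ad1 :: "nat \<Rightarrow> complex^'n \<Rightarrow> complex^'n \<Rightarrow> complex^'n" where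
  "exp_ad1 N a v = (\<Sum>k<N. ((\<lambda>v. - br a v) ^^ k) v /\<^sub>R fact (Suc k))"

text \<open>The extended Lie algebra of pairs \<open>(a, u)\<close>, standing for the first-order operator
  \<open>\<partial>\<^sub>a + ad u\<close> with a constant direction \<open>a\<close>; \<open>ext_step m\<close> is the action of \<open>- ad m\<close>.\<close>

definition ext_br :: "'a::euclidean_space \<times> ('a \<Rightarrow> complex^'n) \<Rightarrow> 'a \<times> ('a \<Rightarrow> complex^'n) \<Rightarrow> 'a \<Rightarrow> complex^'n" where
  "ext_br P Q p = br (snd P p) (snd Q p) + frechet_derivative (snd Q) (at p) (fst P)
     - frechet_derivative (snd P) (at p) (fst Q)"

definition ext_step :: "('a::euclidean_space \<Rightarrow> complex^'n) \<Rightarrow> 'a \<times> ('a \<Rightarrow> complex^'n) \<Rightarrow> 'a \<times> ('a \<Rightarrow> complex^'n)" where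
  "ext_step m P = (0, \<lambda>p. frechet_derivative m (at p) (fst P) - br (m p) (snd P p))"

lemma smooth_ext_step: "smooth_map m \<Longrightarrow> smooth_map (snd P) \<Longrightarrow> smooth_map (snd (ext_step m P))"
  unfolding ext_step_def
  by (auto intro!: smooth_map_diff smooth_map_frechet_derivative bounded_bilinear.smooth_map_prod[OF bounded_bilinear_br])

lemma smooth_ext_steps: "smooth_map m \<Longrightarrow> smooth_map (snd P) \<Longrightarrow> smooth_map (snd ((ext_step m ^^ k) P))"
  by (induction k) (simp_all add: smooth_ext_step)

lemma frechet_ext_step:
  assumes "smooth_map m" "smooth_map (snd P)"
  shows "frechet_derivative (snd (ext_step m P)) (at p) b
     = frechet_derivative (\<lambda>p. frechet_derivative m (at p) (fst P)) (at p) b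
       - br (frechet_derivative m (at p) b) (snd P p) - br (m p) (frechet_derivative (snd P) (at p) b)"
proof -
  have 1: "smooth_map (\<lambda>p. frechet_derivative m (at p) (fst P))"
    by (rule smooth_map_frechet_derivative[OF assms(1)])
  have 2: "smooth_map (\<lambda>p. br (m p) (snd P p))"
    by (rule bounded_bilinear.smooth_map_prod[OF bounded_bilinear_br assms])
  have "frechet_derivative (snd (ext_step m P)) (at p) b
     = frechet_derivative (\<lambda>p. frechet_derivative m (at p) (fst P) + (- br (m p) (snd P p))) (at p) b"
    by (simp add: ext_step_def)
  also have "\<dots> = frechet_derivative (\<lambda>p. frechet_derivative m (at p) (fst P)) (at p) b
       + - frechet_derivative (\<lambda>p. br (m p) (snd P p)) (at p) b"
    by (subst smooth_map_frechet_add[OF 1 smooth_map_minus[OF 2]])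
      (simp add: smooth_map_frechet_bounded_linear[OF bounded_linear_minus[OF bounded_linear_ident] 2])
  finally show ?thesis
    by (simp add: smooth_map_frechet_bilinear[OF bounded_bilinear_br assms] algebra_simps)
qed

lemma frechet_0: assumes "smooth_map u" shows "frechet_derivative u (at p) 0 = 0"
  using linear_0[OF has_derivative_linear[OF smooth_map_has_derivative[OF assms]]] .

text \<open>The Jacobi identity of the extended algebra. Besides the pointwise Jacobi identity it
  needs that the mixed second derivatives of \<open>m\<close> in the two directions cancel.\<close>

lemma ext_br_derivation:
  fixes m :: "'a::euclidean_space \<Rightarrow> complex^'n"
  assumes m: "smooth_map m" and P: "smooth_map (snd P)" and Q: "smooth_map (snd Q)"
  shows "- br (m p) (ext_br P Q p) = ext_br (ext_step m P) Q p + ext_br P (ext_step m Q) p"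
proof -
  have z: "fst (ext_step m P) = 0" "fst (ext_step m Q) = 0" by (simp_all add: ext_step_def)
  have s: "snd (ext_step m P) p = frechet_derivative m (at p) (fst P) - br (m p) (snd P p)"
    "snd (ext_step m Q) p = frechet_derivative m (at p) (fst Q) - br (m p) (snd Q p)"
    by (simp_all add: ext_step_def)
  show ?thesis
    unfolding ext_br_def z s frechet_ext_step[OF m P] frechet_ext_step[OF m Q] frechet_0[OF P] frechet_0[OF Q]
      smooth_map_symmetric_derivative[OF m, of "fst P" p "fst Q"]
    using jacobi[of "m p" "snd P p" "snd Q p"] br_anti[of "snd P p" "frechet_derivative m (at p) (fst Q)"]
    by (simp add: br_simps algebra_simps)
qed

lemma funpow_ad_linear: "linear (\<lambda>v. - br a v)"
  by (rule linearI) (simp_all add: br_simps scaleR_eq_smult)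

lemma ext_step_iter:
  assumes m: "smooth_map m"
  shows "snd ((ext_step m ^^ Suc i) P) p = ((\<lambda>v. - br (m p) v) ^^ i) (snd (ext_step m P) p)"
proof (induction i)
  case (Suc i)
  have "fst ((ext_step m ^^ Suc i) P) = 0" by (simp add: ext_step_def)
  then have "snd (ext_step m ((ext_step m ^^ Suc i) P)) p
      = frechet_derivative m (at p) 0 - br (m p) (snd ((ext_step m ^^ Suc i) P) p)"
    by (subst ext_step_def) (simp del: funpow.simps)
  then show ?case using Suc by (simp add: frechet_0[OF m])
qed simp

text \<open>The exponential of a nilpotent derivation is an automorphism. The functions
  \<open>U\<close> and \<open>W\<close> are the function parts of the transformed operators, whose
  directions do not change. The order is \<open>Suc N\<close> because the first application of
  \<open>ext_step\<close> contributes a derivative of \<open>m\<close> before the nilpotent brackets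
  start.\<close>

lemma exp_ad_ext_br:
  fixes m :: "'a::euclidean_space \<Rightarrow> complex^'n"
  assumes m: "smooth_map m" and P: "smooth_map (snd P)" and Q: "smooth_map (snd Q)"
    and nil: "\<And>k p v. N \<le> k \<Longrightarrow> ((\<lambda>v. - br (m p) v) ^^ k) v = 0"
  defines "N' \<equiv> Suc N"
  defines "U \<equiv> \<lambda>p. \<Sum>i<N'. snd ((ext_step m ^^ i) P) p /\<^sub>R fact i"
    and "W \<equiv> \<lambda>p. \<Sum>i<N'. snd ((ext_step m ^^ i) Q) p /\<^sub>R fact i"
  shows "exp_ad N' (m p) (ext_br P Q p) = ext_br (fst P, U) (fst Q, W) p"
proof -
  define X where "X v = - br (m p) v" for v
  define Pi where "Pi i = (ext_step m ^^ i) P" for i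
  define Qi where "Qi i = (ext_step m ^^ i) Q" for i
  have sP: "smooth_map (snd (Pi i))" and sQ: "smooth_map (snd (Qi i))" for i
    unfolding Pi_def Qi_def by (rule smooth_ext_steps[OF m]; fact)+
  have fP: "fst (Pi i) = (if i = 0 then fst P else 0)" and fQ: "fst (Qi i) = (if i = 0 then fst Q else 0)" for i
    by (cases i; simp add: Pi_def Qi_def ext_step_def)+
  have vP: "snd ((ext_step m ^^ i) R) p = 0" if "N' \<le> i" for i R p
    using that nil ext_step_iter[OF m, of "i - 1" R p] by (cases i) (auto simp: N'_def)
  have vf: "snd ((ext_step m ^^ i) R) = (\<lambda>p. 0)" if "N' \<le> i" for i R by (rule ext) (rule vP[OF that])
  have van: "ext_br (Pi i) (Qi j) p = 0" if "N' \<le> i \<or> N' \<le> j" for i j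
  proof -
    have "i \<noteq> 0" if "N' \<le> i" for i using that by (auto simp: N'_def)
    then show ?thesis
      using that vf[of i P] vf[of j Q] frechet_0[OF sP] frechet_0[OF sQ]
      by (auto simp: ext_br_def fP fQ Pi_def[symmetric] Qi_def[symmetric] br_simps)
  qed
  have "exp_ad N' (m p) (ext_br P Q p) = (\<Sum>k<N'. (X ^^ k) (ext_br (Pi 0) (Qi 0) p) /\<^sub>R fact k)"
    by (simp add: exp_ad_def X_def[abs_def] Pi_def Qi_def)
  also have "\<dots> = (\<Sum>i<N'. \<Sum>j<N'. ext_br (Pi i) (Qi j) p /\<^sub>R (fact i * fact j))"
  proof (rule exp_leibniz)
    show "linear X" unfolding X_def[abs_def] by (rule funpow_ad_linear)
    show "X (ext_br (Pi i) (Qi j) p) = ext_br (Pi (Suc i)) (Qi j) p + ext_br (Pi i) (Qi (Suc j)) p" for i j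
      using ext_br_derivation[OF m sP[of i] sQ[of j]] by (simp add: X_def Pi_def Qi_def)
    show "ext_br (Pi i) (Qi j) p = 0" if "N' \<le> i \<or> N' \<le> j" for i j using van[OF that] .
    show "(X ^^ k) v = 0" if "N' \<le> k" for k v using nil[of k p v] that by (simp add: X_def[abs_def] N'_def)
  qed
  also have "\<dots> = (\<Sum>i<N'. \<Sum>j<N'. br (snd (Pi i) p /\<^sub>R fact i) (snd (Qi j) p /\<^sub>R fact j))
      + (\<Sum>i<N'. \<Sum>j<N'. frechet_derivative (snd (Qi j)) (at p) (fst (Pi i)) /\<^sub>R (fact i * fact j))
      - (\<Sum>i<N'. \<Sum>j<N'. frechet_derivative (snd (Pi i)) (at p) (fst (Qi j)) /\<^sub>R (fact i * fact j))"
    by (simp add: ext_br_def sum.distrib sum_subtractf scaleR_add_right scaleR_diff_right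
        bounded_bilinear.scaleR_left[OF bounded_bilinear_br] bounded_bilinear.scaleR_right[OF bounded_bilinear_br] mult.commute)
  also have "(\<Sum>i<N'. \<Sum>j<N'. br (snd (Pi i) p /\<^sub>R fact i) (snd (Qi j) p /\<^sub>R fact j)) = br (U p) (W p)"
    unfolding U_def W_def bounded_bilinear.sum_left[OF bounded_bilinear_br]
    unfolding bounded_bilinear.sum_right[OF bounded_bilinear_br] Pi_def Qi_def ..
  \<comment> \<open>Every application of \<open>ext_step\<close> sets the direction to zero, so only
    the term \<open>i = 0\<close> survives.\<close>
  also have "(\<Sum>i<N'. \<Sum>j<N'. frechet_derivative (snd (Qi j)) (at p) (fst (Pi i)) /\<^sub>R (fact i * fact j))
      = (\<Sum>j<N'. frechet_derivative (snd (Qi j)) (at p) (fst P) /\<^sub>R fact j)"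
    unfolding N'_def sum.lessThan_Suc_shift[of _ N] by (simp add: fP frechet_0[OF sQ])
  also have "\<dots> = frechet_derivative W (at p) (fst P)"
  proof -
    have "(W has_derivative (\<lambda>v. \<Sum>j<N'. frechet_derivative (snd (Qi j)) (at p) v /\<^sub>R fact j)) (at p)"
      unfolding W_def Qi_def[symmetric]
      by (intro has_derivative_sum has_derivative_scaleR_right smooth_map_has_derivative[OF sQ])
    from frechet_derivative_at[OF this, symmetric] show ?thesis by simp
  qed
  also have "(\<Sum>i<N'. \<Sum>j<N'. frechet_derivative (snd (Pi i)) (at p) (fst (Qi j)) /\<^sub>R (fact i * fact j))
      = (\<Sum>i<N'. frechet_derivative (snd (Pi i)) (at p) (fst Q) /\<^sub>R fact i)"
    by (subst sum.swap, unfold N'_def sum.lessThan_Suc_shift[of _ N]) (simp add: fQ frechet_0[OF sP])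
  also have "\<dots> = frechet_derivative U (at p) (fst Q)"
  proof -
    have "(U has_derivative (\<lambda>v. \<Sum>j<N'. frechet_derivative (snd (Pi j)) (at p) v /\<^sub>R fact j)) (at p)"
      unfolding U_def Pi_def[symmetric]
      by (intro has_derivative_sum has_derivative_scaleR_right smooth_map_has_derivative[OF sP])
    from frechet_derivative_at[OF this, symmetric] show ?thesis by simp
  qed
  finally show ?thesis by (simp add: ext_br_def)
qed

lemma ext_exp:
  assumes m: "smooth_map m"
  shows "(\<Sum>i<Suc N. snd ((ext_step m ^^ i) P) p /\<^sub>R fact i)
     = snd P p + exp_ad1 N (m p) (snd (ext_step m P) p)"
proof -
  show ?thesis unfolding sum.lessThan_Suc_shift exp_ad1_def ext_step_iter[OF m] by simp
qed

end

section \<open>Gauge transformations and local maps\<close>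

lemma smooth_map_sum: "(\<And>i. i \<in> A \<Longrightarrow> smooth_map (f i)) \<Longrightarrow> smooth_map (\<lambda>x. \<Sum>i\<in>A. f i x)"
proof (induction A rule: infinite_finite_induct)
  case (insert i A)
  then show ?case by (simp add: smooth_map_add)
qed (simp_all add: smooth_map_const)

lemma loop_deriv_minus: "smooth_map u \<Longrightarrow> loop_deriv (\<lambda>x. - u x) x = - loop_deriv u x"
  unfolding loop_deriv_def
  by (rule vector_derivative_at, rule has_vector_derivative_minus)
    (use has_vector_derivative_loop_deriv[of u x] in \<open>simp add: loop_deriv_def\<close>)

context lie_alg
begin

text \<open>The exponential series with its first step carried out: \<open>- ad m\<close> applied to
  \<open>\<partial> + z\<close> is \<open>m' + [z, m]\<close>, which is \<open>P2 br z m\<close>.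
  For \<open>N\<close> at least the nilpotency order of \<open>ad m\<close> nothing is cut
  off.\<close>

definition gauge_poly :: "nat \<Rightarrow> 'n loop \<Rightarrow> 'n loop \<Rightarrow> 'n loop" where
  "gauge_poly N m z x = z x + exp_ad1 N (m x) (P2 br z m x)"

lemma ad_op_iter:
  assumes "smooth_map m"
  shows "(ad_op br (\<lambda>y. - m y) ^^ Suc k) (1, z) = (0, \<lambda>x. ((\<lambda>v. - br (m x) v) ^^ k) (P2 br z m x))"
proof (induction k)
  case 0
  show ?case
    using br_anti[of "m _" "z _"]
    by (simp add: ad_op_def P2_def loop_deriv_minus[OF assms] br_simps)
next
  case (Suc k)
  have "(ad_op br (\<lambda>y. - m y) ^^ Suc (Suc k)) (1, z) = ad_op br (\<lambda>y. - m y) ((ad_op br (\<lambda>y. - m y) ^^ Suc k) (1, z))"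
    by simp
  then show ?case unfolding Suc.IH by (simp add: ad_op_def br_simps)
qed

lemma gauge_action_eq:
  assumes m: "smooth_map m" and nil: "\<And>k x v. N \<le> k \<Longrightarrow> ((\<lambda>v. - br (m x) v) ^^ k) v = 0"
  shows "gauge_action br m z = gauge_poly N m z"
proof
  fix x
  have "gauge_action br m z x = (\<Sum>k<Suc N. snd ((ad_op br (\<lambda>y. - m y) ^^ k) (1, z)) x /\<^sub>R fact k)"
    unfolding gauge_action_def
  proof (rule suminf_finite)
    fix k assume "k \<notin> {..<Suc N}"
    then obtain j where "k = Suc j" "N \<le> j" by (cases k) auto
    then show "snd ((ad_op br (\<lambda>y. - m y) ^^ k) (1, z)) x /\<^sub>R fact k = 0"
      by (simp only: ad_op_iter[OF m] snd_conv nil scaleR_zero_right)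
  qed simp
  also have "\<dots> = gauge_poly N m z x"
    unfolding sum.lessThan_Suc_shift gauge_poly_def exp_ad1_def ad_op_iter[OF m] by simp
  finally show "gauge_action br m z x = gauge_poly N m z x" .
qed

text \<open>The velocity of a gauge-transformed curve is read off from the fact that \<open>exp (- ad m)\<close> is an
  automorphism of the extended Lie algebra: it is applied to \<open>[\<partial>\<^sub>x + z, n]\<close> and to
  \<open>[\<partial>\<^sub>t, \<partial>\<^sub>x + z]\<close>.\<close>

lemma gauge_poly_velocity:
  assumes M: "smooth_curve_in (loops UNIV) M" and Z: "smooth_curve_in (loops UNIV) Z"
    and n: "n \<in> loops UNIV" and vel: "curve_velocity Z = P2 br (Z 0) n"
    and nil: "\<And>k t x v. N \<le> k \<Longrightarrow> ((\<lambda>v. - br (M t x) v) ^^ k) v = 0"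
    and q: "smooth_curve_in (loops UNIV) (\<lambda>t. gauge_poly N (M t) (Z t))"
  defines "w \<equiv> \<lambda>x. n x + exp_ad1 N (M 0 x) (- br (M 0 x) (n x)) + exp_ad1 N (M 0 x) (curve_velocity M x)"
  shows "curve_velocity (\<lambda>t. gauge_poly N (M t) (Z t)) x = P2 br (gauge_poly N (M 0) (Z 0)) w x"
proof -
  define m where "m = uncurry_curve M"
  define z where "z = uncurry_curve Z"
  define nn where "nn p = n (snd p)" for p :: "real \<times> real"
  let ?dt = "(1, 0) :: real \<times> real" and ?dx = "(0, 1) :: real \<times> real"
  have sm: "smooth_map m" and sz: "smooth_map z"
    using M Z by (simp_all add: smooth_curve_in_def m_def z_def)
  have sn: "smooth_map nn" unfolding nn_def
    by (rule smooth_map_compose_linear[OF bounded_linear_snd loopsD(1)[OF n]])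
  have nil': "((\<lambda>v. - br (m p) v) ^^ k) v = 0" if "N \<le> k" for k p v
    unfolding m_def using nil[OF that] by blast
  define EE where "EE P p = (\<Sum>i<Suc N. snd ((ext_step m ^^ i) P) p /\<^sub>R fact i)" for P p
  have EE: "EE P p = snd P p + exp_ad1 N (m p) (snd (ext_step m P) p)" for P p
    unfolding EE_def by (rule ext_exp[OF sm])
  have sEE: "smooth_map (EE P)" if "smooth_map (snd P)" for P
    unfolding EE_def
    by (intro smooth_map_sum smooth_map_bounded_linear[OF bounded_linear_scaleR_right] smooth_ext_steps sm that)
  have key: "exp_ad (Suc N) (m p) (ext_br P Q p) = ext_br (fst P, EE P) (fst Q, EE Q) p"
    if "smooth_map (snd P)" "smooth_map (snd Q)" for P Q p
    unfolding EE_def by (rule exp_ad_ext_br[OF sm that nil'])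
  have at0: "frechet_derivative u (at p) (0, 0) = 0" if "smooth_map u" for u :: "real \<times> real \<Rightarrow> complex^'n" and p
    using frechet_0[OF that, of p] by (simp add: zero_prod_def)
  have dm: "frechet_derivative m (at (t, x)) ?dx = loop_deriv (M t) x" for t x
    unfolding m_def by (rule loop_deriv_curve_eq[symmetric]) (use sm in \<open>simp add: m_def\<close>)
  have dn: "frechet_derivative nn (at (t, x)) ?dx = loop_deriv n x" for t x
    using loop_deriv_curve_eq[of "\<lambda>t. n" t x] sn by (simp add: nn_def[abs_def])
  define q where "q = uncurry_curve (\<lambda>t. gauge_poly N (M t) (Z t))"
  \<comment> \<open>The automorphism sends \<open>n\<close> to \<open>B\<close>, the operator of
    differentiation in the parameter to that operator plus \<open>A\<close>, and
    \<open>\<partial> + z\<close> to \<open>\<partial> + q\<close>. At parameter 0 the sum of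
    \<open>A\<close> and \<open>B\<close> is \<open>w\<close>.\<close>
  define B where "B = EE ((0, 0), nn)"
  define A where "A = EE (?dt, \<lambda>p. 0)"
  have qE: "EE (?dx, z) = q"
  proof
    fix p :: "real \<times> real"
    obtain t x where p: "p = (t, x)" by (cases p)
    show "EE (?dx, z) p = q p"
      unfolding EE q_def gauge_poly_def P2_def
      using br_anti[of "M t x" "Z t x"] by (simp add: p ext_step_def dm) (simp add: m_def z_def)
  qed
  have sB: "smooth_map B" and sA: "smooth_map A" and sq: "smooth_map q"
    unfolding A_def B_def qE[symmetric] by (rule sEE; simp add: sn sz smooth_map_const)+
  have B0: "B (0, x) = n x + exp_ad1 N (M 0 x) (- br (M 0 x) (n x))" for x
    unfolding B_def EE by (simp add: ext_step_def at0[OF sm] nn_def) (simp add: m_def)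
  have A0: "A (0, x) = exp_ad1 N (M 0 x) (curve_velocity M x)" for x
    unfolding A_def EE using curve_velocity_eq[of M x] sm
    by (simp add: ext_step_def R.zero m_def)
  have lx: "loop_deriv (\<lambda>x. u (0, x)) x = frechet_derivative u (at (0, x)) ?dx" if "smooth_map u"
    for u :: "real \<times> real \<Rightarrow> complex^'n" and x
    using loop_deriv_curve_eq[of "\<lambda>t x. u (t, x)" 0 x] that by simp
  have "ext_br (?dx, z) ((0, 0), nn) (0, x) = P2 br (Z 0) n x"
    by (simp add: ext_br_def at0[OF sz] dn P2_def) (simp add: z_def nn_def)
  moreover have "ext_br (?dt, \<lambda>p. 0) (?dx, z) (0, x) = curve_velocity Z x"
    using curve_velocity_eq[of Z x] sz frechet_derivative_const[of "0 :: complex^'n" "(0::real, x)"]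
    by (simp add: ext_br_def L.zero z_def)
  ultimately have "ext_br (?dx, z) ((0, 0), nn) (0, x) = ext_br (?dt, \<lambda>p. 0) (?dx, z) (0, x)"
    using vel by simp
  then have "ext_br (?dx, q) ((0, 0), B) (0, x) = ext_br (?dt, A) (?dx, q) (0, x)"
    using key[of "(?dx, z)" "((0, 0), nn)" "(0, x)"] key[of "(?dt, \<lambda>p. 0)" "(?dx, z)" "(0, x)"]
    by (simp add: sz sn smooth_map_const qE A_def B_def)
  then have "frechet_derivative q (at (0, x)) ?dt
     = br (q (0, x)) (B (0, x)) + loop_deriv (\<lambda>x. B (0, x)) x + br (q (0, x)) (A (0, x)) + loop_deriv (\<lambda>x. A (0, x)) x"
    using br_anti[of "A (0, x)" "q (0, x)"]
    by (simp add: ext_br_def at0[OF sq] lx[OF sB] lx[OF sA] algebra_simps)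
  also have "\<dots> = P2 br (\<lambda>x. q (0, x)) (\<lambda>x. B (0, x) + A (0, x)) x"
    using loop_deriv_add[OF smooth_map_restrict_fst[OF sB] smooth_map_restrict_fst[OF sA]]
    by (simp add: P2_def R.add algebra_simps)
  also have "(\<lambda>x. B (0, x) + A (0, x)) = w" by (simp add: w_def A0 B0)
  also have "(\<lambda>x. q (0, x)) = gauge_poly N (M 0) (Z 0)" by (simp add: q_def)
  also have "frechet_derivative q (at (0, x)) ?dt = curve_velocity (\<lambda>t. gauge_poly N (M t) (Z t)) x"
    using curve_velocity_eq[of "\<lambda>t. gauge_poly N (M t) (Z t)" x] sq by (simp add: q_def)
  finally show ?thesis .
qed

end

section \<open>Maps of the loop space whose differential has an adjoint\<close>

context nondegenerate_lie_alg
begin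

text \<open>The adjoint is what makes the pullback of a functional along a local map a functional with
  regular differential.\<close>

definition local_map :: "('n loop \<Rightarrow> 'n loop) \<Rightarrow> bool" where
  "local_map \<Phi> \<longleftrightarrow>
     (\<forall>\<gamma>. smooth_curve_in (loops UNIV) \<gamma> \<longrightarrow> smooth_curve_in (loops UNIV) (\<lambda>t. \<Phi> (\<gamma> t))) \<and>
     (\<forall>q\<in>loops UNIV. \<exists>A. \<forall>v\<in>loops UNIV. A v \<in> loops UNIV \<and>
        (\<forall>\<gamma>. smooth_curve_in (loops UNIV) \<gamma> \<and> \<gamma> 0 = q \<longrightarrow>
           pairing br v (curve_velocity (\<lambda>t. \<Phi> (\<gamma> t))) = pairing br (A v) (curve_velocity \<gamma>)))"

lemma local_mapI:
  assumes "\<And>\<gamma>. smooth_curve_in (loops UNIV) \<gamma> \<Longrightarrow> smooth_curve_in (loops UNIV) (\<lambda>t. \<Phi> (\<gamma> t))"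
    and "\<And>q v. q \<in> loops UNIV \<Longrightarrow> v \<in> loops UNIV \<Longrightarrow> \<exists>u\<in>loops UNIV. \<forall>\<gamma>. smooth_curve_in (loops UNIV) \<gamma> \<and> \<gamma> 0 = q \<longrightarrow>
           pairing br v (curve_velocity (\<lambda>t. \<Phi> (\<gamma> t))) = pairing br u (curve_velocity \<gamma>)"
  shows "local_map \<Phi>"
  unfolding local_map_def
proof (intro conjI ballI)
  fix q :: "'n loop" assume "q \<in> loops UNIV"
  then have "\<exists>A. \<forall>v\<in>loops UNIV. A v \<in> loops UNIV \<and> (\<forall>\<gamma>. smooth_curve_in (loops UNIV) \<gamma> \<and> \<gamma> 0 = q \<longrightarrow>
           pairing br v (curve_velocity (\<lambda>t. \<Phi> (\<gamma> t))) = pairing br (A v) (curve_velocity \<gamma>))"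
    using assms(2) by (intro bchoice ballI) (simp only: Bex_def)
  then show "\<exists>A. \<forall>v\<in>loops UNIV. A v \<in> loops UNIV \<and> (\<forall>\<gamma>. smooth_curve_in (loops UNIV) \<gamma> \<and> \<gamma> 0 = q \<longrightarrow>
           pairing br v (curve_velocity (\<lambda>t. \<Phi> (\<gamma> t))) = pairing br (A v) (curve_velocity \<gamma>))" .
qed (use assms(1) in blast)

lemma local_map_curve:
  "local_map \<Phi> \<Longrightarrow> smooth_curve_in (loops UNIV) \<gamma> \<Longrightarrow> smooth_curve_in (loops UNIV) (\<lambda>t. \<Phi> (\<gamma> t))"
  unfolding local_map_def by blast

lemma local_map_adjoint:
  assumes "local_map \<Phi>" "q \<in> loops UNIV" "v \<in> loops UNIV"
  obtains u where "u \<in> loops UNIV" "\<And>\<gamma>. smooth_curve_in (loops UNIV) \<gamma> \<Longrightarrow> \<gamma> 0 = q \<Longrightarrow>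
     pairing br v (curve_velocity (\<lambda>t. \<Phi> (\<gamma> t))) = pairing br u (curve_velocity \<gamma>)"
proof -
  obtain A where "\<forall>v\<in>loops UNIV. A v \<in> loops UNIV \<and>
        (\<forall>\<gamma>. smooth_curve_in (loops UNIV) \<gamma> \<and> \<gamma> 0 = q \<longrightarrow>
           pairing br v (curve_velocity (\<lambda>t. \<Phi> (\<gamma> t))) = pairing br (A v) (curve_velocity \<gamma>))"
    using bspec[OF conjunct2[OF iffD1[OF local_map_def assms(1)]] assms(2)] by (rule exE)
  from bspec[OF this assms(3)] show ?thesis by (intro that[of "A v"]) simp_all
qed

lemma smooth_curve_const: "q \<in> loops UNIV \<Longrightarrow> smooth_curve_in (loops UNIV) (\<lambda>t. q)"
  and curve_velocity_const: "curve_velocity (\<lambda>t. q) = (\<lambda>x. 0)"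
proof -
  show "smooth_curve_in (loops UNIV) (\<lambda>t. q)" if "q \<in> loops UNIV"
    using smooth_curve_line(1)[OF that loops_const[of 0 UNIV]] by simp
  show "curve_velocity (\<lambda>t. q) = (\<lambda>x. 0)" by (simp add: curve_velocity_def)
qed

lemma local_map_loops: assumes "local_map \<Phi>" "q \<in> loops UNIV" shows "\<Phi> q \<in> loops UNIV"
  using local_map_curve[OF assms(1) smooth_curve_const[OF assms(2)]] by (simp add: smooth_curve_in_def)

lemma local_map_id: "local_map (\<lambda>q. q)"
  by (rule local_mapI) auto

lemma local_map_const: assumes "c \<in> loops UNIV" shows "local_map (\<lambda>q. c)"
proof (rule local_mapI)
  show "\<exists>u\<in>loops UNIV. \<forall>\<gamma>. smooth_curve_in (loops UNIV) \<gamma> \<and> \<gamma> 0 = q \<longrightarrow>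
           pairing br v (curve_velocity (\<lambda>t. c)) = pairing br u (curve_velocity \<gamma>)" for q v
    by (intro bexI[of _ "\<lambda>x. 0"] loops_const) (auto simp: curve_velocity_const pairing_def)
qed (rule smooth_curve_const[OF assms])

lemma curve_velocity_add:
  assumes "smooth_curve_in (loops UNIV) \<gamma>" "smooth_curve_in (loops UNIV) \<delta>"
  shows "smooth_curve_in (loops UNIV) (\<lambda>t x. \<gamma> t x + \<delta> t x)"
    and "curve_velocity (\<lambda>t x. \<gamma> t x + \<delta> t x) = (\<lambda>x. curve_velocity \<gamma> x + curve_velocity \<delta> x)"
proof -
  have s: "smooth_map (uncurry_curve \<gamma>)" "smooth_map (uncurry_curve \<delta>)"
    using assms by (auto simp: smooth_curve_in_def)
  show "smooth_curve_in (loops UNIV) (\<lambda>t x. \<gamma> t x + \<delta> t x)"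
    using assms smooth_map_add[OF s] by (simp add: smooth_curve_in_loops_iff)
  show "curve_velocity (\<lambda>t x. \<gamma> t x + \<delta> t x) = (\<lambda>x. curve_velocity \<gamma> x + curve_velocity \<delta> x)"
    using smooth_map_frechet_add[OF s] curve_velocity_eq[OF s(1)] curve_velocity_eq[OF s(2)]
      curve_velocity_eq[of "\<lambda>t x. \<gamma> t x + \<delta> t x"] smooth_map_add[OF s] by auto
qed

lemma curve_velocity_br:
  assumes "smooth_curve_in (loops UNIV) \<gamma>" "smooth_curve_in (loops UNIV) \<delta>"
  shows "smooth_curve_in (loops UNIV) (\<lambda>t x. br (\<gamma> t x) (\<delta> t x))"
    and "curve_velocity (\<lambda>t x. br (\<gamma> t x) (\<delta> t x)) =
      (\<lambda>x. br (curve_velocity \<gamma> x) (\<delta> 0 x) + br (\<gamma> 0 x) (curve_velocity \<delta> x))"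
proof -
  have s: "smooth_map (uncurry_curve \<gamma>)" "smooth_map (uncurry_curve \<delta>)"
    using assms by (auto simp: smooth_curve_in_def)
  have sb: "smooth_map (uncurry_curve (\<lambda>t x. br (\<gamma> t x) (\<delta> t x)))"
    by (rule bounded_bilinear.smooth_map_prod[OF bounded_bilinear_br s])
  show "smooth_curve_in (loops UNIV) (\<lambda>t x. br (\<gamma> t x) (\<delta> t x))"
    using assms sb by (simp add: smooth_curve_in_loops_iff)
  show "curve_velocity (\<lambda>t x. br (\<gamma> t x) (\<delta> t x)) =
      (\<lambda>x. br (curve_velocity \<gamma> x) (\<delta> 0 x) + br (\<gamma> 0 x) (curve_velocity \<delta> x))"
    using smooth_map_frechet_bilinear[OF bounded_bilinear_br s] curve_velocity_eq[OF s(1)] curve_velocity_eq[OF s(2)]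
      curve_velocity_eq[OF sb] by auto
qed

lemma curve_velocity_linear:
  assumes L: "bounded_linear L" and "smooth_curve_in (loops UNIV) \<gamma>"
  shows "smooth_curve_in (loops UNIV) (\<lambda>t x. L (\<gamma> t x))"
    and "curve_velocity (\<lambda>t x. L (\<gamma> t x)) = (\<lambda>x. L (curve_velocity \<gamma> x))"
proof -
  have s: "smooth_map (uncurry_curve \<gamma>)" using assms by (auto simp: smooth_curve_in_def)
  have sL: "smooth_map (uncurry_curve (\<lambda>t x. L (\<gamma> t x)))" by (rule smooth_map_bounded_linear[OF L s])
  show "smooth_curve_in (loops UNIV) (\<lambda>t x. L (\<gamma> t x))"
    using assms sL by (simp add: smooth_curve_in_loops_iff)
  show "curve_velocity (\<lambda>t x. L (\<gamma> t x)) = (\<lambda>x. L (curve_velocity \<gamma> x))"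
    using smooth_map_frechet_bounded_linear[OF L s] curve_velocity_eq[OF s] curve_velocity_eq[OF sL] by auto
qed

lemma local_map_add:
  assumes \<Phi>: "local_map \<Phi>" and \<Psi>: "local_map \<Psi>" shows "local_map (\<lambda>q x. \<Phi> q x + \<Psi> q x)"
proof (rule local_mapI)
  fix q v :: "'n loop" assume q: "q \<in> loops UNIV" and v: "v \<in> loops UNIV"
  obtain a where a: "a \<in> loops UNIV" "\<And>\<gamma>. smooth_curve_in (loops UNIV) \<gamma> \<Longrightarrow> \<gamma> 0 = q \<Longrightarrow>
     pairing br v (curve_velocity (\<lambda>t. \<Phi> (\<gamma> t))) = pairing br a (curve_velocity \<gamma>)"
    by (rule local_map_adjoint[OF \<Phi> q v]) (rule that)
  obtain b where b: "b \<in> loops UNIV" "\<And>\<gamma>. smooth_curve_in (loops UNIV) \<gamma> \<Longrightarrow> \<gamma> 0 = q \<Longrightarrow>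
     pairing br v (curve_velocity (\<lambda>t. \<Psi> (\<gamma> t))) = pairing br b (curve_velocity \<gamma>)"
    by (rule local_map_adjoint[OF \<Psi> q v]) (rule that)
  have "pairing br v (curve_velocity (\<lambda>t x. \<Phi> (\<gamma> t) x + \<Psi> (\<gamma> t) x)) = pairing br (\<lambda>x. a x + b x) (curve_velocity \<gamma>)"
    if g: "smooth_curve_in (loops UNIV) \<gamma>" "\<gamma> 0 = q" for \<gamma>
    using local_map_curve[OF \<Phi> g(1)] local_map_curve[OF \<Psi> g(1)] g v a b
    by (simp add: curve_velocity_add pairing_add_left pairing_add_right loops_curve_velocity)
  then show "\<exists>u\<in>loops UNIV. \<forall>\<gamma>. smooth_curve_in (loops UNIV) \<gamma> \<and> \<gamma> 0 = q \<longrightarrow>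
      pairing br v (curve_velocity (\<lambda>t x. \<Phi> (\<gamma> t) x + \<Psi> (\<gamma> t) x)) = pairing br u (curve_velocity \<gamma>)"
    using loops_add[OF a(1) b(1)] by (intro bexI[of _ "\<lambda>x. a x + b x"]) simp_all
qed (rule curve_velocity_add(1)[OF local_map_curve[OF \<Phi>] local_map_curve[OF \<Psi>]])

lemma local_map_br:
  assumes \<Phi>: "local_map \<Phi>" and \<Psi>: "local_map \<Psi>" shows "local_map (\<lambda>q x. br (\<Phi> q x) (\<Psi> q x))"
proof (rule local_mapI)
  fix q v :: "'n loop" assume q: "q \<in> loops UNIV" and v: "v \<in> loops UNIV"
  have l: "\<Phi> q \<in> loops UNIV" "\<Psi> q \<in> loops UNIV" by (rule local_map_loops[OF \<Phi> q], rule local_map_loops[OF \<Psi> q])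
  \<comment> \<open>The test loops in this and the next step arise from moving each bracket to the
    other side of the pairing by invariance of the Killing form.\<close>
  obtain a where a: "a \<in> loops UNIV" "\<And>\<gamma>. smooth_curve_in (loops UNIV) \<gamma> \<Longrightarrow> \<gamma> 0 = q \<Longrightarrow>
     pairing br (\<lambda>x. br (\<Psi> q x) (v x)) (curve_velocity (\<lambda>t. \<Phi> (\<gamma> t))) = pairing br a (curve_velocity \<gamma>)"
    by (rule local_map_adjoint[OF \<Phi> q loops_br[OF l(2) v]]) (rule that)
  obtain b where b: "b \<in> loops UNIV" "\<And>\<gamma>. smooth_curve_in (loops UNIV) \<gamma> \<Longrightarrow> \<gamma> 0 = q \<Longrightarrow>
     pairing br (\<lambda>x. br (v x) (\<Phi> q x)) (curve_velocity (\<lambda>t. \<Psi> (\<gamma> t))) = pairing br b (curve_velocity \<gamma>)"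
    by (rule local_map_adjoint[OF \<Psi> q loops_br[OF v l(1)]]) (rule that)
  have "pairing br v (curve_velocity (\<lambda>t x. br (\<Phi> (\<gamma> t) x) (\<Psi> (\<gamma> t) x))) = pairing br (\<lambda>x. a x + b x) (curve_velocity \<gamma>)"
    if g: "smooth_curve_in (loops UNIV) \<gamma>" "\<gamma> 0 = q" for \<gamma>
  proof -
    let ?c = "curve_velocity (\<lambda>t. \<Phi> (\<gamma> t))" and ?d = "curve_velocity (\<lambda>t. \<Psi> (\<gamma> t))"
    have c: "smooth_curve_in (loops UNIV) (\<lambda>t. \<Phi> (\<gamma> t))" "smooth_curve_in (loops UNIV) (\<lambda>t. \<Psi> (\<gamma> t))"
      by (rule local_map_curve[OF \<Phi> g(1)], rule local_map_curve[OF \<Psi> g(1)])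
    have "pairing br v (curve_velocity (\<lambda>t x. br (\<Phi> (\<gamma> t) x) (\<Psi> (\<gamma> t) x)))
        = pairing br v (\<lambda>x. br (?c x) (\<Psi> q x)) + pairing br v (\<lambda>x. br (\<Phi> q x) (?d x))"
      using c l g v by (simp add: curve_velocity_br pairing_add_right loops_br loops_curve_velocity)
    also have "pairing br v (\<lambda>x. br (\<Phi> q x) (?d x)) = pairing br (\<lambda>x. br (v x) (\<Phi> q x)) ?d"
      by (rule pairing_br[symmetric])
    also have "pairing br v (\<lambda>x. br (?c x) (\<Psi> q x)) = pairing br (\<lambda>x. br (\<Psi> q x) (v x)) ?c"
      by (subst br_anti) (simp add: pairing_sym[of v] pairing_minus pairing_br' pairing_sym[of "\<lambda>x. br (\<Psi> q x) (v x)"])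
    finally show ?thesis
      using a b g by (simp add: pairing_add_left loops_curve_velocity)
  qed
  then show "\<exists>u\<in>loops UNIV. \<forall>\<gamma>. smooth_curve_in (loops UNIV) \<gamma> \<and> \<gamma> 0 = q \<longrightarrow>
      pairing br v (curve_velocity (\<lambda>t x. br (\<Phi> (\<gamma> t) x) (\<Psi> (\<gamma> t) x))) = pairing br u (curve_velocity \<gamma>)"
    using loops_add[OF a(1) b(1)] by (intro bexI[of _ "\<lambda>x. a x + b x"]) simp_all
qed (rule curve_velocity_br(1)[OF local_map_curve[OF \<Phi>] local_map_curve[OF \<Psi>]])

lemma local_map_linear:
  assumes L: "Vector_Spaces.linear (*s) (*s) L" and \<Phi>: "local_map \<Phi>"
  shows "local_map (\<lambda>q x. L (\<Phi> q x))"
proof (rule local_mapI)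
  fix q v :: "'n loop" assume q: "q \<in> loops UNIV" and v: "v \<in> loops UNIV"
  obtain L' where L': "Vector_Spaces.linear (*s) (*s) L'" "\<And>u v. killing br u (L v) = killing br (L' u) v"
    using killing_adjoint[OF L] by blast
  obtain a where a: "a \<in> loops UNIV" "\<And>\<gamma>. smooth_curve_in (loops UNIV) \<gamma> \<Longrightarrow> \<gamma> 0 = q \<Longrightarrow>
     pairing br (\<lambda>x. L' (v x)) (curve_velocity (\<lambda>t. \<Phi> (\<gamma> t))) = pairing br a (curve_velocity \<gamma>)"
    by (rule local_map_adjoint[OF \<Phi> q loops_linear[OF L'(1) v]]) (rule that)
  have "pairing br v (curve_velocity (\<lambda>t x. L (\<Phi> (\<gamma> t) x))) = pairing br a (curve_velocity \<gamma>)"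
    if g: "smooth_curve_in (loops UNIV) \<gamma>" "\<gamma> 0 = q" for \<gamma>
    using curve_velocity_linear(2)[OF complex_linear_bounded[OF L] local_map_curve[OF \<Phi> g(1)]] a(2)[OF g]
    by (simp add: pairing_def L'(2))
  then show "\<exists>u\<in>loops UNIV. \<forall>\<gamma>. smooth_curve_in (loops UNIV) \<gamma> \<and> \<gamma> 0 = q \<longrightarrow>
      pairing br v (curve_velocity (\<lambda>t x. L (\<Phi> (\<gamma> t) x))) = pairing br u (curve_velocity \<gamma>)"
    using a(1) by (intro bexI[of _ a]) simp_all
qed (rule curve_velocity_linear(1)[OF complex_linear_bounded[OF L] local_map_curve[OF \<Phi>]])

lemma local_map_loop_deriv:
  assumes \<Phi>: "local_map \<Phi>" shows "local_map (\<lambda>q. loop_deriv (\<Phi> q))"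
proof (rule local_mapI)
  fix q v :: "'n loop" assume q: "q \<in> loops UNIV" and v: "v \<in> loops UNIV"
  obtain a where a: "a \<in> loops UNIV" "\<And>\<gamma>. smooth_curve_in (loops UNIV) \<gamma> \<Longrightarrow> \<gamma> 0 = q \<Longrightarrow>
     pairing br (loop_deriv v) (curve_velocity (\<lambda>t. \<Phi> (\<gamma> t))) = pairing br a (curve_velocity \<gamma>)"
    by (rule local_map_adjoint[OF \<Phi> q loops_loop_deriv[OF v]]) (rule that)
  have "pairing br v (curve_velocity (\<lambda>t. loop_deriv (\<Phi> (\<gamma> t)))) = pairing br (\<lambda>x. - a x) (curve_velocity \<gamma>)"
    if g: "smooth_curve_in (loops UNIV) \<gamma>" "\<gamma> 0 = q" for \<gamma>
  proof -
    have c: "smooth_curve_in (loops UNIV) (\<lambda>t. \<Phi> (\<gamma> t))" by (rule local_map_curve[OF \<Phi> g(1)])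
    show ?thesis
      unfolding curve_velocity_loop_deriv[OF c] pairing_loop_deriv[OF v loops_curve_velocity[OF c]] pairing_minus
      using a(2)[OF g] by simp
  qed
  then show "\<exists>u\<in>loops UNIV. \<forall>\<gamma>. smooth_curve_in (loops UNIV) \<gamma> \<and> \<gamma> 0 = q \<longrightarrow>
      pairing br v (curve_velocity (\<lambda>t. loop_deriv (\<Phi> (\<gamma> t)))) = pairing br u (curve_velocity \<gamma>)"
    using loops_minus[OF a(1)] by (intro bexI[of _ "\<lambda>x. - a x"]) simp_all
qed (rule smooth_curve_loop_deriv[OF local_map_curve[OF \<Phi>]])

lemma local_map_minus: "local_map \<Phi> \<Longrightarrow> local_map (\<lambda>q x. - \<Phi> q x)"
  by (rule local_map_linear) (simp add: complex_linear_iff vec.scale_minus_right)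

lemma local_map_diff: "local_map \<Phi> \<Longrightarrow> local_map \<Psi> \<Longrightarrow> local_map (\<lambda>q x. \<Phi> q x - \<Psi> q x)"
  using local_map_add[OF _ local_map_minus] by simp

lemma local_map_sum: "(\<And>k. k < (n::nat) \<Longrightarrow> local_map (\<Phi> k)) \<Longrightarrow> local_map (\<lambda>q x. \<Sum>k<n. \<Phi> k q x)"
proof (induction n)
  case 0
  then show ?case using local_map_const[OF loops_const[of 0]] by simp
next
  case (Suc n)
  then show ?case using local_map_add[of "\<lambda>q x. \<Sum>k<n. \<Phi> k q x" "\<Phi> n"] by simp
qed

lemma local_map_exp_ad1:
  assumes \<Phi>: "local_map \<Phi>" and \<Psi>: "local_map \<Psi>" shows "local_map (\<lambda>q x. exp_ad1 N (\<Phi> q x) (\<Psi> q x))"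
proof -
  have "local_map (\<lambda>q x. ((\<lambda>v. - br (\<Phi> q x) v) ^^ k) (\<Psi> q x))" for k
  proof (induction k)
    case (Suc k)
    then show ?case using local_map_minus[OF local_map_br[OF \<Phi> Suc]] by simp
  qed (simp add: \<Psi>)
  then have "local_map (\<lambda>q x. ((\<lambda>v. - br (\<Phi> q x) v) ^^ k) (\<Psi> q x) /\<^sub>R fact (Suc k))" for k
    by (rule local_map_linear[rotated]) (simp add: complex_linear_iff scaleR_eq_smult vec.scale_right_distrib mult.commute)
  then show ?thesis unfolding exp_ad1_def by (rule local_map_sum)
qed

lemma local_map_gauge_poly:
  assumes "local_map \<Phi>" "local_map \<Psi>" shows "local_map (\<lambda>q. gauge_poly N (\<Phi> q) (\<Psi> q))"
  unfolding gauge_poly_def[abs_def] P2_def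
  by (intro local_map_add local_map_exp_ad1 local_map_loop_deriv local_map_br assms)

end

section \<open>Gauge fixing\<close>

lemma affine_loops_iff:
  "q \<in> affine_loops a V \<longleftrightarrow> q \<in> loops UNIV \<and> (\<forall>x. q x - a \<in> V)"
proof
  assume "q \<in> affine_loops a V"
  then obtain s where s: "s \<in> loops V" "q = (\<lambda>x. a + s x)" by (auto simp: affine_loops_def)
  then show "q \<in> loops UNIV \<and> (\<forall>x. q x - a \<in> V)"
    using loops_add[OF loops_const[of a UNIV] loops_UNIV[OF s(1)]] by (auto simp: loopsD(3))
next
  assume q: "q \<in> loops UNIV \<and> (\<forall>x. q x - a \<in> V)"
  then have "(\<lambda>x. q x - a) \<in> loops V"
    using loops_diff[OF _ loops_const[of a UNIV], of q] by (subst loops_iff) auto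
  then show "q \<in> affine_loops a V" by (auto simp: affine_loops_def intro!: image_eqI[of _ _ "\<lambda>x. q x - a"])
qed

lemma (in nondegenerate_lie_alg) loops_exp_ad1:
  assumes "u \<in> loops UNIV" "v \<in> loops UNIV" shows "(\<lambda>x. exp_ad1 N (u x) (v x)) \<in> loops UNIV"
  using local_map_loops[OF local_map_exp_ad1[OF local_map_const[OF assms(1)] local_map_const[OF assms(2)]] assms(1)] .

lemma (in nondegenerate_lie_alg) loops_gauge_poly:
  assumes "u \<in> loops UNIV" "v \<in> loops UNIV" shows "gauge_poly N u v \<in> loops UNIV"
  using local_map_loops[OF local_map_gauge_poly[OF local_map_const[OF assms(1)] local_map_const[OF assms(2)]] assms(1)] .

context good_slice
begin

text \<open>The number of steps after which an operator lowering the degree by at least 1 has pushed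
  everything from degree \<open>height\<close> below \<open>- height\<close>. It serves both as
  nilpotency order and as number of iterations.\<close>

definition ord :: nat where "ord = Suc (2 * height)"

lemma low_add: "x \<in> low k \<Longrightarrow> y \<in> low k \<Longrightarrow> x + y \<in> low k"
  and low_diff: "x \<in> low k \<Longrightarrow> y \<in> low k \<Longrightarrow> x - y \<in> low k"
  and low_minus: "x \<in> low k \<Longrightarrow> - x \<in> low k"
  and low_zero: "0 \<in> low k"
  and low_scaleR: "x \<in> low k \<Longrightarrow> r *\<^sub>R x \<in> low k"
  unfolding scaleR_eq_smult
  by (simp_all add: vec.subspace_add vec.subspace_diff vec.subspace_neg vec.subspace_0 vec.subspace_scale subspace_low)

lemma funpow_ad_low:
  assumes "a \<in> low (-1)" "v \<in> low j" shows "((\<lambda>v. - br a v) ^^ k) v \<in> low (j - int k)"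
proof (induction k)
  case (Suc k)
  show ?case using low_minus[OF low_br[OF assms(1) Suc]] by (simp add: algebra_simps)
qed (simp add: assms)

lemma ad_low_nilpotent:
  assumes "a \<in> low (-1)" "ord \<le> k" shows "((\<lambda>v. - br a v) ^^ k) v = 0"
  using funpow_ad_low[OF assms(1) low_top[OF order.refl, of v], of k] assms(2)
  by (intro low_bot) (auto simp: ord_def)

lemma exp_ad1_low: assumes "a \<in> low (-1)" "v \<in> low j" shows "exp_ad1 N a v \<in> low j"
  unfolding exp_ad1_def
  by (intro vec.subspace_sum subspace_low low_scaleR low_mono[OF funpow_ad_low[OF assms]]) auto

definition tail :: "complex^'n \<Rightarrow> complex^'n \<Rightarrow> complex^'n" where
  "tail a v = exp_ad1 ord a v - v"

lemma tail_eq: "tail a v = (\<Sum>k<2 * height. ((\<lambda>v. - br a v) ^^ Suc k) v /\<^sub>R fact (Suc (Suc k)))"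
  unfolding tail_def exp_ad1_def ord_def
  by (simp add: sum.lessThan_Suc_shift del: sum.lessThan_Suc funpow.simps(2) fact_Suc)

lemma tail_low: assumes "a \<in> low (-1)" "v \<in> low 1" shows "tail a v \<in> low 0"
  unfolding tail_eq
  by (intro vec.subspace_sum subspace_low low_scaleR low_mono[OF funpow_ad_low[OF assms]]) auto

text \<open>Each term of \<open>tail\<close> contains at least one bracket with an element of
  negative degree, so an error of degree \<open>k + 2\<close> in the argument comes out in degree
  \<open>k + 1\<close>, and so does an error of degree \<open>k\<close> in the parameter.\<close>

lemma tail_diff_low:
  assumes a: "a \<in> low (-1)" "a' \<in> low (-1)" "a - a' \<in> low k" and v: "v \<in> low 1" "v' \<in> low 1" "v - v' \<in> low (k + 2)"
  shows "tail a v - tail a' v' \<in> low (k + 1)"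
proof -
  have step: "- br a w - (- br a' w') \<in> low (k + 1)" if "w - w' \<in> low (k + 2)" "w' \<in> low 1" for w w'
  proof -
    have "br a (w - w') \<in> low (k + 1)" using low_br[OF a(1) that(1)] by (simp add: add.commute)
    moreover have "br (a - a') w' \<in> low (k + 1)" using low_br[OF a(3) that(2)] .
    moreover have "- br a w - (- br a' w') = - (br a (w - w') + br (a - a') w')" by (simp add: br_simps)
    ultimately show ?thesis using low_minus[OF low_add] by metis
  qed
  have pow: "((\<lambda>v. - br a v) ^^ Suc i) v - ((\<lambda>v. - br a' v) ^^ Suc i) v' \<in> low (k + 1)" for i
  proof (induction i)
    case 0
    then show ?case using step[OF v(3) v(2)] by simp
  next
    case (Suc i)
    have "((\<lambda>v. - br a' v) ^^ Suc i) v' \<in> low 1" by (rule low_mono[OF funpow_ad_low[OF a(2) v(2)]]) auto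
    from step[OF low_mono[OF Suc] this] show ?case by simp
  qed
  have "tail a v - tail a' v' = (\<Sum>i<2 * height. (((\<lambda>v. - br a v) ^^ Suc i) v - ((\<lambda>v. - br a' v) ^^ Suc i) v') /\<^sub>R fact (Suc (Suc i)))"
    unfolding tail_eq sum_subtractf[symmetric] scaleR_diff_right ..
  also have "\<dots> \<in> low (k + 1)" by (intro vec.subspace_sum subspace_low low_scaleR pow)
  finally show ?thesis .
qed

text \<open>The contraction property says that each graded component of \<open>T u\<close> depends only on the
  components of \<open>u\<close> of higher degree.\<close>

lemma graded_contraction:
  assumes inv: "\<And>u. u \<in> X \<Longrightarrow> T u \<in> X"
    and contr: "\<And>u u' k x. u \<in> X \<Longrightarrow> u' \<in> X \<Longrightarrow> (\<And>x. u x - u' x \<in> low k) \<Longrightarrow> T u x - T u' x \<in> low (k - 1)"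
    and u0: "u0 \<in> X"
  shows "(T ^^ k) u0 \<in> X" and "T ((T ^^ ord) u0) = (T ^^ ord) u0"
    and "v \<in> X \<Longrightarrow> T v = v \<Longrightarrow> v = (T ^^ ord) u0"
proof -
  have X: "(T ^^ k) u \<in> X" if "u \<in> X" for u k using that inv by (induction k) auto
  then show "(T ^^ k) u0 \<in> X" using u0 .
  have d: "(T ^^ k) u x - (T ^^ k) u' x \<in> low (int height - int k)" if "u \<in> X" "u' \<in> X" for u u' k x
  proof (induction k arbitrary: x)
    case (Suc k)
    show ?case using contr[OF X[OF that(1)] X[OF that(2)] Suc] by (simp add: algebra_simps)
  qed (simp add: low_top)
  have eq: "(T ^^ ord) u = (T ^^ ord) u'" if "u \<in> X" "u' \<in> X" for u u'
  proof
    fix x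
    have "(T ^^ ord) u x - (T ^^ ord) u' x = 0" using d[OF that, of ord x] by (intro low_bot) (auto simp: ord_def)
    then show "(T ^^ ord) u x = (T ^^ ord) u' x" by simp
  qed
  show "T ((T ^^ ord) u0) = (T ^^ ord) u0"
    using eq[OF inv[OF u0] u0] by (simp add: funpow_swap1)
  show "v = (T ^^ ord) u0" if "v \<in> X" "T v = v"
  proof -
    have "(T ^^ k) v = v" for k using that(2) by (induction k) auto
    then show ?thesis using eq[OF that(1) u0] by simp
  qed
qed

text \<open>To leading order the gauge transform changes \<open>z\<close> by
  \<open>[e, \<mu>]\<close>. On loops of negative degree \<open>slice_inv\<close> undoes the bracket
  with \<open>e\<close>, so a step subtracts from \<open>\<mu>\<close> the value of
  \<open>slice_inv\<close> at the deviation of the transform from \<open>e\<close>, and it stops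
  exactly when that deviation centralizes \<open>f\<close>.\<close>

definition gauge_step :: "'n loop \<Rightarrow> 'n loop \<Rightarrow> 'n loop" where
  "gauge_step z \<mu> = (\<lambda>x. \<sigma> (br e (\<mu> x) - (gauge_poly ord \<mu> z x - e)))"

definition gauge_fix :: "'n loop \<Rightarrow> 'n loop" where
  "gauge_fix z = (gauge_step z ^^ ord) (\<lambda>x. 0)"

abbreviation "neg_loops \<equiv> loops (low (-1))"

text \<open>The source of the contraction: the one term raising the degree of \<open>\<mu>\<close>
  by 2 cancels. Differences of the remaining terms rise by at most 1, while \<open>slice_inv\<close>
  lowers by 2.\<close>

lemma gauge_arg:
  "br e (\<mu> x) - (gauge_poly ord \<mu> z x - e)
     = - (z x - e) - (loop_deriv \<mu> x + br (z x - e) (\<mu> x) + tail (\<mu> x) (P2 br z \<mu> x))"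
  by (simp add: gauge_poly_def tail_def P2_def br_simps)

context
  fixes z :: "'n loop"
  assumes z: "z \<in> loops UNIV" and z1: "\<And>x. z x - e \<in> low 1"
begin

lemma P2_neg: assumes "\<mu> \<in> neg_loops" shows "P2 br z \<mu> x \<in> low 1"
proof -
  have m: "\<mu> x \<in> low (-1)" using assms by (rule loopsD)
  have "br e (\<mu> x) \<in> low 1" using low_br[OF grade_low[OF grade_e order.refl] m] by simp
  moreover have "br (z x - e) (\<mu> x) \<in> low 1" by (rule low_mono[OF low_br[OF z1 m]]) simp
  moreover have "loop_deriv \<mu> x \<in> low 1" by (rule low_mono[OF loop_deriv_in[OF assms subspace_low]]) simp
  moreover have "P2 br z \<mu> x = loop_deriv \<mu> x + (br e (\<mu> x) + br (z x - e) (\<mu> x))"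
    by (simp add: P2_def br_simps)
  ultimately show ?thesis by (simp add: low_add)
qed

lemma gauge_arg_low:
  assumes "\<mu> \<in> neg_loops"
  shows "loop_deriv \<mu> x + br (z x - e) (\<mu> x) + tail (\<mu> x) (P2 br z \<mu> x) \<in> low 0"
proof -
  have m: "\<mu> x \<in> low (-1)" using assms by (rule loopsD)
  have "loop_deriv \<mu> x \<in> low 0" by (rule low_mono[OF loop_deriv_in[OF assms subspace_low]]) simp
  moreover have "br (z x - e) (\<mu> x) \<in> low 0" using low_br[OF z1 m] by simp
  ultimately show ?thesis by (intro low_add tail_low m P2_neg assms)
qed

lemma loops_gauge_step: assumes "\<mu> \<in> neg_loops" shows "gauge_step z \<mu> \<in> loops UNIV"
  unfolding gauge_step_def
  by (rule loops_linear[OF linear_slice_inv loops_diff[OF loops_linear[OF linear_right loops_UNIV[OF assms]]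
        loops_diff[OF loops_gauge_poly[OF loops_UNIV[OF assms] z] loops_const[OF UNIV_I]]]])

lemma gauge_step_neg: assumes "\<mu> \<in> neg_loops" shows "gauge_step z \<mu> \<in> neg_loops"
proof (subst loops_iff, intro conjI allI loops_gauge_step[OF assms])
  fix x
  have "br e (\<mu> x) - (gauge_poly ord \<mu> z x - e) \<in> low 1"
    unfolding gauge_arg by (intro low_diff low_minus z1 low_mono[OF gauge_arg_low[OF assms]]) simp
  from slice_inv_low[OF this] show "gauge_step z \<mu> x \<in> low (-1)" by (simp add: gauge_step_def)
qed

text \<open>All terms except \<open>z - e\<close> lie in degree at most 0, hence in
  \<open>b\<close>; so the whole argument stays in \<open>b\<close>, which \<open>slice_inv\<close>
  maps to \<open>m\<close>.\<close>

lemma gauge_step_mm: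
  assumes zb: "\<And>x. z x - e \<in> bb" and \<mu>: "\<mu> \<in> loops mm" shows "gauge_step z \<mu> \<in> loops mm"
proof -
  have n: "\<mu> \<in> neg_loops" using \<mu> mm_subset_nn nn_subset_low by (subst loops_iff) (auto simp: loops_def)
  show ?thesis
  proof (subst loops_iff, intro conjI allI loops_gauge_step[OF n])
    fix x
    have "br e (\<mu> x) - (gauge_poly ord \<mu> z x - e) \<in> bb"
      unfolding gauge_arg using gauge_arg_low[OF n] low_subset_bb
      by (intro vec.subspace_diff vec.subspace_neg subspace_bb zb) auto
    from slice_inv_bb[OF this] show "gauge_step z \<mu> x \<in> mm" by (simp add: gauge_step_def)
  qed
qed

lemma gauge_step_contraction:
  assumes \<mu>: "\<mu> \<in> neg_loops" and \<nu>: "\<nu> \<in> neg_loops" and d: "\<And>x. \<mu> x - \<nu> x \<in> low k"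
  shows "gauge_step z \<mu> x - gauge_step z \<nu> x \<in> low (k - 1)"
proof -
  have m: "\<mu> x \<in> low (-1)" "\<nu> x \<in> low (-1)" using loopsD(3)[OF \<mu>] loopsD(3)[OF \<nu>] by auto
  have dl: "(\<lambda>x. \<mu> x - \<nu> x) \<in> loops (low k)"
    using loops_diff[OF loops_UNIV[OF \<mu>] loops_UNIV[OF \<nu>]] d by (subst loops_iff) auto
  have ld: "loop_deriv \<mu> x - loop_deriv \<nu> x \<in> low k"
    using loop_deriv_in[OF dl subspace_low] loop_deriv_diff[OF loopsD(1)[OF \<mu>] loopsD(1)[OF \<nu>]] by simp
  have b: "br (z x - e) (\<mu> x) - br (z x - e) (\<nu> x) \<in> low (k + 1)"
    using low_br[OF z1 d] by (simp add: R.diff add.commute)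
  have be: "br e (\<mu> x) - br e (\<nu> x) \<in> low (k + 2)"
    using low_br[OF grade_low[OF grade_e order.refl] d] by (simp add: R.diff add.commute)
  have "P2 br z \<mu> x - P2 br z \<nu> x = (loop_deriv \<mu> x - loop_deriv \<nu> x)
      + (br (z x - e) (\<mu> x) - br (z x - e) (\<nu> x)) + (br e (\<mu> x) - br e (\<nu> x))"
    by (simp add: P2_def br_simps)
  also have "\<dots> \<in> low (k + 2)"
    by (intro low_add low_mono[OF ld] low_mono[OF b] be) auto
  finally have t: "tail (\<mu> x) (P2 br z \<mu> x) - tail (\<nu> x) (P2 br z \<nu> x) \<in> low (k + 1)"
    by (intro tail_diff_low m d P2_neg \<mu> \<nu>)
  let ?a = "\<lambda>\<mu>. br e (\<mu> x) - (gauge_poly ord \<mu> z x - e)"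
  have "?a \<mu> - ?a \<nu> = - ((loop_deriv \<mu> x - loop_deriv \<nu> x) + (br (z x - e) (\<mu> x) - br (z x - e) (\<nu> x))
      + (tail (\<mu> x) (P2 br z \<mu> x) - tail (\<nu> x) (P2 br z \<nu> x)))"
    unfolding gauge_arg by (simp add: algebra_simps)
  also have "\<dots> \<in> low (k + 1)"
    by (intro low_minus low_add low_mono[OF ld] b t) auto
  finally have "\<sigma> (?a \<mu> - ?a \<nu>) \<in> low (k - 1)" using slice_inv_low by fastforce
  then show ?thesis unfolding gauge_step_def \<sigma>.diff[symmetric] .
qed

lemma gauge_step_fixed_iff:
  assumes \<mu>: "\<mu> \<in> neg_loops" shows "gauge_step z \<mu> = \<mu> \<longleftrightarrow> gauge_poly ord \<mu> z \<in> Q_space br e f"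
proof -
  have "gauge_step z \<mu> x = \<mu> x - \<sigma> (gauge_poly ord \<mu> z x - e)" for x
  proof -
    have "\<mu> x \<in> range (br f)" using loopsD(3)[OF \<mu>] low_range by auto
    then show ?thesis by (simp only: gauge_step_def \<sigma>.diff slice_inv_e)
  qed
  then have "gauge_step z \<mu> = \<mu> \<longleftrightarrow> (\<forall>x. \<sigma> (gauge_poly ord \<mu> z x - e) = 0)"
    by (simp add: fun_eq_iff)
  also have "\<dots> \<longleftrightarrow> gauge_poly ord \<mu> z \<in> Q_space br e f"
    unfolding slice_inv_cen Q_space_def affine_loops_iff
    using loops_gauge_poly[OF loops_UNIV[OF \<mu>] z] by blast
  finally show ?thesis .
qed

lemma gauge_fix_neg: "gauge_fix z \<in> neg_loops"
  unfolding gauge_fix_def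
  using graded_contraction(1)[where X = neg_loops and T = "gauge_step z", OF gauge_step_neg gauge_step_contraction loops_const[OF low_zero]]
  by blast

lemma gauge_fix_Q: "gauge_poly ord (gauge_fix z) z \<in> Q_space br e f"
proof -
  have "gauge_step z (gauge_fix z) = gauge_fix z"
    unfolding gauge_fix_def
    by (rule graded_contraction(2)[where X = neg_loops and T = "gauge_step z", OF gauge_step_neg gauge_step_contraction loops_const[OF low_zero]])
  then show ?thesis by (rule iffD1[OF gauge_step_fixed_iff[OF gauge_fix_neg]])
qed

lemma gauge_fix_unique:
  assumes \<mu>: "\<mu> \<in> neg_loops" and Q: "gauge_poly ord \<mu> z \<in> Q_space br e f"
  shows "\<mu> = gauge_fix z"
  unfolding gauge_fix_def
  by (rule graded_contraction(3)[where X = neg_loops and T = "gauge_step z", OF gauge_step_neg gauge_step_contraction loops_const[OF low_zero] \<mu>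
        iffD2[OF gauge_step_fixed_iff[OF \<mu>] Q]])

lemma gauge_fix_mm: assumes "\<And>x. z x - e \<in> bb" shows "gauge_fix z \<in> loops mm"
proof -
  have "(gauge_step z ^^ k) (\<lambda>x. 0) \<in> loops mm" for k
    by (induction k) (auto intro: gauge_step_mm assms loops_const vec.subspace_0[OF subspace_mm])
  then show ?thesis by (simp only: gauge_fix_def)
qed

end

section \<open>The projection to Q and its extension to all loops\<close>

lemma loops_mono: "q \<in> loops V \<Longrightarrow> V \<subseteq> W \<Longrightarrow> q \<in> loops W"
  by (auto simp: loops_def)

lemma mm_subset_low: "mm \<subseteq> low (-1)"
  using mm_subset_nn nn_subset_low by blast

lemma Q_spaceD:
  assumes "q \<in> Q_space br e f"
  shows "q \<in> loops UNIV" "q x - e \<in> cen" "q x - e \<in> low 0"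
  using assms cen_low by (auto simp: Q_space_def affine_loops_iff)

lemma S_space_iff: "z \<in> S_space br e \<Gamma> l \<longleftrightarrow> z \<in> loops UNIV \<and> (\<forall>x. z x - e \<in> bb)"
  by (simp add: S_space_def affine_loops_iff)

lemma Q_subset_S: "Q_space br e f \<subseteq> S_space br e \<Gamma> l"
  using Q_spaceD low_subset_bb by (fastforce simp: S_space_iff)

text \<open>The iteration stays in \<open>m\<close> for points of \<open>S\<close>, which gives
  existence; uniqueness already holds among all gauge parameters in \<open>low (-1)\<close>.\<close>

lemma Q_proj_eq:
  assumes z: "z \<in> S_space br e \<Gamma> l"
  shows "Q_proj br e f \<Gamma> l z = gauge_poly ord (gauge_fix z) z"
proof -
  have zl: "z \<in> loops UNIV" and zb: "\<And>x. z x - e \<in> bb" using z by (auto simp: S_space_iff)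
  have z1: "\<And>x. z x - e \<in> low 1" using zb bb_subset_low by blast
  have ga: "gauge_action br m z = gauge_poly ord m z" if "m \<in> neg_loops" for m
    by (rule gauge_action_eq[OF loopsD(1)[OF that] ad_low_nilpotent[OF loopsD(3)[OF that]]])
  show ?thesis unfolding Q_proj_def
  proof (rule the_equality)
    show "gauge_poly ord (gauge_fix z) z \<in> Q_space br e f \<and>
      (\<exists>m\<in>loops mm. gauge_poly ord (gauge_fix z) z = gauge_action br m z)"
      using gauge_fix_Q[OF zl z1] gauge_fix_mm[OF zl z1 zb] ga[OF gauge_fix_neg[OF zl z1]] by metis
    fix q assume q: "q \<in> Q_space br e f \<and> (\<exists>m\<in>loops mm. q = gauge_action br m z)"
    then obtain m where m: "m \<in> loops mm" "q = gauge_action br m z" by blast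
    have n: "m \<in> neg_loops" by (rule loops_mono[OF m(1) mm_subset_low])
    have "m = gauge_fix z" using q m(2) ga[OF n] by (intro gauge_fix_unique[OF zl z1 n]) simp
    then show "q = gauge_poly ord (gauge_fix z) z" using m(2) ga[OF n] by simp
  qed
qed

lemma exp_ad1_zero: "exp_ad1 N a 0 = 0"
proof -
  have "((\<lambda>v. - br a v) ^^ k) 0 = 0" for k by (induction k) (auto simp: R.zero)
  then show ?thesis by (simp add: exp_ad1_def)
qed

lemma Q_proj_id: assumes q: "q \<in> Q_space br e f" shows "Q_proj br e f \<Gamma> l q = q"
proof -
  have 0: "gauge_poly ord (\<lambda>x. 0) q = q"
    by (auto simp: gauge_poly_def P2_def loop_deriv_zero R.zero exp_ad1_zero)
  have "(\<lambda>x. 0) = gauge_fix q"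
    using q 0 by (intro gauge_fix_unique Q_spaceD(1)[OF q] low_mono[OF Q_spaceD(3)[OF q]] loops_const low_zero) auto
  then show ?thesis using Q_proj_eq[of q] Q_subset_S q 0 by auto
qed

definition retract :: "'n loop \<Rightarrow> 'n loop" where
  "retract q = (let z = (\<lambda>x. e + low1_proj (q x - e)) in gauge_poly ord (gauge_fix z) z)"

lemma loops_low1: "q \<in> loops UNIV \<Longrightarrow> (\<lambda>x. e + low1_proj (q x - e)) \<in> loops UNIV"
  by (intro loops_add loops_linear[OF linear_low1_proj] loops_diff loops_const UNIV_I)

lemma retract_Q: "q \<in> loops UNIV \<Longrightarrow> retract q \<in> Q_space br e f"
  unfolding retract_def Let_def by (intro gauge_fix_Q loops_low1) (simp_all add: low1_proj_low)

lemma retract_low: "(\<And>x. z x - e \<in> low 1) \<Longrightarrow> retract z = gauge_poly ord (gauge_fix z) z"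
  by (simp add: retract_def low1_proj_id)

lemma local_map_low1: "local_map (\<lambda>q x. e + low1_proj (q x - e))"
  by (rule local_map_add[OF local_map_const[OF loops_const[OF UNIV_I]]
        local_map_linear[OF linear_low1_proj local_map_diff[OF local_map_id local_map_const[OF loops_const[OF UNIV_I]]]]])

text \<open>The number of iterations is the same for all loops, so gauge fixing is a finite
  combination of operations that have adjoints.\<close>

lemma local_map_gauge_fix:
  assumes \<Psi>: "local_map \<Psi>" shows "local_map (\<lambda>q. gauge_fix (\<Psi> q))"
proof -
  have "local_map (\<lambda>q. (gauge_step (\<Psi> q) ^^ k) (\<lambda>x. 0))" for k
  proof (induction k)
    case 0
    show ?case using local_map_const[OF loops_const[of 0 UNIV]] by simp
  next
    case (Suc k)
    have "local_map (\<lambda>q. gauge_step (\<Psi> q) ((gauge_step (\<Psi> q) ^^ k) (\<lambda>x. 0)))"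
      unfolding gauge_step_def[of "\<Psi> _" "(gauge_step (\<Psi> _) ^^ k) _"]
      by (rule local_map_linear[OF linear_slice_inv local_map_diff[OF local_map_linear[OF linear_right Suc]
          local_map_diff[OF local_map_gauge_poly[OF Suc \<Psi>] local_map_const[OF loops_const[OF UNIV_I]]]]])
    then show ?case by simp
  qed
  then show ?thesis unfolding gauge_fix_def .
qed

lemma local_map_retract: "local_map retract"
  unfolding retract_def[abs_def] Let_def
  by (rule local_map_gauge_poly[OF local_map_gauge_fix[OF local_map_low1] local_map_low1])

text \<open>The linearized gauge condition at \<open>q\<close>: solve \<open>P2 br q u = w\<close>
  up to the centralizer of \<open>f\<close>. Moving everything except \<open>[e, u]\<close> to the
  other side gives a fixed-point equation; since \<open>q - e\<close> has degree at most 0, the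
  unknown terms do not raise degrees and \<open>slice_inv\<close> makes the map contract. The space
  \<open>V\<close> is a parameter because the equation is solved in \<open>low (-1)\<close>, in
  \<open>m\<close> and in the range of \<open>ad f\<close>.\<close>

lemma affine_contraction:
  assumes q: "q \<in> Q_space br e f" and V: "vec.subspace V"
    and w: "w \<in> loops UNIV" and step: "\<And>u x. u \<in> loops V \<Longrightarrow> \<sigma> (w x - loop_deriv u x - br (q x - e) (u x)) \<in> V"
    and Vr: "V \<subseteq> range (br f)"
  shows "\<exists>u\<in>loops V. (\<forall>x. w x - P2 br q u x \<in> cen) \<and>
           (\<forall>v\<in>loops V. (\<forall>x. w x - P2 br q v x \<in> cen) \<longrightarrow> v = u)"
proof -
  define T where "T u = (\<lambda>x. \<sigma> (w x - loop_deriv u x - br (q x - e) (u x)))" for u :: "'n loop"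
  have lT: "T u \<in> loops V" if "u \<in> loops V" for u
  proof (subst loops_iff, intro conjI allI)
    show "T u \<in> loops UNIV" unfolding T_def
      by (rule loops_linear[OF linear_slice_inv loops_diff[OF loops_diff[OF w loops_loop_deriv[OF loops_UNIV[OF that]]]
            loops_br[OF loops_diff[OF Q_spaceD(1)[OF q] loops_const[OF UNIV_I]] loops_UNIV[OF that]]]])
    show "T u x \<in> V" for x unfolding T_def by (rule step[OF that])
  qed
  have cT: "T u x - T u' x \<in> low (k - 1)" if u: "u \<in> loops V" "u' \<in> loops V" and d: "\<And>x. u x - u' x \<in> low k" for u u' k x
  proof -
    have dl: "(\<lambda>x. u x - u' x) \<in> loops (low k)"
      using loops_diff[OF loops_UNIV[OF u(1)] loops_UNIV[OF u(2)]] d by (subst loops_iff) auto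
    have "loop_deriv u x - loop_deriv u' x \<in> low k"
      using loop_deriv_in[OF dl subspace_low] loop_deriv_diff[OF loopsD(1)[OF u(1)] loopsD(1)[OF u(2)]] by simp
    moreover have "br (q x - e) (u x) - br (q x - e) (u' x) \<in> low k"
      using low_br[OF Q_spaceD(3)[OF q] d] by (simp add: R.diff)
    ultimately have "- (loop_deriv u x - loop_deriv u' x + (br (q x - e) (u x) - br (q x - e) (u' x))) \<in> low k"
      by (intro low_minus low_add)
    then have "\<sigma> (- (loop_deriv u x - loop_deriv u' x + (br (q x - e) (u x) - br (q x - e) (u' x)))) \<in> low (k - 1)"
      by (intro low_mono[OF slice_inv_low]) auto
    then show ?thesis unfolding T_def by (simp add: \<sigma>.diff \<sigma>.add \<sigma>.neg algebra_simps)
  qed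
  have z: "(\<lambda>x. 0) \<in> loops V" by (rule loops_const[OF vec.subspace_0[OF V]])
  define u where "u = (T ^^ ord) (\<lambda>x. 0)"
  have u1: "u \<in> loops V"
    unfolding u_def by (rule graded_contraction(1)[where X = "loops V" and T = T, OF lT cT z])
  have u2: "T u = u"
    unfolding u_def by (rule graded_contraction(2)[where X = "loops V" and T = T, OF lT cT z])
  have "w x - P2 br q u x \<in> cen" for x
  proof -
    have "w x - loop_deriv u x - br (q x - e) (u x) - br e (\<sigma> (w x - loop_deriv u x - br (q x - e) (u x))) \<in> cen"
      by (rule slice_inv(2))
    moreover have "\<sigma> (w x - loop_deriv u x - br (q x - e) (u x)) = u x"
      using fun_cong[OF u2, of x] by (simp add: T_def)
    ultimately show ?thesis by (simp add: P2_def br_simps algebra_simps)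
  qed
  moreover have "v = u" if v: "v \<in> loops V" "\<And>x. w x - P2 br q v x \<in> cen" for v
  proof -
    have Tv: "T v = v"
    proof
      fix x
      have "w x - loop_deriv v x - br (q x - e) (v x) - br e (v x) \<in> cen"
        using v(2)[of x] by (simp add: P2_def br_simps algebra_simps)
      then show "T v x = v x" unfolding T_def using loopsD(3)[OF v(1)] Vr by (intro slice_inv_eqI) auto
    qed
    show ?thesis
      unfolding u_def by (rule graded_contraction(3)[where X = "loops V" and T = T, OF lT cT z v(1) Tv])
  qed
  ultimately show ?thesis using u1 by blast
qed

text \<open>Uniqueness in the linearized equation with right-hand side 0: the infinitesimal gauge
  directions of negative degree meet the tangent space of \<open>Q\<close> only in zero.\<close>

lemma transversal:
  assumes q: "q \<in> Q_space br e f" and n: "n \<in> neg_loops" and P: "\<And>x. P2 br q n x \<in> cen"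
  shows "n x = 0"
proof -
  have z: "(\<lambda>x. 0) \<in> neg_loops" by (rule loops_const[OF low_zero])
  have st: "\<sigma> (0 - loop_deriv u x - br (q x - e) (u x)) \<in> low (-1)" if u: "u \<in> neg_loops" for u x
  proof -
    have "br (q x - e) (u x) \<in> low (-1)" using low_br[OF Q_spaceD(3)[OF q] loopsD(3)[OF u]] by simp
    then have "0 - loop_deriv u x - br (q x - e) (u x) \<in> low (-1)"
      by (intro low_diff low_zero loop_deriv_in[OF u subspace_low])
    then show ?thesis by (intro low_mono[OF slice_inv_low]) auto
  qed
  from affine_contraction[OF q subspace_low loops_const[OF UNIV_I] st low_range]
  obtain u where u: "\<And>v. v \<in> neg_loops \<Longrightarrow> (\<And>x. 0 - P2 br q v x \<in> cen) \<Longrightarrow> v = u"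
    by metis
  have "n = u" using P vec.subspace_neg[OF subspace_cen] by (intro u n) simp
  moreover have "(\<lambda>x. 0) = u"
    by (intro u z) (simp add: P2_def loop_deriv_zero R.zero vec.subspace_0[OF subspace_cen])
  ultimately show ?thesis by metis
qed

lemma decompose_bb:
  assumes q: "q \<in> Q_space br e f" and y: "y \<in> loops bb"
  obtains m where "m \<in> loops mm" "\<And>x. y x - P2 br q m x \<in> cen"
proof -
  have mr: "mm \<subseteq> range (br f)" using mm_subset_low low_range by blast
  have st: "\<sigma> (y x - loop_deriv u x - br (q x - e) (u x)) \<in> mm" if u: "u \<in> loops mm" for u x
  proof -
  have n: "u \<in> neg_loops" by (rule loops_mono[OF u mm_subset_low])
  have "loop_deriv u x \<in> low 0" "br (q x - e) (u x) \<in> low 0"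
    using low_mono[OF loop_deriv_in[OF n subspace_low]] low_mono[OF low_br[OF Q_spaceD(3)[OF q] loopsD(3)[OF n]]] by auto
  then have "w' \<in> bb" if "w' = loop_deriv u x \<or> w' = br (q x - e) (u x)" for w'
    using that low_subset_bb by blast
  then show ?thesis
    by (intro slice_inv_bb vec.subspace_diff subspace_bb loopsD(3)[OF y]) auto
  qed
  from affine_contraction[OF q subspace_mm loops_UNIV[OF y] st mr] show ?thesis using that by blast
qed

text \<open>The correction \<open>u\<close> is sought in the range of \<open>ad f\<close>, which is
  Killing orthogonal to the centralizer of \<open>f\<close>; it therefore adjusts the Hamiltonian
  vector without changing the covector on \<open>Q\<close>.\<close>

lemma lift_covector:
  assumes q: "q \<in> Q_space br e f" and v: "v \<in> loops UNIV"
  obtains v' where "v' \<in> loops UNIV" "\<And>x. P2 br q v' x \<in> cen"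
    "\<And>w. w \<in> loops cen \<Longrightarrow> pairing br v' w = pairing br v w"
proof -
  obtain u where u: "u \<in> loops (range (br f))" "\<And>x. P2 br q v x - P2 br q u x \<in> cen"
    using affine_contraction[OF q subspace_range loops_P2[OF Q_spaceD(1)[OF q] v] slice_inv(1) order.refl]
    by blast
  define v' where "v' x = v x - u x" for x
  have "v' \<in> loops UNIV" unfolding v'_def by (rule loops_diff[OF v loops_UNIV[OF u(1)]])
  moreover have "P2 br q v' x = P2 br q v x - P2 br q u x" for x
    unfolding P2_def v'_def using loop_deriv_diff[OF loopsD(1)[OF v] loopsD(1)[OF u(1)]] by (simp add: br_simps)
  moreover have "pairing br v' w = pairing br v w" if w: "w \<in> loops cen" for w
  proof -
    have "pairing br u w = 0"
      by (rule pairing_0) (subst killing_sym, rule killing_cen_range[OF loopsD(3)[OF w] loopsD(3)[OF u(1)]])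
    then show ?thesis
      unfolding v'_def using pairing_diff_left[OF v loops_UNIV[OF u(1)] loops_UNIV[OF w]] by simp
  qed
  ultimately show ?thesis using that u(2) by metis
qed

end

section \<open>The reduced bracket\<close>

context good_slice
begin

lemma D_distI: "n \<in> loops nn \<Longrightarrow> P2 br z n \<in> D_dist br e \<Gamma> l z"
  by (simp add: D_dist_def)

text \<open>The straight line in direction \<open>P2 br z n\<close> may leave \<open>S\<close> but
  stays in \<open>e + L(low 1)\<close>, where \<open>retract\<close> is the gauge transform. Its
  image has velocity \<open>P2 br (q 0) w\<close> with \<open>w\<close> of negative degree; the
  image lies in \<open>Q\<close>, so this velocity is tangent to \<open>Q\<close> and transversality
  forces \<open>w = 0\<close>.\<close>

lemma retract_velocity:
  assumes z: "z \<in> S_space br e \<Gamma> l" and n: "n \<in> loops nn"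
  shows "curve_velocity (\<lambda>t. retract (\<lambda>x. z x + t *\<^sub>R P2 br z n x)) = (\<lambda>x. 0)"
proof -
  define Z where "Z t x = z x + t *\<^sub>R P2 br z n x" for t x
  define M where "M t = gauge_fix (Z t)" for t
  define q where "q t = gauge_poly ord (M t) (Z t)" for t
  have zl: "z \<in> loops UNIV" and z1: "\<And>x. z x - e \<in> low 1"
    using z bb_subset_low by (auto simp: S_space_iff)
  have nneg: "n \<in> neg_loops" by (rule loops_mono[OF n nn_subset_low])
  have Pl: "P2 br z n \<in> loops UNIV" by (rule loops_P2[OF zl loops_UNIV[OF n]])
  have P1: "P2 br z n x \<in> low 1" for x by (rule P2_neg[OF zl z1 nneg])
  have cZ: "smooth_curve_in (loops UNIV) Z" and vZ: "curve_velocity Z = P2 br z n"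
    using smooth_curve_line[OF zl Pl] unfolding Z_def by blast+
  have Zl: "Z t \<in> loops UNIV" for t using cZ by (simp add: smooth_curve_in_def)
  have Z1: "Z t x - e \<in> low 1" for t x
    using low_add[OF z1 low_scaleR[OF P1], of x t x] by (simp add: Z_def algebra_simps)
  have Z0: "Z 0 = z" by (simp add: Z_def fun_eq_iff)
  have rq: "retract (Z t) = q t" for t unfolding q_def M_def by (rule retract_low[OF Z1])
  have Mn: "M t \<in> neg_loops" for t unfolding M_def by (rule gauge_fix_neg[OF Zl Z1])
  have cM: "smooth_curve_in (loops UNIV) M"
  proof -
    have "M = (\<lambda>t. gauge_fix (\<lambda>x. e + low1_proj (Z t x - e)))"
      using Z1 by (simp add: M_def low1_proj_id fun_eq_iff)
    then show ?thesis using local_map_curve[OF local_map_gauge_fix[OF local_map_low1] cZ] by simp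
  qed
  have cq: "smooth_curve_in (loops UNIV) q"
    using local_map_curve[OF local_map_retract cZ] by (simp add: rq)
  have qQ: "q t \<in> Q_space br e f" for t using retract_Q[OF Zl[of t]] by (simp add: rq)
  define w where "w x = n x + exp_ad1 ord (M 0 x) (- br (M 0 x) (n x)) + exp_ad1 ord (M 0 x) (curve_velocity M x)" for x
  have vq: "curve_velocity q x = P2 br (q 0) w x" for x
    unfolding q_def w_def
    by (rule gauge_poly_velocity[OF cM cZ loops_UNIV[OF n] _ ad_low_nilpotent[OF loopsD(3)[OF Mn]]])
      (use cq in \<open>simp_all add: vZ Z0 q_def[abs_def]\<close>)
  have wl: "w \<in> neg_loops"
  proof (subst loops_iff, intro conjI allI)
    have m0: "M 0 \<in> loops UNIV" and nU: "n \<in> loops UNIV" using loops_UNIV[OF Mn] loops_UNIV[OF n] .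
    show "w \<in> loops UNIV" unfolding w_def
      by (rule loops_add[OF loops_add[OF nU loops_exp_ad1[OF m0 loops_minus[OF loops_br[OF m0 nU]]]]
            loops_exp_ad1[OF m0 loops_curve_velocity[OF cM]]])
    fix x
    have "curve_velocity M x \<in> low (-1)"
    proof (rule has_vector_derivative_in_subspace[OF _ subspace_low])
      have s: "smooth_map (uncurry_curve M)" using cM by (simp add: smooth_curve_in_def)
      show "((\<lambda>t. M t x) has_vector_derivative curve_velocity M x) (at 0)"
        using has_vector_derivative_curve[OF s, of x 0] curve_velocity_eq[OF s, of x] by simp
      show "M t x \<in> low (-1)" for t using loopsD(3)[OF Mn] .
    qed
    moreover have "- br (M 0 x) (n x) \<in> low (-1)"
      by (intro low_minus low_mono[OF low_br[OF loopsD(3)[OF Mn] loopsD(3)[OF nneg]]]) simp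
    ultimately show "w x \<in> low (-1)" unfolding w_def
      by (intro low_add exp_ad1_low loopsD(3)[OF Mn] loopsD(3)[OF nneg])
  qed
  have "curve_velocity q x \<in> cen" for x
  proof (rule has_vector_derivative_in_subspace[OF _ subspace_cen])
    have s: "smooth_map (uncurry_curve q)" using cq by (simp add: smooth_curve_in_def)
    have "((\<lambda>t. q t x) has_vector_derivative curve_velocity q x) (at 0)"
      using has_vector_derivative_curve[OF s, of x 0] curve_velocity_eq[OF s, of x] by simp
    then show "((\<lambda>t. q t x - e) has_vector_derivative curve_velocity q x) (at 0)"
      by (auto intro!: derivative_eq_intros)
    show "q t x - e \<in> cen" for t by (rule Q_spaceD(2)[OF qQ])
  qed
  then have "P2 br (q 0) w x \<in> cen" for x by (simp add: vq)
  then have "w = (\<lambda>x. 0)" using transversal[OF qQ wl] by blast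
  then have "curve_velocity q = (\<lambda>x. 0)" by (auto simp: vq P2_def loop_deriv_zero R.zero)
  then show ?thesis using rq by (simp add: Z_def[abs_def])
qed

text \<open>The differential of \<open>\<phi>\<close> is available only along curves in
  \<open>Q\<close>; \<open>retract\<close> turns every smooth curve of loops into such a curve, and
  its adjoint carries the representing loop back to the full loop space.\<close>

lemma adapted_extension_retract:
  assumes \<phi>: "functional_on br (Q_space br e f) \<phi>"
  shows "adapted_extension br e f \<Gamma> l \<phi> (\<lambda>q. \<phi> (retract q))"
proof -
  have along: "\<exists>v\<in>loops UNIV. \<forall>\<gamma>. smooth_curve_in (loops UNIV) \<gamma> \<and> \<gamma> 0 = q \<longrightarrow>
      ((\<lambda>t. \<phi> (retract (\<gamma> t))) has_vector_derivative pairing br v (curve_velocity (\<lambda>t. retract (\<gamma> t)))) (at 0)"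
    if q: "q \<in> loops UNIV" for q
  proof -
    obtain v where v: "represents_differential br (Q_space br e f) \<phi> (retract q) v"
      using \<phi> retract_Q[OF q] by (auto simp: functional_on_def)
    have "((\<lambda>t. \<phi> (retract (\<gamma> t))) has_vector_derivative pairing br v (curve_velocity (\<lambda>t. retract (\<gamma> t)))) (at 0)"
      if g: "smooth_curve_in (loops UNIV) \<gamma>" "\<gamma> 0 = q" for \<gamma>
    proof -
      have "smooth_curve_in (Q_space br e f) (\<lambda>t. retract (\<gamma> t))"
        using local_map_curve[OF local_map_retract g(1)] g(1) retract_Q by (simp add: smooth_curve_in_def)
      then show ?thesis using v g(2) unfolding represents_differential_def curve_velocity_def by simp
    qed
    moreover have "v \<in> loops UNIV" using v by (simp add: represents_differential_def)
    ultimately show ?thesis by (intro bexI[of _ v]) simp_all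
  qed
  have F: "functional_on br (loops UNIV) (\<lambda>q. \<phi> (retract q))"
    unfolding functional_on_def
  proof
    fix q :: "'n loop" assume q: "q \<in> loops UNIV"
    obtain v where v: "v \<in> loops UNIV" "\<And>\<gamma>. smooth_curve_in (loops UNIV) \<gamma> \<Longrightarrow> \<gamma> 0 = q \<Longrightarrow>
      ((\<lambda>t. \<phi> (retract (\<gamma> t))) has_vector_derivative pairing br v (curve_velocity (\<lambda>t. retract (\<gamma> t)))) (at 0)"
      using along[OF q] by auto
    obtain u where u: "u \<in> loops UNIV" "\<And>\<gamma>. smooth_curve_in (loops UNIV) \<gamma> \<Longrightarrow> \<gamma> 0 = q \<Longrightarrow>
      pairing br v (curve_velocity (\<lambda>t. retract (\<gamma> t))) = pairing br u (curve_velocity \<gamma>)"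
      by (rule local_map_adjoint[OF local_map_retract q v(1)]) (rule that)
    have "represents_differential br (loops UNIV) (\<lambda>q. \<phi> (retract q)) q u"
      unfolding represents_differential_def curve_velocity_def[symmetric]
      using u v(2) by auto
    then show "\<exists>v. represents_differential br (loops UNIV) (\<lambda>q. \<phi> (retract q)) q v" by (rule exI[where x = u])
  qed
  moreover have "\<phi> (retract z) = \<phi> (Q_proj br e f \<Gamma> l z)" if z: "z \<in> S_space br e \<Gamma> l" for z
    using z bb_subset_low by (subst Q_proj_eq[OF z], subst retract_low) (auto simp: S_space_iff)
  moreover have "pairing br (gradient br (\<lambda>q. \<phi> (retract q)) z) w = 0"
    if z: "z \<in> S_space br e \<Gamma> l" and w: "w \<in> D_dist br e \<Gamma> l z" for z w
  proof -
    obtain n where n: "n \<in> loops nn" "w = P2 br z n" using w by (auto simp: D_dist_def)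
    have zl: "z \<in> loops UNIV" using z by (simp add: S_space_iff)
    have wl: "w \<in> loops UNIV" unfolding n(2) by (rule loops_P2[OF zl loops_UNIV[OF n(1)]])
    have "((\<lambda>t. \<phi> (retract (\<lambda>x. z x + t *\<^sub>R w x))) has_vector_derivative
        pairing br (gradient br (\<lambda>q. \<phi> (retract q)) z) w) (at 0)"
      by (rule represents_differential_line[OF gradient_represents[OF F zl] zl wl])
        (use smooth_curve_line(1)[OF zl wl] in \<open>simp add: smooth_curve_in_def\<close>)
    \<comment> \<open>The gradient is a choice of representative, so its pairing with
      \<open>w\<close> is found by computing the same derivative once more with the chain
      rule.\<close>
    moreover obtain v where "\<And>\<gamma>. smooth_curve_in (loops UNIV) \<gamma> \<Longrightarrow> \<gamma> 0 = z \<Longrightarrow>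
      ((\<lambda>t. \<phi> (retract (\<gamma> t))) has_vector_derivative pairing br v (curve_velocity (\<lambda>t. retract (\<gamma> t)))) (at 0)"
      using along[OF zl] by auto
    from this[OF smooth_curve_line(1)[OF zl wl]]
    have "((\<lambda>t. \<phi> (retract (\<lambda>x. z x + t *\<^sub>R w x))) has_vector_derivative 0) (at 0)"
      by (simp add: n(2) retract_velocity[OF z n(1)] pairing_0)
    ultimately show ?thesis by (rule vector_derivative_unique_at)
  qed
  ultimately show ?thesis unfolding adapted_extension_def by blast
qed

text \<open>A straight line with direction in the centralizer stays in \<open>Q\<close>, where the
  projection is the identity; hence \<open>F\<close> and \<open>\<phi>\<close> agree along
  it.\<close>

lemma adapted_differential_on_Q:
  assumes F: "adapted_extension br e f \<Gamma> l \<phi> F" and q: "q \<in> Q_space br e f"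
    and v: "represents_differential br (Q_space br e f) \<phi> q v" and w: "w \<in> loops cen"
  shows "pairing br (gradient br F q) w = pairing br v w"
proof -
  have qU: "q \<in> loops UNIV" and wU: "w \<in> loops UNIV" by (rule Q_spaceD(1)[OF q], rule loops_UNIV[OF w])
  have lQ: "(\<lambda>x. q x + t *\<^sub>R w x) \<in> Q_space br e f" for t
    unfolding Q_space_def affine_loops_iff
  proof (intro conjI allI)
    show "(\<lambda>x. q x + t *\<^sub>R w x) \<in> loops UNIV"
      using smooth_curve_line(1)[OF qU wU] by (simp add: smooth_curve_in_def)
    fix x
    have "(q x - e) + t *\<^sub>R w x \<in> cen" unfolding scaleR_eq_smult
      by (intro vec.subspace_add vec.subspace_scale subspace_cen Q_spaceD(2)[OF q] loopsD(3)[OF w])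
    then show "q x + t *\<^sub>R w x - e \<in> cen" by (simp add: algebra_simps)
  qed
  have "F p = \<phi> p" if "p \<in> Q_space br e f" for p
    using F Q_subset_S that Q_proj_id[OF that] by (auto simp: adapted_extension_def)
  then have F\<phi>: "F (\<lambda>x. q x + t *\<^sub>R w x) = \<phi> (\<lambda>x. q x + t *\<^sub>R w x)" for t using lQ by blast
  have fF: "functional_on br (loops UNIV) F" using F by (simp add: adapted_extension_def)
  have "((\<lambda>t. F (\<lambda>x. q x + t *\<^sub>R w x)) has_vector_derivative pairing br (gradient br F q) w) (at 0)"
    by (rule represents_differential_line[OF gradient_represents[OF fF qU] qU wU])
      (rule Q_spaceD(1)[OF lQ])
  moreover have "((\<lambda>t. F (\<lambda>x. q x + t *\<^sub>R w x)) has_vector_derivative pairing br v w) (at 0)"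
    unfolding F\<phi> by (rule represents_differential_line[OF v qU wU lQ])
  ultimately show ?thesis by (rule vector_derivative_unique_at)
qed

text \<open>The value of the bracket is the Dirac reduction of the second bracket to \<open>Q\<close>: the covector
  \<open>v'\<close> lifts the differential of \<open>\<phi>\<close> so that its Hamiltonian vector is tangent to \<open>Q\<close>. Neither \<open>\<Gamma>\<close>
  nor \<open>l\<close> enters.\<close>

lemma bracket2_adapted:
  assumes F: "adapted_extension br e f \<Gamma> l \<phi> F" and G: "adapted_extension br e f \<Gamma> l \<psi> G"
    and q: "q \<in> Q_space br e f"
    and v: "represents_differential br (Q_space br e f) \<phi> q v"
    and u: "represents_differential br (Q_space br e f) \<psi> q u"
    and v': "v' \<in> loops UNIV" "\<And>x. P2 br q v' x \<in> cen"
      "\<And>w. w \<in> loops cen \<Longrightarrow> pairing br v' w = pairing br v w"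
  shows "bracket2 br F G q = - pairing br u (P2 br q v')"
proof -
  have qU: "q \<in> loops UNIV" and qS: "q \<in> S_space br e \<Gamma> l"
    using q Q_subset_S by (auto intro: Q_spaceD(1))
  define a where "a = gradient br F q"
  define b where "b = gradient br G q"
  have "represents_differential br (loops UNIV) F q a" "represents_differential br (loops UNIV) G q b"
    using F G qU unfolding a_def b_def adapted_extension_def by (auto intro: gradient_represents)
  then have a: "a \<in> loops UNIV" and b: "b \<in> loops UNIV" by (simp_all add: represents_differential_def)
  have aD: "pairing br a (P2 br q n) = 0" and bD: "pairing br b (P2 br q n) = 0" if "n \<in> loops nn" for n
    using F G qS D_distI[OF that] unfolding a_def b_def adapted_extension_def by blast+
  define y where "y = P2 br q b"
  have yU: "y \<in> loops UNIV" unfolding y_def by (rule loops_P2[OF qU b])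
  have "y \<in> loops bb"
  proof (subst loops_iff, intro conjI allI yU)
    fix x
    have "killing br (y x) t = 0" if t: "t \<in> nn" for t
    proof (rule pairing_zero_imp_orthogonal[OF yU subspace_nn t])
      fix n assume n: "n \<in> loops nn"
      show "pairing br y n = 0"
        using pairing_P2_skew[OF qU b loops_UNIV[OF n]] bD[OF n] by (simp add: y_def)
    qed
    then show "y x \<in> bb" by (simp add: b_space_def)
  qed
  then obtain m where m: "m \<in> loops mm" "\<And>x. y x - P2 br q m x \<in> cen"
    using decompose_bb[OF q] by blast
  have mn: "m \<in> loops nn" by (rule loops_mono[OF m(1) mm_subset_nn])
  have PmU: "P2 br q m \<in> loops UNIV" by (rule loops_P2[OF qU loops_UNIV[OF m(1)]])
  define c where "c x = y x - P2 br q m x" for x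
  have c: "c \<in> loops cen"
    using m(2) loops_diff[OF yU PmU] by (subst loops_iff) (auto simp: c_def[abs_def])
  have y: "y = (\<lambda>x. c x + P2 br q m x)" by (auto simp: c_def)
  have P': "P2 br q v' \<in> loops cen" using v'(2) loops_P2[OF qU v'(1)] by (subst loops_iff) auto
  \<comment> \<open>Like \<open>a\<close>, the lift annihilates the gauge directions of
    \<open>m\<close>: by skewness this is the pairing of a loop in degree at most 0 with one in
    negative degree.\<close>
  have "pairing br v' (P2 br q m) = - pairing br (P2 br q v') m"
    by (rule pairing_P2_skew[OF qU v'(1) loops_UNIV[OF m(1)]])
  also have "pairing br (P2 br q v') m = 0"
    by (rule pairing_0, rule killing_low[OF cen_low[OF v'(2)] subsetD[OF mm_subset_low loopsD(3)[OF m(1)]]]) simp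
  finally have vm: "pairing br v' (P2 br q m) = 0" by simp
  have "pairing br a y = pairing br a c + pairing br a (P2 br q m)"
    unfolding y by (rule pairing_add_right[OF a loops_UNIV[OF c] PmU])
  also have "\<dots> = pairing br v' c + pairing br v' (P2 br q m)"
    using adapted_differential_on_Q[OF F q v c] v'(3)[OF c] aD[OF mn] vm by (simp add: a_def)
  also have "\<dots> = pairing br v' y"
    unfolding y by (rule pairing_add_right[OF v'(1) loops_UNIV[OF c] PmU, symmetric])
  also have "\<dots> = - pairing br b (P2 br q v')"
    unfolding y_def pairing_P2_skew[OF qU v'(1) b] by (subst pairing_sym) simp
  also have "pairing br b (P2 br q v') = pairing br u (P2 br q v')"
    unfolding b_def by (rule adapted_differential_on_Q[OF G q u P'])
  finally show ?thesis by (simp add: bracket2_def a_def y_def b_def)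
qed

lemma reduced_bracket2_eq:
  assumes \<phi>: "functional_on br (Q_space br e f) \<phi>" and \<psi>: "functional_on br (Q_space br e f) \<psi>"
    and q: "q \<in> Q_space br e f"
    and v: "represents_differential br (Q_space br e f) \<phi> q v"
    and u: "represents_differential br (Q_space br e f) \<psi> q u"
    and v': "v' \<in> loops UNIV" "\<And>x. P2 br q v' x \<in> cen"
      "\<And>w. w \<in> loops cen \<Longrightarrow> pairing br v' w = pairing br v w"
  shows "reduced_bracket2 br e f \<Gamma> l \<phi> \<psi> q = - pairing br u (P2 br q v')"
  unfolding reduced_bracket2_def
proof (rule the_equality)
  note val = bracket2_adapted[OF _ _ q v u v']
  show "\<exists>F G. adapted_extension br e f \<Gamma> l \<phi> F \<and> adapted_extension br e f \<Gamma> l \<psi> G \<and>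
      - pairing br u (P2 br q v') = bracket2 br F G q"
    using adapted_extension_retract[OF \<phi>] adapted_extension_retract[OF \<psi>]
      val[OF adapted_extension_retract[OF \<phi>] adapted_extension_retract[OF \<psi>]] by metis
  show "c = - pairing br u (P2 br q v')"
    if "\<exists>F G. adapted_extension br e f \<Gamma> l \<phi> F \<and> adapted_extension br e f \<Gamma> l \<psi> G \<and> c = bracket2 br F G q" for c
    using that val by blast
qed

end

theorem theorem3p8:
  fixes br :: "'n::finite bracket"
    and e h f :: "complex^'n"
    and \<Gamma>\<^sub>1 \<Gamma>\<^sub>2 :: "int \<Rightarrow> (complex^'n) set"
    and l\<^sub>1 l\<^sub>2 :: "(complex^'n) set"
    and \<phi> \<psi> :: "'n loop \<Rightarrow> complex"
    and q :: "'n loop"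
  assumes "simple_lie_algebra br"
    and "ad_nilpotent br f"
    and "sl2_triple br e h f"
    and "good_grading br f \<Gamma>\<^sub>1" and "compatible_grading e h \<Gamma>\<^sub>1" and "isotropic br e \<Gamma>\<^sub>1 l\<^sub>1"
    and "good_grading br f \<Gamma>\<^sub>2" and "compatible_grading e h \<Gamma>\<^sub>2" and "isotropic br e \<Gamma>\<^sub>2 l\<^sub>2"
    and "functional_on br (Q_space br e f) \<phi>"
    and "functional_on br (Q_space br e f) \<psi>"
    and "q \<in> Q_space br e f"
  shows "reduced_bracket2 br e f \<Gamma>\<^sub>1 l\<^sub>1 \<phi> \<psi> q = reduced_bracket2 br e f \<Gamma>\<^sub>2 l\<^sub>2 \<phi> \<psi> q"
proof (cases "f = 0")
  case True
  have lie: "lie_algebra br" using assms(1) by (simp add: simple_lie_algebra_def)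
  show ?thesis
    using good_grading_0[OF assms(4)[unfolded True] lie assms(6)] good_grading_0[OF assms(7)[unfolded True] lie assms(9)]
    by simp
next
  case False
  have lie: "lie_alg br" using assms(1) by (simp add: lie_alg_def simple_lie_algebra_def)
  have graded: "graded_lie_alg br \<Gamma>" if "good_grading br f \<Gamma>" for \<Gamma>
    using that lie by (simp add: graded_lie_alg_def graded_lie_alg_axioms_def good_grading_def)
  have "e \<in> \<Gamma>\<^sub>1 2" "f \<in> \<Gamma>\<^sub>1 (-2)" using assms(4,5) by (auto simp: good_grading_def compatible_grading_def)
  from graded_lie_alg.killing_h_h_neq_0[OF graded[OF assms(4)] this assms(3) False]
  have nd: "nondegenerate_lie_alg br"
    unfolding nondegenerate_lie_alg_def nondegenerate_lie_alg_axioms_def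
    using lie killing_nondegenerate[OF assms(1)] by blast
  have gs: "good_slice br \<Gamma> e h f l"
    if "good_grading br f \<Gamma>" "compatible_grading e h \<Gamma>" "isotropic br e \<Gamma> l" for \<Gamma> l
    using nd graded[OF that(1)] that assms(3) by (simp add: good_slice_def good_slice_axioms_def)
  obtain v u where v: "represents_differential br (Q_space br e f) \<phi> q v"
    and u: "represents_differential br (Q_space br e f) \<psi> q u"
    using bspec[OF assms(10)[unfolded functional_on_def] assms(12)]
      bspec[OF assms(11)[unfolded functional_on_def] assms(12)] by blast
  have "v \<in> loops UNIV" using v by (simp add: represents_differential_def)
  \<comment> \<open>The lift is constructed with the first grading, but the three properties
    recorded here mention only \<open>br\<close>, \<open>e\<close>, \<open>f\<close> through
    \<open>q\<close> and the centralizer, so the same loop computes the bracket for the second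
    one.\<close>
  then obtain v' where v': "v' \<in> loops UNIV" "\<And>x. P2 br q v' x \<in> centralizer br f"
    "\<And>w. w \<in> loops (centralizer br f) \<Longrightarrow> pairing br v' w = pairing br v w"
    using good_slice.lift_covector[OF gs[OF assms(4-6)] assms(12)] by metis
  have "reduced_bracket2 br e f \<Gamma> l \<phi> \<psi> q = - pairing br u (P2 br q v')"
    if "good_grading br f \<Gamma>" "compatible_grading e h \<Gamma>" "isotropic br e \<Gamma> l" for \<Gamma> l
    by (rule good_slice.reduced_bracket2_eq[OF gs[OF that] assms(10-12) v u v'])
  then show ?thesis using assms(4-9) by metis
qed

end
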